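(* Let $(M,\bar h,J)$ be a rotational hypersurface of type III in $\mathbb C^n\times\mathbb R$ ($\dim M=2n\ge4$) generated by the meridian $$\gamma:\ \mathbf z(s)=t(s)\mathbf n+q(s)\mathbf e,\qquad s\in I,$$ in the hyperbolic plane $O\mathbf{ne}$, with $t(s)>0$, $t'(s)\le-1$ for $s\in I$. Then the metric $$g=\bar h+(1-t')(\bar\eta\otimes\bar\eta+\tilde{\bar\eta}\otimes\tilde{\bar\eta})$$ is Bochner-Kähler if and only if $$s(t)=\int\frac{dt}{c_1t^4+c_2t^2+1},$$ where $c_1=\mathrm{const}$, $c_2=\mathrm{const}$ (i.e. there are real constants $c_1,c_2$ such that the inverse function $s(t)$ of $t(s)$ is an antiderivative of $1/(c_1t^4+c_2t^2+1)$).
   Context: Rotational hypersurfaces of type III: let $(\mathbb C^n,h',J_0)$ be the flat Kähler-Lorentz space with standard complex structure $J_0$ and $h'(\mathbf Z,\mathbf Z)=|z^1|^2+\dots+|z^{n-1}|^2-|z^n|^2$, and let $\mathbb R$ be spanned by $\mathbf e$ with $\mathbf e^2=+1$; the product metric on $\mathbb C^n\times\mathbb R$ is also denoted $h'$. For smooth functions $t(s)>0$, $q(s)$ on an interval $I$, the rotational hypersurface $M$ generated by the meridian $\gamma$ consists of the points $\mathbf Z=t(s)\mathbf n+q(s)\mathbf e$, $s\in I$, $\mathbf n\in\mathbb C^n$ with $h'(\mathbf n,\mathbf n)=-1$ (for the meridian, $\mathbf n$ is fixed). $M$ is of type III if its normals are space-like; $s$ is a natural parameter, $-t'^2+q'^2=-1$.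 Structures on $M$: $\bar h$ is the induced metric, of signature $(2(n-1),2)$; $\bar\xi=\partial\mathbf Z/\partial s$; $\tilde{\bar\xi}=J_0\mathbf n$; $\bar\eta=\bar h(\bar\xi,\cdot)$, $\tilde{\bar\eta}=\bar h(\tilde{\bar\xi},\cdot)$; $D$ is the $\bar h$-orthogonal complement of $\mathrm{span}\{\bar\xi,\tilde{\bar\xi}\}$ in $TM$; $J|_D=J_0$, $J\bar\xi=\tilde{\bar\xi}$, $J\tilde{\bar\xi}=-\bar\xi$. The metric $g$ is positive definite and Kähler with respect to $J$. A Kähler metric $g$ is Bochner-Kähler if its Bochner tensor vanishes: in local holomorphic coordinates, with curvature tensor $R$, Ricci tensor $\rho$ and scalar curvature $\tau$, where $R(X,Y)Z=\nabla_X\nabla_YZ-\nabla_Y\nabla_XZ-\nabla_{[X,Y]}Z$, $R(X,Y,Z,U)=g(R(X,Y)Z,U)$, $\rho(Y,Z)=\sum_iR(e_i,Y,Z,e_i)$, $\tau=\sum_i\rho(e_i,e_i)$, $$R_{\alpha\bar\beta\gamma\bar\delta}-\tfrac1{n+2}(g_{\alpha\bar\beta}\rho_{\gamma\bar\delta}+g_{\gamma\bar\beta}\rho_{\alpha\bar\delta}+g_{\gamma\bar\delta}\rho_{\alpha\bar\beta}+g_{\alpha\bar\delta}\rho_{\gamma\bar\beta})+\tfrac{\tau}{2(n+1)(n+2)}(g_{\alpha\bar\beta}g_{\gamma\bar\delta}+g_{\gamma\bar\beta}g_{\alpha\bar\delta})=0 .$$ *)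

theory Defs
  imports "HOL-Analysis.Analysis"
begin

section \<open>Smooth maps\<close>

fun Ck_on :: "nat \<Rightarrow> 'a::euclidean_space set \<Rightarrow> ('a \<Rightarrow> 'b::real_normed_vector) \<Rightarrow> bool" where
  "Ck_on 0 U f \<longleftrightarrow> continuous_on U f"
| "Ck_on (Suc m) U f \<longleftrightarrow> (\<forall>x\<in>U. f differentiable (at x)) \<and>
     (\<forall>v. Ck_on m U (\<lambda>x. frechet_derivative f (at x) v))"

text \<open>Only used for open sets \<open>U\<close>.\<close>

definition smooth_on :: "'a::euclidean_space set \<Rightarrow> ('a \<Rightarrow> 'b::real_normed_vector) \<Rightarrow> bool" where
  "smooth_on U f \<longleftrightarrow> (\<forall>m. Ck_on m U f)"


section \<open>Riemannian curvature in coordinates\<close>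

text \<open>A metric \<open>G\<close> on an open subset of a Euclidean space (the range of a chart) assigns to
  each point \<open>z\<close> a bilinear form \<open>G z\<close>; vector fields are maps \<open>'a \<Rightarrow> 'a\<close>.  The vector
  \<open>christoffel G z u v\<close> is \<open>\<nabla>\<^sub>u v\<close> at \<open>z\<close> for constant fields \<open>u\<close>, \<open>v\<close>, given by the
  Koszul formula.\<close>

type_synonym 'a metric = "'a \<Rightarrow> 'a \<Rightarrow> 'a \<Rightarrow> real"

definition christoffel :: "'a::euclidean_space metric \<Rightarrow> 'a \<Rightarrow> 'a \<Rightarrow> 'a \<Rightarrow> 'a" where
  "christoffel G z u v = (THE w. \<forall>x. 2 * G z w x =
      frechet_derivative (\<lambda>y. G y v x) (at z) u
    + frechet_derivative (\<lambda>y. G y u x) (at z) v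
    - frechet_derivative (\<lambda>y. G y u v) (at z) x)"

definition nabla :: "'a::euclidean_space metric \<Rightarrow> ('a \<Rightarrow> 'a) \<Rightarrow> ('a \<Rightarrow> 'a) \<Rightarrow> 'a \<Rightarrow> 'a" where
  "nabla G X Y z = frechet_derivative Y (at z) (X z) + christoffel G z (X z) (Y z)"

definition lie_bracket :: "('a::euclidean_space \<Rightarrow> 'a) \<Rightarrow> ('a \<Rightarrow> 'a) \<Rightarrow> 'a \<Rightarrow> 'a" where
  "lie_bracket X Y z = frechet_derivative Y (at z) (X z) - frechet_derivative X (at z) (Y z)"

definition curvature_op ::
    "'a::euclidean_space metric \<Rightarrow> ('a \<Rightarrow> 'a) \<Rightarrow> ('a \<Rightarrow> 'a) \<Rightarrow> ('a \<Rightarrow> 'a) \<Rightarrow> 'a \<Rightarrow> 'a" where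
  "curvature_op G X Y Z z =
     nabla G X (nabla G Y Z) z - nabla G Y (nabla G X Z) z - nabla G (lie_bracket X Y) Z z"

text \<open>As the curvature is a tensor, its value on vectors at \<open>z\<close> is computed from their constant
  extensions.\<close>

definition riemann :: "'a::euclidean_space metric \<Rightarrow> 'a \<Rightarrow> 'a \<Rightarrow> 'a \<Rightarrow> 'a \<Rightarrow> 'a \<Rightarrow> real" where
  "riemann G z x y v u = G z (curvature_op G (\<lambda>_. x) (\<lambda>_. y) (\<lambda>_. v) z) u"

definition orthonormal_frame :: "'a::euclidean_space metric \<Rightarrow> 'a \<Rightarrow> 'a set \<Rightarrow> bool" where
  "orthonormal_frame G z E \<longleftrightarrow> finite E \<and> card E = DIM('a) \<and>
     (\<forall>x\<in>E. \<forall>y\<in>E. G z x y = (if x = y then 1 else 0))"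

text \<open>For positive definite \<open>G z\<close> the two traces below do not depend on the chosen frame.\<close>

definition ricci :: "'a::euclidean_space metric \<Rightarrow> 'a \<Rightarrow> 'a \<Rightarrow> 'a \<Rightarrow> real" where
  "ricci G z y v = (\<Sum>e\<in>(SOME E. orthonormal_frame G z E). riemann G z e y v e)"

definition scalar_curvature :: "'a::euclidean_space metric \<Rightarrow> 'a \<Rightarrow> real" where
  "scalar_curvature G z = (\<Sum>e\<in>(SOME E. orthonormal_frame G z E). ricci G z e e)"


section \<open>The Bochner tensor in holomorphic coordinates\<close>

text \<open>A complexified tangent vector \<open>u + i v\<close> is represented by the pair \<open>(u, v)\<close>; real tensors
  are extended complex-multilinearly.\<close>

definition cext :: "('a \<Rightarrow> complex) \<Rightarrow> 'a \<times> 'a \<Rightarrow> complex" where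
  "cext T a = T (fst a) + \<i> * T (snd a)"

definition cext2 :: "('a \<Rightarrow> 'a \<Rightarrow> real) \<Rightarrow> 'a \<times> 'a \<Rightarrow> 'a \<times> 'a \<Rightarrow> complex" where
  "cext2 T a b = cext (\<lambda>u. cext (\<lambda>v. complex_of_real (T u v)) b) a"

definition cext4 :: "('a \<Rightarrow> 'a \<Rightarrow> 'a \<Rightarrow> 'a \<Rightarrow> real) \<Rightarrow>
    'a \<times> 'a \<Rightarrow> 'a \<times> 'a \<Rightarrow> 'a \<times> 'a \<Rightarrow> 'a \<times> 'a \<Rightarrow> complex" where
  "cext4 T a b c d =
     cext (\<lambda>u. cext (\<lambda>v. cext (\<lambda>w. cext (\<lambda>x. complex_of_real (T u v w x)) d) c) b) a"

text \<open>\<open>\<partial>/\<partial>z\<^sup>\<alpha> = (\<partial>/\<partial>x\<^sup>\<alpha> - i \<partial>/\<partial>y\<^sup>\<alpha>) / 2\<close> and its conjugate.\<close>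

definition dz :: "'n::finite \<Rightarrow> (complex^'n) \<times> (complex^'n)" where
  "dz \<alpha> = ((1/2) *\<^sub>R axis \<alpha> 1, (-1/2) *\<^sub>R axis \<alpha> \<i>)"

definition dzbar :: "'n::finite \<Rightarrow> (complex^'n) \<times> (complex^'n)" where
  "dzbar \<alpha> = ((1/2) *\<^sub>R axis \<alpha> 1, (1/2) *\<^sub>R axis \<alpha> \<i>)"

definition bochner :: "(complex^'n::finite) metric \<Rightarrow> complex^'n \<Rightarrow> 'n \<Rightarrow> 'n \<Rightarrow> 'n \<Rightarrow> 'n \<Rightarrow> complex" where
  "bochner G z \<alpha> \<beta> \<gamma> \<delta> =
    (let n = real CARD('n);
         g = (\<lambda>\<mu> \<nu>. cext2 (G z) (dz \<mu>) (dzbar \<nu>));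
         \<rho> = (\<lambda>\<mu> \<nu>. cext2 (ricci G z) (dz \<mu>) (dzbar \<nu>));
         R = cext4 (riemann G z) (dz \<alpha>) (dzbar \<beta>) (dz \<gamma>) (dzbar \<delta>);
         \<tau> = scalar_curvature G z
     in R
      - complex_of_real (1 / (n + 2)) *
          (g \<alpha> \<beta> * \<rho> \<gamma> \<delta> + g \<gamma> \<beta> * \<rho> \<alpha> \<delta> + g \<gamma> \<delta> * \<rho> \<alpha> \<beta> + g \<alpha> \<delta> * \<rho> \<gamma> \<beta>)
      + complex_of_real (\<tau> / (2 * (n + 1) * (n + 2))) *
          (g \<alpha> \<beta> * g \<gamma> \<delta> + g \<gamma> \<beta> * g \<alpha> \<delta>))"

text \<open>Here the complex structure of the coordinate domain is multiplication by \<open>\<i>\<close>; the last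
  conjunct says that the fundamental form \<open>\<omega>(u,v) = G(i u, v)\<close> is closed.\<close>

definition kaehler_on :: "(complex^'n::finite) set \<Rightarrow> (complex^'n) metric \<Rightarrow> bool" where
  "kaehler_on U G \<longleftrightarrow>
     (\<forall>u v. smooth_on U (\<lambda>z. G z u v)) \<and>
     (\<forall>z\<in>U. bilinear (G z) \<and> (\<forall>u v. G z u v = G z v u) \<and> (\<forall>u. u \<noteq> 0 \<longrightarrow> G z u u > 0) \<and>
       (\<forall>u v. G z (\<i> *s u) (\<i> *s v) = G z u v) \<and>
       (\<forall>u v w. frechet_derivative (\<lambda>y. G y (\<i> *s v) w) (at z) u
              + frechet_derivative (\<lambda>y. G y (\<i> *s w) u) (at z) v
              + frechet_derivative (\<lambda>y. G y (\<i> *s u) v) (at z) w = 0))"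


section \<open>Holomorphic charts of an embedded submanifold\<close>

text \<open>\<open>M\<close> is a real hypersurface in \<open>\<complex>\<^sup>n \<times> \<real>\<close>, so that it has complex dimension \<open>n\<close>.  An almost
  complex structure \<open>J\<close> and a metric \<open>g\<close> on \<open>M\<close> are families indexed by the points of \<open>M\<close>; only
  their values on tangent vectors of \<open>M\<close> matter.  Charts are given by their inverses
  \<open>\<phi> : U \<rightarrow> M\<close>, that is, by local parametrizations.\<close>

definition holomorphic_param ::
    "((complex^'n::finite) \<times> real) set \<Rightarrow>
     ((complex^'n) \<times> real \<Rightarrow> (complex^'n) \<times> real \<Rightarrow> (complex^'n) \<times> real) \<Rightarrow>
     (complex^'n) set \<Rightarrow> (complex^'n \<Rightarrow> (complex^'n) \<times> real) \<Rightarrow> bool" where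
  "holomorphic_param M J U \<phi> \<longleftrightarrow>
     open U \<and> smooth_on U \<phi> \<and>
     \<phi> ` U \<subseteq> M \<and> openin (top_of_set M) (\<phi> ` U) \<and> (\<exists>\<psi>. homeomorphism U (\<phi> ` U) \<phi> \<psi>) \<and>
     (\<forall>z\<in>U. inj (frechet_derivative \<phi> (at z)) \<and>
       (\<forall>v. frechet_derivative \<phi> (at z) (\<i> *s v) = J (\<phi> z) (frechet_derivative \<phi> (at z) v)))"

definition pullback_metric ::
    "('a::real_normed_vector \<Rightarrow> 'b::real_normed_vector) \<Rightarrow> 'b metric \<Rightarrow> 'a metric" where
  "pullback_metric \<phi> g z u v =
     g (\<phi> z) (frechet_derivative \<phi> (at z) u) (frechet_derivative \<phi> (at z) v)"

text \<open>The first conjunct is the integrability of \<open>J\<close>; it also excludes vacuous truth of the other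
  two.\<close>

definition bochner_kaehler ::
    "((complex^'n::finite) \<times> real) set \<Rightarrow> ((complex^'n) \<times> real) metric \<Rightarrow>
     ((complex^'n) \<times> real \<Rightarrow> (complex^'n) \<times> real \<Rightarrow> (complex^'n) \<times> real) \<Rightarrow> bool" where
  "bochner_kaehler M g J \<longleftrightarrow>
     (\<forall>p\<in>M. \<exists>U \<phi>. holomorphic_param M J U \<phi> \<and> p \<in> \<phi> ` U) \<and>
     (\<forall>U \<phi>. holomorphic_param M J U \<phi> \<longrightarrow> kaehler_on U (pullback_metric \<phi> g)) \<and>
     (\<forall>U \<phi>. holomorphic_param M J U \<phi> \<longrightarrow>
        (\<forall>z\<in>U. \<forall>\<alpha> \<beta> \<gamma> \<delta>. bochner (pullback_metric \<phi> g) z \<alpha> \<beta> \<gamma> \<delta> = 0))"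


section \<open>Rotational hypersurfaces\<close>

text \<open>The flat Kaehler-Lorentz metric of \<open>\<complex>\<^sup>n\<close>; the index \<open>k\<close> marks the coordinate carrying the
  minus sign.\<close>

definition lorentz :: "'n::finite \<Rightarrow> complex^'n \<Rightarrow> complex^'n \<Rightarrow> real" where
  "lorentz k z w = (\<Sum>j\<in>UNIV - {k}. Re (z $ j * cnj (w $ j))) - Re (z $ k * cnj (w $ k))"

definition ambient_metric :: "'n::finite \<Rightarrow> (complex^'n) \<times> real \<Rightarrow> (complex^'n) \<times> real \<Rightarrow> real" where
  "ambient_metric k X Y = lorentz k (fst X) (fst Y) + snd X * snd Y"

definition J0 :: "(complex^'n::finite) \<times> real \<Rightarrow> (complex^'n) \<times> real" where
  "J0 X = (\<i> *s fst X, 0)"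

definition hyperquadric :: "'n::finite \<Rightarrow> (complex^'n) set" where
  "hyperquadric k = {n. lorentz k n n = -1}"

text \<open>The point \<open>t(s) n + q(s) e\<close>, where \<open>e = (0, 1)\<close>.\<close>

definition rot_point :: "(real \<Rightarrow> real) \<Rightarrow> (real \<Rightarrow> real) \<Rightarrow> real \<times> (complex^'n::finite) \<Rightarrow> (complex^'n) \<times> real" where
  "rot_point t q = (\<lambda>(s, n). t s *\<^sub>R (n, 0) + q s *\<^sub>R (0, 1))"

definition rot_hypersurface ::
    "'n::finite \<Rightarrow> real set \<Rightarrow> (real \<Rightarrow> real) \<Rightarrow> (real \<Rightarrow> real) \<Rightarrow> ((complex^'n) \<times> real) set" where
  "rot_hypersurface k I t q = rot_point t q ` (I \<times> hyperquadric k)"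

text \<open>The parameters \<open>(s, n)\<close> of a point of the hypersurface; they are unique if \<open>t\<close> is positive
  and injective on \<open>I\<close> (see \<open>rot_param_rot_point\<close>).\<close>

definition rot_param ::
    "'n::finite \<Rightarrow> real set \<Rightarrow> (real \<Rightarrow> real) \<Rightarrow> (real \<Rightarrow> real) \<Rightarrow> (complex^'n) \<times> real \<Rightarrow> real \<times> (complex^'n)" where
  "rot_param k I t q = inv_into (I \<times> hyperquadric k) (rot_point t q)"

definition rot_xi ::
    "'n::finite \<Rightarrow> real set \<Rightarrow> (real \<Rightarrow> real) \<Rightarrow> (real \<Rightarrow> real) \<Rightarrow> (complex^'n) \<times> real \<Rightarrow> (complex^'n) \<times> real" where
  "rot_xi k I t q p =
     (case rot_param k I t q p of (s, n) \<Rightarrow> vector_derivative (\<lambda>\<sigma>. rot_point t q (\<sigma>, n)) (at s))"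

definition rot_xi_tilde ::
    "'n::finite \<Rightarrow> real set \<Rightarrow> (real \<Rightarrow> real) \<Rightarrow> (real \<Rightarrow> real) \<Rightarrow> (complex^'n) \<times> real \<Rightarrow> (complex^'n) \<times> real" where
  "rot_xi_tilde k I t q p = (case rot_param k I t q p of (s, n) \<Rightarrow> J0 (n, 0))"

definition rot_eta ::
    "'n::finite \<Rightarrow> real set \<Rightarrow> (real \<Rightarrow> real) \<Rightarrow> (real \<Rightarrow> real) \<Rightarrow> (complex^'n) \<times> real \<Rightarrow> (complex^'n) \<times> real \<Rightarrow> real" where
  "rot_eta k I t q p X = ambient_metric k (rot_xi k I t q p) X"

definition rot_eta_tilde ::
    "'n::finite \<Rightarrow> real set \<Rightarrow> (real \<Rightarrow> real) \<Rightarrow> (real \<Rightarrow> real) \<Rightarrow> (complex^'n) \<times> real \<Rightarrow> (complex^'n) \<times> real \<Rightarrow> real" where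
  "rot_eta_tilde k I t q p X = ambient_metric k (rot_xi_tilde k I t q p) X"

text \<open>As \<open>\<xi>\<close> and \<open>\<xi>\<close>-tilde are orthogonal with square \<open>-1\<close>, the components of \<open>X\<close> along them are
  \<open>a = - \<eta>(X)\<close> and \<open>b = - \<eta>\<close>-tilde\<open>(X)\<close>, and the remainder of \<open>X\<close> is its \<open>D\<close>-component, on which
  \<open>J\<close> is \<open>J\<^sub>0\<close>.  The defining properties of \<open>J\<close> are verified in \<open>rot_J_xi\<close>, \<open>rot_J_xi_tilde\<close>
  and \<open>rot_J_D\<close>.\<close>

definition rot_J ::
    "'n::finite \<Rightarrow> real set \<Rightarrow> (real \<Rightarrow> real) \<Rightarrow> (real \<Rightarrow> real) \<Rightarrow> (complex^'n) \<times> real \<Rightarrow> (complex^'n) \<times> real \<Rightarrow> (complex^'n) \<times> real" where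
  "rot_J k I t q p X =
    (let \<xi> = rot_xi k I t q p; \<zeta> = rot_xi_tilde k I t q p;
         a = - rot_eta k I t q p X; b = - rot_eta_tilde k I t q p X
     in a *\<^sub>R \<zeta> - b *\<^sub>R \<xi> + J0 (X - a *\<^sub>R \<xi> - b *\<^sub>R \<zeta>))"

text \<open>The induced metric is the restriction of \<open>ambient_metric\<close> to tangent vectors.\<close>

definition rot_metric ::
    "'n::finite \<Rightarrow> real set \<Rightarrow> (real \<Rightarrow> real) \<Rightarrow> (real \<Rightarrow> real) \<Rightarrow> ((complex^'n) \<times> real) metric" where
  "rot_metric k I t q p X Y =
     ambient_metric k X Y
     + (1 - deriv t (fst (rot_param k I t q p))) *
       (rot_eta k I t q p X * rot_eta k I t q p Y
        + rot_eta_tilde k I t q p X * rot_eta_tilde k I t q p Y)"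

definition tangent_vectors :: "'a::real_normed_vector set \<Rightarrow> 'a \<Rightarrow> 'a set" where
  "tangent_vectors M p = {v. \<exists>c. c 0 = p \<and> (\<forall>\<^sub>F x in at (0::real). c x \<in> M) \<and>
     (c has_vector_derivative v) (at 0)}"

definition spacelike_normals :: "'n::finite \<Rightarrow> ((complex^'n) \<times> real) set \<Rightarrow> bool" where
  "spacelike_normals k M \<longleftrightarrow>
     (\<forall>p\<in>M. \<forall>N. N \<noteq> 0 \<and> (\<forall>X\<in>tangent_vectors M p. ambient_metric k N X = 0) \<longrightarrow>
        ambient_metric k N N > 0)"

text \<open>\<open>s\<close> is a natural parameter, so the tangents of the meridian are unit time-like.\<close>

definition rot_type_III :: "'n::finite \<Rightarrow> real set \<Rightarrow> (real \<Rightarrow> real) \<Rightarrow> (real \<Rightarrow> real) \<Rightarrow> bool" where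
  "rot_type_III k I t q \<longleftrightarrow>
     open I \<and> is_interval I \<and> I \<noteq> {} \<and> smooth_on I t \<and> smooth_on I q \<and> (\<forall>s\<in>I. t s > 0) \<and>
     (\<forall>s\<in>I. - (deriv t s)\<^sup>2 + (deriv q s)\<^sup>2 = -1) \<and>
     spacelike_normals k (rot_hypersurface k I t q)"


subsection \<open>Consistency of the definitions\<close>

lemma lorentz_scale: "lorentz k (a *\<^sub>R z) (b *\<^sub>R w) = a * b * lorentz k z w"
  unfolding lorentz_def by (simp add: sum_distrib_left algebra_simps)

lemma lorentz_i: "lorentz k (\<i> *s z) (\<i> *s w) = lorentz k z w"
  unfolding lorentz_def by (simp add: algebra_simps)

lemma lorentz_commute: "lorentz k z w = lorentz k w z"
  unfolding lorentz_def by (simp add: algebra_simps)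

lemma lorentz_i_self: "lorentz k (\<i> *s z) z = 0"
  unfolding lorentz_def by (simp add: algebra_simps)

lemma rot_point_simp: "rot_point t q (s, n) = (t s *\<^sub>R n, q s)"
  by (simp add: rot_point_def)

lemma rot_param_rot_point:
  assumes "inj_on t I" "\<forall>s\<in>I. t s > 0" "s \<in> I" "n \<in> hyperquadric k"
  shows "rot_param k I t q (rot_point t q (s, n)) = (s, n)"
proof -
  have "inj_on (rot_point t q) (I \<times> hyperquadric k)"
  proof (rule inj_onI, clarify)
    fix s n s' n'
    assume s: "s \<in> I" "s' \<in> I" and n: "n \<in> hyperquadric k" "n' \<in> hyperquadric k"
      and eq: "rot_point t q (s, n) = rot_point t q (s', n')"
    have e: "t s *\<^sub>R n = t s' *\<^sub>R n'" using eq by (simp add: rot_point_simp)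
    have "lorentz k (t s *\<^sub>R n) (t s *\<^sub>R n) = lorentz k (t s' *\<^sub>R n') (t s' *\<^sub>R n')"
      using e by simp
    then have "(t s)\<^sup>2 = (t s')\<^sup>2"
      using n by (simp add: lorentz_scale hyperquadric_def power2_eq_square)
    then have "t s = t s'" using assms(2) s by (metis less_imp_le power2_eq_imp_eq)
    moreover from this have "s = s'" using assms(1) s by (meson inj_onD)
    ultimately show "s = s' \<and> n = n'" using e assms(2) s by fastforce
  qed
  then show ?thesis
    unfolding rot_param_def using assms(3,4) by (simp add: inv_into_f_f)
qed

context
  fixes k :: "'n::finite" and I :: "real set" and t q :: "real \<Rightarrow> real" and s :: real
    and n :: "complex^'n" and p :: "(complex^'n) \<times> real"
  assumes inj: "inj_on t I" and pos: "\<forall>s\<in>I. t s > 0"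
    and diff: "t differentiable (at s)" "q differentiable (at s)"
    and nat: "- (deriv t s)\<^sup>2 + (deriv q s)\<^sup>2 = -1"
    and s: "s \<in> I" and n: "n \<in> hyperquadric k" and p: "p = rot_point t q (s, n)"
begin

lemma rot_param_p: "rot_param k I t q p = (s, n)"
  using rot_param_rot_point[OF inj pos s n] p by simp

lemma rot_xi_eq: "rot_xi k I t q p = (deriv t s *\<^sub>R n, deriv q s)"
proof -
  have t: "(t has_real_derivative deriv t s) (at s)" and q: "(q has_real_derivative deriv q s) (at s)"
    using diff real_differentiableE DERIV_imp_deriv by metis+
  have "((\<lambda>\<sigma>. (t \<sigma> *\<^sub>R n, q \<sigma>)) has_vector_derivative (deriv t s *\<^sub>R n, deriv q s)) (at s)"
    by (intro has_vector_derivative_Pair)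
      (use t q in \<open>auto intro!: derivative_eq_intros simp: has_real_derivative_iff_has_vector_derivative\<close>)
  then show ?thesis
    by (simp add: rot_xi_def rot_param_p rot_point_simp vector_derivative_at)
qed

lemma rot_xi_tilde_eq: "rot_xi_tilde k I t q p = (\<i> *s n, 0)"
  by (simp add: rot_xi_tilde_def rot_param_p J0_def)

lemma rot_xi_products:
  "rot_eta k I t q p (rot_xi k I t q p) = -1"
  "rot_eta_tilde k I t q p (rot_xi_tilde k I t q p) = -1"
  "rot_eta k I t q p (rot_xi_tilde k I t q p) = 0"
  "rot_eta_tilde k I t q p (rot_xi k I t q p) = 0"
proof -
  have 1: "lorentz k n n = -1" using n by (simp add: hyperquadric_def)
  have 2: "lorentz k (a *\<^sub>R n) (\<i> *s n) = 0" "lorentz k (\<i> *s n) (a *\<^sub>R n) = 0" for a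
    using lorentz_scale[of k 1 "\<i> *s n" a n] lorentz_i_self[of k n] lorentz_commute[of k "a *\<^sub>R n"]
    by simp_all
  show "rot_eta k I t q p (rot_xi k I t q p) = -1"
    using nat 1
    by (simp add: rot_eta_def rot_xi_eq ambient_metric_def lorentz_scale power2_eq_square)
  show "rot_eta_tilde k I t q p (rot_xi_tilde k I t q p) = -1"
    using 1 by (simp add: rot_eta_tilde_def rot_xi_tilde_eq ambient_metric_def lorentz_i)
  show "rot_eta k I t q p (rot_xi_tilde k I t q p) = 0"
    "rot_eta_tilde k I t q p (rot_xi k I t q p) = 0"
    using 2 by (simp_all add: rot_eta_def rot_eta_tilde_def rot_xi_eq rot_xi_tilde_eq ambient_metric_def)
qed

lemma rot_J_xi: "rot_J k I t q p (rot_xi k I t q p) = rot_xi_tilde k I t q p"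
  by (simp add: rot_J_def Let_def rot_xi_products) (simp add: J0_def zero_prod_def)

lemma rot_J_xi_tilde: "rot_J k I t q p (rot_xi_tilde k I t q p) = - rot_xi k I t q p"
  by (simp add: rot_J_def Let_def rot_xi_products) (simp add: J0_def zero_prod_def)

lemma rot_J_D:
  assumes "rot_eta k I t q p X = 0" "rot_eta_tilde k I t q p X = 0"
  shows "rot_J k I t q p X = J0 X"
  using assms by (simp add: rot_J_def)

end

end

theory Submission
  imports Defs
begin

text \<open>With \<open>L' = 1/t\<close> and \<open>f = exp L\<close>, the map sending the point with parameters \<open>(s, n)\<close> to
  \<open>w = f(s) n\<close> is a biholomorphism of the hypersurface onto an open part of the negative cone of
  \<open>\<complex>\<^sup>n\<close>. With the Lorentz-Hermitian form \<open>H\<close> and \<open>r = - H(w, w) = f\<^sup>2\<close>, the metric becomes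
  \<open>A (Re H(u, v) + a Re (H(u, w) H(w, v)))\<close>, where \<open>A = t\<^sup>2/r\<close> and \<open>a = (1 - t')/r\<close> are functions of
  \<open>r\<close> with \<open>dA/dr = - a A\<close>. Its curvature has the form \<open>gS + gS + gS + gS\<close> of a Bochner-flat one up
  to a multiple \<open>E(r)\<close> of the rank one tensor \<open>H(x, w) H(w, y) H(u, w) H(w, v)\<close>. Hence the Bochner
  tensor vanishes iff \<open>E = 0\<close>. Up to a nonvanishing factor \<open>E\<close> is \<open>t\<^sup>2 p'' - 5 t p' + 8 (p - 1)\<close> for
  \<open>p = t'\<close> as a function of \<open>t\<close>, and the solutions of this Euler equation are
  \<open>p = c1 t\<^sup>4 + c2 t\<^sup>2 + 1\<close>. Other holomorphic parametrizations are reduced to this one by the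
  naturality of the curvature.\<close>

section \<open>Calculus of smooth maps\<close>

text \<open>The factor f is forced by holomorphy: a unit step along \<open>\<xi>\<close> changes w
  by f' n, while the tangent vector i n of the hypersurface turns n with speed 1/t and so changes w
  by (f/t) i n. As J sends the first vector to the second, f' = f/t. The relation dA/dr = - a A is
  the Kaehler condition: a potential F(r) has complex Hessian - F' H(u, v) + F'' H(u, w) H(w, v), so
  A = - F' and a A = F''. The bound on t' enters through r a = 1 - t' > 1, which makes g positive on
  the complex line of w and lets one divide by 1 - r a = t'. Bochner-Kaehler is a statement about
  all holomorphic parametrizations, with a connection defined by the Koszul formula and with Ricci
  traces over a chosen frame. Hence a connection is guessed and verified through its characteristic
  properties, and these are transported to other coordinates, where differentiability of the
  transported connection needs an argument of its own. For the necessity of E = 0 the Ricci tensor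
  is left unknown: its entries are eliminated between three components of the Bochner
  tensor.\<close>

lemma Ck_on_cong:
  assumes "open U" "\<And>x. x \<in> U \<Longrightarrow> f x = g x"
  shows "Ck_on m U f \<longleftrightarrow> Ck_on m U g"
  using assms(2)
proof (induction m arbitrary: f g)
  case 0
  then show ?case by (auto cong: continuous_on_cong)
next
  case (Suc m)
  have D: "(f has_derivative D) (at x) \<longleftrightarrow> (g has_derivative D) (at x)" if "x \<in> U" for x D
    using has_derivative_transform_within_open[OF _ assms(1) that, of f D UNIV g]
      has_derivative_transform_within_open[OF _ assms(1) that, of g D UNIV f] Suc.prems by auto
  have fd: "frechet_derivative f (at x) v = frechet_derivative g (at x) v" if "x \<in> U" for x v
    unfolding frechet_derivative_def using D[OF that] by simp
  have df: "f differentiable (at x) \<longleftrightarrow> g differentiable (at x)" if "x \<in> U" for x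
    unfolding differentiable_def using D[OF that] by simp
  show ?case
    using df Suc.IH[of "\<lambda>x. frechet_derivative f (at x) v" "\<lambda>x. frechet_derivative g (at x) v" for v] fd
    by simp
qed

text \<open>Lets a derivative be supplied in closed form, so that inductions on the order never have
  to compute \<open>frechet_derivative\<close> itself.\<close>

lemma Ck_on_SucI:
  assumes "open U" "\<And>x. x \<in> U \<Longrightarrow> (f has_derivative D x) (at x)" "\<And>v. Ck_on m U (\<lambda>x. D x v)"
  shows "Ck_on (Suc m) U f"
proof -
  have "frechet_derivative f (at x) = D x" if "x \<in> U" for x
    using assms(2)[OF that] frechet_derivative_at by metis
  then have "Ck_on m U (\<lambda>x. frechet_derivative f (at x) v) = Ck_on m U (\<lambda>x. D x v)" for v
    using assms(1) by (intro Ck_on_cong) auto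
  then show ?thesis using assms by (auto intro: differentiableI)
qed

lemma Ck_on_SucD:
  assumes "Ck_on (Suc m) U f" "x \<in> U"
  shows "(f has_derivative frechet_derivative f (at x)) (at x)"
  using assms frechet_derivative_works by auto

lemma Ck_on_Suc_imp: "Ck_on (Suc m) U f \<Longrightarrow> Ck_on m U f"
proof (induction m arbitrary: f)
  case 0
  then show ?case
    by (auto intro!: continuous_at_imp_continuous_on differentiable_imp_continuous_within)
next
  case (Suc m)
  then have "Ck_on (Suc m) U (\<lambda>x. frechet_derivative f (at x) v)" for v by simp
  then have "Ck_on m U (\<lambda>x. frechet_derivative f (at x) v)" for v by (rule Suc.IH)
  then show ?case using Suc.prems by simp
qed

lemma Ck_on_imp_continuous_on: "Ck_on m U f \<Longrightarrow> continuous_on U f"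
  by (induction m) (use Ck_on_Suc_imp Ck_on.simps(1) in blast)+

lemma Ck_on_subset: "Ck_on m U f \<Longrightarrow> V \<subseteq> U \<Longrightarrow> Ck_on m V f"
  by (induction m arbitrary: f) (auto intro: continuous_on_subset)

lemma Ck_on_const: "Ck_on m U (\<lambda>x. c)"
  by (induction m arbitrary: c) auto

lemma Ck_on_bounded_linear: "bounded_linear f \<Longrightarrow> Ck_on m U f"
proof (induction m)
  case 0
  then show ?case by (simp add: linear_continuous_on)
next
  case (Suc m)
  then have "frechet_derivative f (at x) = f" for x
    by (metis bounded_linear_imp_has_derivative frechet_derivative_at)
  then show ?case using Suc.prems
    by (auto simp: Ck_on_const bounded_linear_imp_differentiable)
qed

lemma Ck_on_compose_linear:
  assumes "bounded_linear h" "open U"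
  shows "Ck_on m U f \<Longrightarrow> Ck_on m U (\<lambda>x. h (f x))"
proof (induction m arbitrary: f)
  case 0
  then show ?case using assms
    by (auto intro: continuous_on_compose2[OF linear_continuous_on])
next
  case (Suc m)
  show ?case
    by (rule Ck_on_SucI[OF assms(2), where D="\<lambda>x v. h (frechet_derivative f (at x) v)"])
      (use Suc bounded_linear.has_derivative[OF assms(1) Ck_on_SucD[OF Suc.prems]] in auto)
qed

lemma Ck_on_add:
  assumes "open U"
  shows "Ck_on m U f \<Longrightarrow> Ck_on m U g \<Longrightarrow> Ck_on m U (\<lambda>x. f x + g x)"
proof (induction m arbitrary: f g)
  case 0
  then show ?case by (auto intro: continuous_intros)
next
  case (Suc m)
  show ?case
    by (rule Ck_on_SucI[OF assms, where D="\<lambda>x v. frechet_derivative f (at x) v + frechet_derivative g (at x) v"])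
      (use Suc has_derivative_add[OF Ck_on_SucD[OF Suc.prems(1)] Ck_on_SucD[OF Suc.prems(2)]] in auto)
qed

lemma Ck_on_sum:
  assumes "open U" "\<And>i. i \<in> S \<Longrightarrow> Ck_on m U (f i)"
  shows "Ck_on m U (\<lambda>x. \<Sum>i\<in>S. f i x)"
proof (cases "finite S")
  case True
  then show ?thesis using assms(2)
    by (induction S) (auto intro: Ck_on_const Ck_on_add[OF assms(1)])
qed (simp add: Ck_on_const)

lemma Ck_on_bilinear:
  assumes "bounded_bilinear h" "open U"
  shows "Ck_on m U f \<Longrightarrow> Ck_on m U g \<Longrightarrow> Ck_on m U (\<lambda>x. h (f x) (g x))"
proof (induction m arbitrary: f g)
  case 0
  then show ?case by (auto intro: bounded_bilinear.continuous_on[OF assms(1)])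
next
  case (Suc m)
  show ?case
  proof (rule Ck_on_SucI[OF assms(2), where
      D="\<lambda>x v. h (f x) (frechet_derivative g (at x) v) + h (frechet_derivative f (at x) v) (g x)"])
    show "((\<lambda>x. h (f x) (g x)) has_derivative
        (\<lambda>v. h (f x) (frechet_derivative g (at x) v) + h (frechet_derivative f (at x) v) (g x))) (at x)"
      if "x \<in> U" for x
      using bounded_bilinear.FDERIV[OF assms(1) Ck_on_SucD[OF Suc.prems(1) that] Ck_on_SucD[OF Suc.prems(2) that]] .
    show "Ck_on m U (\<lambda>x. h (f x) (frechet_derivative g (at x) v) + h (frechet_derivative f (at x) v) (g x))" for v
      by (intro Ck_on_add assms Suc.IH Ck_on_Suc_imp[OF Suc.prems(1)] Ck_on_Suc_imp[OF Suc.prems(2)])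
        (use Suc.prems in auto)
  qed
qed

lemma linear_Basis_sum:
  fixes f :: "'a::euclidean_space \<Rightarrow> 'b::real_vector"
  assumes "linear f"
  shows "f x = (\<Sum>b\<in>Basis. (x \<bullet> b) *\<^sub>R f b)"
  by (subst euclidean_representation[symmetric, of x])
    (simp only: linear_sum[OF assms] linear_cmul[OF assms])

text \<open>The chain rule applies the derivative of g to a direction that varies with x, whereas
  \<open>Ck_on\<close> speaks of fixed directions only. Expanding the varying direction in the basis
  leaves a sum of products to which the induction hypothesis applies.\<close>

lemma Ck_on_compose:
  fixes f :: "'a::euclidean_space \<Rightarrow> 'b::euclidean_space" and g :: "'b \<Rightarrow> 'c::real_normed_vector"
  assumes "open U" "open V" "f ` U \<subseteq> V"
  shows "Ck_on m U f \<Longrightarrow> Ck_on m V g \<Longrightarrow> Ck_on m U (\<lambda>x. g (f x))"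
proof (induction m arbitrary: g)
  case 0
  then show ?case using assms(3) by (auto intro: continuous_on_compose2)
next
  case (Suc m)
  have fin: "f x \<in> V" if "x \<in> U" for x using that assms(3) by auto
  show ?case
  proof (rule Ck_on_SucI[OF assms(1), where
      D="\<lambda>x v. \<Sum>b\<in>Basis. (frechet_derivative f (at x) v \<bullet> b) *\<^sub>R frechet_derivative g (at (f x)) b"])
    fix x assume x: "x \<in> U"
    have g': "(g has_derivative frechet_derivative g (at (f x))) (at (f x))"
      using Ck_on_SucD[OF Suc.prems(2) fin[OF x]] .
    have "((\<lambda>x. g (f x)) has_derivative (\<lambda>v. frechet_derivative g (at (f x)) (frechet_derivative f (at x) v))) (at x)"
      using has_derivative_compose[OF Ck_on_SucD[OF Suc.prems(1) x] g'] .
    then show "((\<lambda>x. g (f x)) has_derivative (\<lambda>v. \<Sum>b\<in>Basis. (frechet_derivative f (at x) v \<bullet> b) *\<^sub>R frechet_derivative g (at (f x)) b)) (at x)"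
      by (subst linear_Basis_sum[OF has_derivative_linear[OF g'], symmetric])
  next
    fix v
    show "Ck_on m U (\<lambda>x. \<Sum>b\<in>Basis. (frechet_derivative f (at x) v \<bullet> b) *\<^sub>R frechet_derivative g (at (f x)) b)"
      by (intro Ck_on_sum Ck_on_bilinear[OF bounded_bilinear_scaleR] assms Suc.IH Ck_on_Suc_imp[OF Suc.prems(1)]
          Ck_on_compose_linear[OF bounded_linear_inner_left])
        (use Suc.prems in auto)
  qed
qed

lemma Ck_on_realI:
  fixes f :: "real \<Rightarrow> real"
  assumes "open U" "\<And>x. x \<in> U \<Longrightarrow> (f has_real_derivative f' x) (at x)" "Ck_on m U f'"
  shows "Ck_on (Suc m) U f"
  by (rule Ck_on_SucI[OF assms(1), where D="\<lambda>x v. f' x * v"])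
    (use assms in \<open>auto simp: has_field_derivative_def intro: Ck_on_bilinear[OF bounded_bilinear_mult] Ck_on_const\<close>)

lemma frechet_derivative_real:
  fixes f :: "real \<Rightarrow> real"
  assumes "f differentiable (at x)"
  shows "frechet_derivative f (at x) v = deriv f x * v"
proof -
  have "(f has_real_derivative deriv f x) (at x)"
    using assms by (metis DERIV_deriv_iff_real_differentiable)
  then show ?thesis
    by (metis frechet_derivative_at has_field_derivative_def)
qed

section \<open>Closure properties of smooth maps\<close>

lemma smooth_on_cong: "open U \<Longrightarrow> (\<And>x. x \<in> U \<Longrightarrow> f x = g x) \<Longrightarrow> smooth_on U f \<longleftrightarrow> smooth_on U g"
  unfolding smooth_on_def using Ck_on_cong by blast

lemma smooth_on_subset: "smooth_on U f \<Longrightarrow> V \<subseteq> U \<Longrightarrow> smooth_on V f"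
  unfolding smooth_on_def using Ck_on_subset by blast

lemma smooth_on_const: "smooth_on U (\<lambda>x. c)"
  unfolding smooth_on_def by (simp add: Ck_on_const)

lemma smooth_on_bounded_linear: "bounded_linear f \<Longrightarrow> smooth_on U f"
  unfolding smooth_on_def using Ck_on_bounded_linear by blast

lemma smooth_on_add: "open U \<Longrightarrow> smooth_on U f \<Longrightarrow> smooth_on U g \<Longrightarrow> smooth_on U (\<lambda>x. f x + g x)"
  unfolding smooth_on_def using Ck_on_add by blast

lemma smooth_on_bilinear:
  "bounded_bilinear h \<Longrightarrow> open U \<Longrightarrow> smooth_on U f \<Longrightarrow> smooth_on U g \<Longrightarrow> smooth_on U (\<lambda>x. h (f x) (g x))"
  unfolding smooth_on_def using Ck_on_bilinear by blast

lemma smooth_on_compose_linear: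
  "bounded_linear h \<Longrightarrow> open U \<Longrightarrow> smooth_on U f \<Longrightarrow> smooth_on U (\<lambda>x. h (f x))"
  unfolding smooth_on_def using Ck_on_compose_linear by blast

lemma smooth_on_compose:
  fixes f :: "'a::euclidean_space \<Rightarrow> 'b::euclidean_space" and g :: "'b \<Rightarrow> 'c::real_normed_vector"
  shows "smooth_on V g \<Longrightarrow> smooth_on U f \<Longrightarrow> open U \<Longrightarrow> open V \<Longrightarrow> f ` U \<subseteq> V \<Longrightarrow> smooth_on U (\<lambda>x. g (f x))"
  unfolding smooth_on_def using Ck_on_compose by blast

lemma smooth_on_continuous_on: "smooth_on U f \<Longrightarrow> continuous_on U f"
  unfolding smooth_on_def using Ck_on_imp_continuous_on by blast

lemma smooth_on_frechet: "smooth_on U f \<Longrightarrow> smooth_on U (\<lambda>x. frechet_derivative f (at x) v)"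
  unfolding smooth_on_def using Ck_on.simps(2) by blast

lemma smooth_on_has_derivative:
  "smooth_on U f \<Longrightarrow> x \<in> U \<Longrightarrow> (f has_derivative frechet_derivative f (at x)) (at x)"
  unfolding smooth_on_def using Ck_on_SucD by blast

lemma smooth_on_differentiable: "smooth_on U f \<Longrightarrow> x \<in> U \<Longrightarrow> f differentiable (at x)"
  using smooth_on_has_derivative differentiableI by blast

lemma smooth_on_DERIV:
  fixes f :: "real \<Rightarrow> real"
  shows "smooth_on U f \<Longrightarrow> x \<in> U \<Longrightarrow> (f has_real_derivative deriv f x) (at x)"
  using smooth_on_differentiable DERIV_deriv_iff_real_differentiable by blast

lemma smooth_on_deriv:
  fixes f :: "real \<Rightarrow> real"
  assumes "open U" "smooth_on U f"
  shows "smooth_on U (deriv f)"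
proof -
  have "smooth_on U (\<lambda>x. frechet_derivative f (at x) 1)" using assms smooth_on_frechet by blast
  then show ?thesis
    using assms by (subst smooth_on_cong[where g="\<lambda>x. frechet_derivative f (at x) 1"])
      (auto simp: frechet_derivative_real[OF smooth_on_differentiable])
qed

lemma smooth_on_realI:
  fixes f :: "real \<Rightarrow> real"
  assumes "open U" "\<And>x. x \<in> U \<Longrightarrow> (f has_real_derivative f' x) (at x)" "smooth_on U f'"
  shows "smooth_on U f"
  unfolding smooth_on_def
  using Ck_on_realI[OF assms(1,2)] assms(3) Ck_on_Suc_imp unfolding smooth_on_def by blast

text \<open>The derivative is minus the square of the function itself, so each order of
  differentiability yields the next.\<close>

lemma smooth_on_inverse: "smooth_on (- {0}) (inverse :: real \<Rightarrow> real)"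
  unfolding smooth_on_def
proof
  fix m
  show "Ck_on m (- {0}) (inverse :: real \<Rightarrow> real)"
  proof (induction m)
    case 0
    then show ?case by (auto intro!: continuous_intros)
  next
    case (Suc m)
    have o: "open (- {0::real})" by (rule open_Compl) simp
    show ?case
    proof (rule Ck_on_realI[OF o, where f'="\<lambda>x. - 1 * (inverse x * inverse x)"])
      show "(inverse has_real_derivative - 1 * (inverse x * inverse x)) (at x)" if "x \<in> - {0}" for x :: real
        using that DERIV_inverse[of x UNIV] by (simp add: power2_eq_square)
      show "Ck_on m (- {0}) (\<lambda>x::real. - 1 * (inverse x * inverse x))"
        by (intro Ck_on_bilinear[OF bounded_bilinear_mult] Ck_on_const Suc o)
    qed
  qed
qed

lemma smooth_on_exp: "smooth_on UNIV (exp :: real \<Rightarrow> real)"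
  unfolding smooth_on_def
proof
  show "Ck_on m UNIV (exp :: real \<Rightarrow> real)" for m
  proof (induction m)
    case 0
    then show ?case by (simp add: continuous_on_exp)
  next
    case (Suc m)
    then show ?case by (intro Ck_on_realI[where f'=exp] open_UNIV DERIV_exp)
  qed
qed

lemma smooth_on_divide:
  fixes f g :: "'a::euclidean_space \<Rightarrow> real"
  assumes "open U" "smooth_on U f" "smooth_on U g" "\<And>x. x \<in> U \<Longrightarrow> g x \<noteq> 0"
  shows "smooth_on U (\<lambda>x. f x / g x)"
  unfolding divide_inverse
  by (rule smooth_on_bilinear[OF bounded_bilinear_mult assms(1,2)])
    (rule smooth_on_compose[OF smooth_on_inverse assms(3,1)], use assms(4) in auto)

lemma smooth_on_mult:
  fixes f g :: "'a::euclidean_space \<Rightarrow> real"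
  shows "open U \<Longrightarrow> smooth_on U f \<Longrightarrow> smooth_on U g \<Longrightarrow> smooth_on U (\<lambda>x. f x * g x)"
  by (rule smooth_on_bilinear[OF bounded_bilinear_mult])

lemma smooth_on_minus:
  "open U \<Longrightarrow> smooth_on U f \<Longrightarrow> smooth_on U (\<lambda>x. - f x)"
  by (rule smooth_on_compose_linear[OF bounded_linear_minus[OF bounded_linear_ident]])

lemma smooth_on_diff:
  "open U \<Longrightarrow> smooth_on U f \<Longrightarrow> smooth_on U g \<Longrightarrow> smooth_on U (\<lambda>x. f x - g x)"
  unfolding diff_conv_add_uminus by (intro smooth_on_add smooth_on_minus)

lemma smooth_on_Pair:
  assumes "open U" "smooth_on U f" "smooth_on U g"
  shows "smooth_on U (\<lambda>x. (f x, g x))"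
proof -
  have "smooth_on U (\<lambda>x. (f x, 0) + (0, g x))"
    using assms
    by (intro smooth_on_add smooth_on_compose_linear[of "\<lambda>y. (y, 0)"] smooth_on_compose_linear[of "\<lambda>y. (0, y)"])
      (auto intro: bounded_linear_Pair bounded_linear_ident bounded_linear_zero)
  then show ?thesis by simp
qed

section \<open>Inverses of real functions with nonvanishing derivative\<close>

lemma the_inv_into_DERIV:
  fixes h :: "real \<Rightarrow> real"
  assumes "open I" "inj_on h I" "\<And>s. s \<in> I \<Longrightarrow> (h has_real_derivative h' s) (at s)" "s \<in> I" "h' s \<noteq> 0"
  shows "(the_inv_into I h has_real_derivative 1 / h' s) (at (h s))"
proof -
  have "continuous_on I h"
    using assms(3) DERIV_isCont by (meson continuous_at_imp_continuous_on)
  then have "(the_inv_into I h has_derivative (\<lambda>v. v / h' s)) (at (h s))"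
    by (rule has_derivative_inverse_strong[OF assms(1,4), where f'="\<lambda>v. h' s * v"])
      (use assms(2,5) assms(3)[OF assms(4)] in \<open>auto simp: the_inv_into_f_f has_field_derivative_def o_def\<close>)
  moreover have "(\<lambda>v. v / h' s) = (*) (1 / h' s)" by auto
  ultimately show ?thesis by (simp add: has_field_derivative_def)
qed

text \<open>Bootstrapping: the derivative of the inverse is the smooth function 1/h' composed with
  the inverse, hence is as regular as the inverse is already known to be.\<close>

lemma smooth_on_the_inv_into:
  fixes h :: "real \<Rightarrow> real"
  assumes "open I" "inj_on h I" "smooth_on I h" "\<And>s. s \<in> I \<Longrightarrow> deriv h s \<noteq> 0"
  shows "open (h ` I)" "smooth_on (h ` I) (the_inv_into I h)"
proof -
  show o: "open (h ` I)"
    using assms invariance_of_domain smooth_on_continuous_on by blast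
  let ?g = "the_inv_into I h"
  have g: "?g ` (h ` I) \<subseteq> I" using assms(2) by (auto simp: the_inv_into_f_f)
  have g': "(?g has_real_derivative 1 / deriv h (?g y)) (at y)" if "y \<in> h ` I" for y
    using the_inv_into_DERIV[OF assms(1,2) smooth_on_DERIV[OF assms(3)]] assms(2,4) that
    by (auto simp: the_inv_into_f_f)
  have s: "smooth_on I (\<lambda>s. 1 / deriv h s)"
    using assms by (intro smooth_on_divide smooth_on_const smooth_on_deriv)
  show "smooth_on (h ` I) ?g"
    unfolding smooth_on_def
  proof
    show "Ck_on m (h ` I) ?g" for m
    proof (induction m)
      case 0
      then show ?case using g' DERIV_isCont by (auto intro!: continuous_at_imp_continuous_on)
    next
      case (Suc m)
      have "Ck_on m (h ` I) (\<lambda>y. 1 / deriv h (?g y))"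
        using s Ck_on_compose[OF o assms(1) g Suc] unfolding smooth_on_def by blast
      then show ?case using Ck_on_realI[OF o g'] by blast
    qed
  qed
qed

section \<open>Symmetry of second derivatives\<close>

lemma has_derivative_line:
  assumes "(f has_derivative D) (at (z + s *\<^sub>R u))"
  shows "((\<lambda>s. f (z + s *\<^sub>R u)) has_vector_derivative D u) (at s)"
proof -
  have "((\<lambda>s. z + s *\<^sub>R u) has_derivative (\<lambda>h. h *\<^sub>R u)) (at s)"
    by (auto intro!: derivative_eq_intros)
  from has_derivative_compose[OF this assms]
  show ?thesis
    unfolding has_vector_derivative_def
    using linear_cmul[OF has_derivative_linear[OF assms]] by simp
qed

text \<open>The mean value theorem is used twice, first along u for the difference of f across the
  step h v, then along v for the derivative in direction u. The second difference is symmetric in u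
  and v while the right side is not, which is what the symmetry of second derivatives
  exploits.\<close>

lemma second_difference_mean_value:
  fixes f :: "'a::euclidean_space \<Rightarrow> real"
  assumes "Ck_on 2 U f" "h > 0"
    and U: "\<And>s t. 0 \<le> s \<Longrightarrow> s \<le> h \<Longrightarrow> 0 \<le> t \<Longrightarrow> t \<le> h \<Longrightarrow> z + s *\<^sub>R u + t *\<^sub>R v \<in> U"
  obtains s t where "0 < s" "s < h" "0 < t" "t < h"
    "f (z + h *\<^sub>R u + h *\<^sub>R v) - f (z + h *\<^sub>R u) - f (z + h *\<^sub>R v) + f z =
      h * h * frechet_derivative (\<lambda>x. frechet_derivative f (at x) u) (at (z + s *\<^sub>R u + t *\<^sub>R v)) v"
proof -
  let ?F = "\<lambda>x. frechet_derivative f (at x) u"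
  have C1: "Ck_on (Suc 1) U f" and C2: "Ck_on (Suc 0) U ?F" using assms(1) by (auto simp: numeral_2_eq_2)
  define g where "g s = f (z + s *\<^sub>R u + h *\<^sub>R v) - f (z + s *\<^sub>R u)" for s
  have g': "(g has_real_derivative ?F (z + s *\<^sub>R u + h *\<^sub>R v) - ?F (z + s *\<^sub>R u)) (at s)"
    if s: "0 \<le> s" "s \<le> h" for s
  proof -
    have "((\<lambda>s. f ((z + h *\<^sub>R v) + s *\<^sub>R u)) has_vector_derivative ?F ((z + h *\<^sub>R v) + s *\<^sub>R u)) (at s)"
      using U[OF s, of h] assms(2) by (intro has_derivative_line Ck_on_SucD[OF C1]) (simp add: ac_simps)
    moreover have "((\<lambda>s. f (z + s *\<^sub>R u)) has_vector_derivative ?F (z + s *\<^sub>R u)) (at s)"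
      using U[OF s, of 0] assms(2) by (intro has_derivative_line Ck_on_SucD[OF C1]) simp
    ultimately show ?thesis
      unfolding g_def has_real_derivative_iff_has_vector_derivative
      by (auto intro!: has_vector_derivative_diff simp: ac_simps)
  qed
  obtain s where s: "0 < s" "s < h"
    "g h - g 0 = (h - 0) * (?F (z + s *\<^sub>R u + h *\<^sub>R v) - ?F (z + s *\<^sub>R u))"
    using MVT2[OF assms(2) g'] by blast
  have k': "((\<lambda>t. ?F (z + s *\<^sub>R u + t *\<^sub>R v)) has_real_derivative
      frechet_derivative ?F (at (z + s *\<^sub>R u + t *\<^sub>R v)) v) (at t)" if "0 \<le> t" "t \<le> h" for t
    unfolding has_real_derivative_iff_has_vector_derivative
    by (rule has_derivative_line Ck_on_SucD[OF C2])+ (use U s that in auto)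
  obtain t where t: "0 < t" "t < h" "?F (z + s *\<^sub>R u + h *\<^sub>R v) - ?F (z + s *\<^sub>R u + 0 *\<^sub>R v) =
      (h - 0) * frechet_derivative ?F (at (z + s *\<^sub>R u + t *\<^sub>R v)) v"
    using MVT2[OF assms(2) k'] by blast
  show ?thesis
    by (rule that[OF s(1,2) t(1,2)]) (use s(3) t(3) in \<open>simp add: g_def algebra_simps\<close>)
qed

lemma second_derivative_symmetric_real:
  fixes f :: "'a::euclidean_space \<Rightarrow> real"
  assumes "open U" "Ck_on 2 U f" "z \<in> U"
  shows "frechet_derivative (\<lambda>x. frechet_derivative f (at x) u) (at z) v =
    frechet_derivative (\<lambda>x. frechet_derivative f (at x) v) (at z) u"
proof -
  define P where "P x = frechet_derivative (\<lambda>x. frechet_derivative f (at x) u) (at x) v" for x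
  define Q where "Q x = frechet_derivative (\<lambda>x. frechet_derivative f (at x) v) (at x) u" for x
  have "continuous_on U P" "continuous_on U Q"
    using assms(2) unfolding P_def Q_def numeral_2_eq_2 by auto
  then have cP: "isCont P z" and cQ: "isCont Q z"
    using assms by (auto simp: continuous_on_eq_continuous_at)
  have le: "\<bar>P z - Q z\<bar> \<le> e" if "e > 0" for e
  proof -
    have e: "e / 2 > 0" using that by simp
    obtain d0 where d0: "d0 > 0" "ball z d0 \<subseteq> U" using assms openE by blast
    obtain d1 where d1: "d1 > 0" "\<And>y. dist y z < d1 \<Longrightarrow> dist (P y) (P z) < e/2"
      using cP e unfolding continuous_at_eps_delta by blast
    obtain d2 where d2: "d2 > 0" "\<And>y. dist y z < d2 \<Longrightarrow> dist (Q y) (Q z) < e/2"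
      using cQ e unfolding continuous_at_eps_delta by blast
    define d where "d = min d0 (min d1 d2)"
    \<comment> \<open>This scale keeps the whole parallelogram with sides h u and h v within
      distance d of z; the summand 1 keeps the denominator positive when u = v = 0.\<close>
    define h where "h = d / (2 * (norm u + norm v + 1))"
    have n: "norm u + norm v + 1 > 0" by (simp add: add_nonneg_pos)
    have d: "d > 0" using d0 d1 d2 by (simp add: d_def)
    then have h: "h > 0" using n by (simp add: h_def)
    have near: "dist (z + s *\<^sub>R u + t *\<^sub>R v) z < d" if "0 \<le> s" "s \<le> h" "0 \<le> t" "t \<le> h" for s t
    proof -
      have "norm (s *\<^sub>R u + t *\<^sub>R v) \<le> s * norm u + t * norm v"
        using norm_triangle_ineq[of "s *\<^sub>R u" "t *\<^sub>R v"] that by simp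
      also have "\<dots> \<le> h * norm u + h * norm v"
        using that by (intro add_mono mult_right_mono) auto
      also have "\<dots> < h * (norm u + norm v + 1)" using h by (simp add: algebra_simps)
      also have "\<dots> = d / 2" using n by (simp only: h_def) (simp add: divide_simps)
      also have "\<dots> < d" using d by simp
      finally show ?thesis by (simp add: dist_norm algebra_simps)
    qed
    have inU: "z + s *\<^sub>R u + t *\<^sub>R v \<in> U" if "0 \<le> s" "s \<le> h" "0 \<le> t" "t \<le> h" for s t
      using near[OF that] d0 by (auto simp: d_def dist_commute)
    have inU': "z + s *\<^sub>R v + t *\<^sub>R u \<in> U" if "0 \<le> s" "s \<le> h" "0 \<le> t" "t \<le> h" for s t
      using inU[OF that(3,4,1,2)] by (simp add: ac_simps)
    obtain s t where st: "0 < s" "s < h" "0 < t" "t < h"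
      "f (z + h *\<^sub>R u + h *\<^sub>R v) - f (z + h *\<^sub>R u) - f (z + h *\<^sub>R v) + f z =
        h * h * P (z + s *\<^sub>R u + t *\<^sub>R v)"
      using second_difference_mean_value[OF assms(2) h inU] unfolding P_def by blast
    obtain s' t' where st': "0 < s'" "s' < h" "0 < t'" "t' < h"
      "f (z + h *\<^sub>R v + h *\<^sub>R u) - f (z + h *\<^sub>R v) - f (z + h *\<^sub>R u) + f z =
        h * h * Q (z + s' *\<^sub>R v + t' *\<^sub>R u)"
      using second_difference_mean_value[OF assms(2) h inU'] unfolding Q_def by blast
    have e: "z + h *\<^sub>R v + h *\<^sub>R u = z + h *\<^sub>R u + h *\<^sub>R v"
      "z + s' *\<^sub>R v + t' *\<^sub>R u = z + t' *\<^sub>R u + s' *\<^sub>R v" by simp_all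
    have "h * h * P (z + s *\<^sub>R u + t *\<^sub>R v) = h * h * Q (z + t' *\<^sub>R u + s' *\<^sub>R v)"
      using st(5) st'(5)[unfolded e] by linarith
    then have "P (z + s *\<^sub>R u + t *\<^sub>R v) = Q (z + t' *\<^sub>R u + s' *\<^sub>R v)" using h by simp
    moreover have "dist (P (z + s *\<^sub>R u + t *\<^sub>R v)) (P z) < e/2"
      using near[of s t] st by (intro d1) (simp add: d_def)
    moreover have "dist (Q (z + t' *\<^sub>R u + s' *\<^sub>R v)) (Q z) < e/2"
      using near[of t' s'] st' by (intro d2) (simp add: d_def)
    ultimately show ?thesis by (auto simp: dist_real_def abs_if split: if_splits)
  qed
  have "\<bar>P z - Q z\<bar> \<le> 0" by (rule field_le_epsilon) (unfold add_0, rule le)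
  then show ?thesis unfolding P_def Q_def by simp
qed

lemma differentiable_compose_linear:
  "bounded_linear h \<Longrightarrow> f differentiable (at x) \<Longrightarrow> (\<lambda>x. h (f x)) differentiable (at x)"
  unfolding differentiable_def using bounded_linear.has_derivative by blast

lemma frechet_derivative_compose_linear:
  assumes "bounded_linear h" "f differentiable (at x)"
  shows "frechet_derivative (\<lambda>x. h (f x)) (at x) v = h (frechet_derivative f (at x) v)"
  using frechet_derivative_at[OF bounded_linear.has_derivative[OF assms(1) iffD1[OF frechet_derivative_works assms(2)]]]
  by metis

lemma frechet_derivative_cong_open:
  assumes "open U" "z \<in> U" "\<And>x. x \<in> U \<Longrightarrow> f x = g x"
  shows "frechet_derivative f (at z) = frechet_derivative g (at z)"
proof -
  have "(f has_derivative D) (at z) \<longleftrightarrow> (g has_derivative D) (at z)" for D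
    using has_derivative_transform_within_open[OF _ assms(1,2), of f D UNIV g]
      has_derivative_transform_within_open[OF _ assms(1,2), of g D UNIV f] assms(3) by auto
  then show ?thesis unfolding frechet_derivative_def by simp
qed

text \<open>The mean value argument needs real values, hence the passage to components.\<close>

lemma second_derivative_symmetric:
  fixes f :: "'a::euclidean_space \<Rightarrow> 'b::euclidean_space"
  assumes U: "open U" and f: "smooth_on U f" and z: "z \<in> U"
  shows "frechet_derivative (\<lambda>x. frechet_derivative f (at x) u) (at z) v =
    frechet_derivative (\<lambda>x. frechet_derivative f (at x) v) (at z) u"
proof (rule euclidean_eqI)
  fix b :: 'b
  have lin: "bounded_linear (\<lambda>y::'b. y \<bullet> b)" by (rule bounded_linear_inner_left)
  have "frechet_derivative (\<lambda>x. frechet_derivative f (at x) u) (at z) v \<bullet> b =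
      frechet_derivative (\<lambda>x. frechet_derivative (\<lambda>x. f x \<bullet> b) (at x) u) (at z) v" for u v
  proof -
    have "frechet_derivative (\<lambda>x. frechet_derivative (\<lambda>x. f x \<bullet> b) (at x) u) (at z) =
        frechet_derivative (\<lambda>x. frechet_derivative f (at x) u \<bullet> b) (at z)"
      by (rule frechet_derivative_cong_open[OF U z])
        (rule frechet_derivative_compose_linear[OF lin smooth_on_differentiable[OF f]])
    then show ?thesis
      using frechet_derivative_compose_linear[OF lin smooth_on_differentiable[OF smooth_on_frechet[OF f] z]] by simp
  qed
  moreover have "Ck_on 2 U (\<lambda>x. f x \<bullet> b)"
    using smooth_on_compose_linear[OF lin U f] unfolding smooth_on_def by blast
  ultimately show "frechet_derivative (\<lambda>x. frechet_derivative f (at x) u) (at z) v \<bullet> b =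
      frechet_derivative (\<lambda>x. frechet_derivative f (at x) v) (at z) u \<bullet> b"
    using second_derivative_symmetric_real[OF U _ z] by metis
qed

text \<open>A product rule in which c is merely continuous: since g vanishes at z, the increment of
  c is multiplied by something of first order already.\<close>

lemma has_derivative_scaleR_vanishing:
  assumes c: "isCont c z" and g: "(g has_derivative g') (at z)" and 0: "g z = 0"
  shows "((\<lambda>x. c x *\<^sub>R g x) has_derivative (\<lambda>h. c z *\<^sub>R g' h)) (at z)"
proof -
  have lg: "bounded_linear g'" using g by (rule has_derivative_bounded_linear)
  obtain K where K: "\<And>h. norm (g' h) \<le> norm h * K" using bounded_linear.bounded[OF lg] by blast
  have l: "((\<lambda>x. norm (g x - g z - g' (x - z)) / norm (x - z)) \<longlongrightarrow> 0) (at z)"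
    using g unfolding has_derivative_iff_norm by simp
  have c': "(c \<longlongrightarrow> c z) (at z)" using c by (simp add: isCont_def)
  have "((\<lambda>x. \<bar>c x\<bar> * (norm (g x - g z - g' (x - z)) / norm (x - z)) + \<bar>c x - c z\<bar> * K) \<longlongrightarrow> \<bar>c z\<bar> * 0 + \<bar>c z - c z\<bar> * K) (at z)"
    by (intro tendsto_intros l c')
  then have lim: "((\<lambda>x. \<bar>c x\<bar> * (norm (g x - g z - g' (x - z)) / norm (x - z)) + \<bar>c x - c z\<bar> * K) \<longlongrightarrow> 0) (at z)"
    by simp
  have "((\<lambda>x. norm (c x *\<^sub>R g x - c z *\<^sub>R g z - c z *\<^sub>R g' (x - z)) / norm (x - z)) \<longlongrightarrow> 0) (at z)"
  proof (rule Lim_null_comparison[OF _ lim], rule eventuallyI)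
    fix x
    show "norm (norm (c x *\<^sub>R g x - c z *\<^sub>R g z - c z *\<^sub>R g' (x - z)) / norm (x - z))
      \<le> \<bar>c x\<bar> * (norm (g x - g z - g' (x - z)) / norm (x - z)) + \<bar>c x - c z\<bar> * K"
    proof (cases "x = z")
      case True
      then show ?thesis using 0 linear_0[OF bounded_linear.linear[OF lg]] by simp
    next
      case False
      have "c x *\<^sub>R g x - c z *\<^sub>R g z - c z *\<^sub>R g' (x - z) =
          c x *\<^sub>R (g x - g z - g' (x - z)) + (c x - c z) *\<^sub>R g' (x - z)"
        using 0 by (simp add: algebra_simps)
      then have "norm (c x *\<^sub>R g x - c z *\<^sub>R g z - c z *\<^sub>R g' (x - z)) \<le>
          \<bar>c x\<bar> * norm (g x - g z - g' (x - z)) + \<bar>c x - c z\<bar> * norm (g' (x - z))"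
        by (metis norm_scaleR norm_triangle_ineq)
      also have "\<dots> \<le> \<bar>c x\<bar> * norm (g x - g z - g' (x - z)) + \<bar>c x - c z\<bar> * (norm (x - z) * K)"
        using K by (simp add: mult_left_mono)
      finally show ?thesis using False by (simp add: field_simps)
    qed
  qed
  moreover have "bounded_linear (\<lambda>h. c z *\<^sub>R g' h)"
    using bounded_linear_compose[OF bounded_linear_scaleR_right lg] by simp
  ultimately show ?thesis unfolding has_derivative_iff_norm by simp
qed

text \<open>Solutions of linear equations depend differentiably on the coefficients, as can be seen
  without Cramer's rule: if \<open>Q\<close> inverts \<open>L z\<close> then \<open>x = Q y - (Q L - 1) x\<close>, where \<open>Q L - 1\<close>
  vanishes at \<open>z\<close>.\<close>

lemma differentiable_linear_solution:
  fixes L :: "'a::euclidean_space \<Rightarrow> 'b::euclidean_space \<Rightarrow> 'b"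
  assumes U: "open U" "z \<in> U" and lin: "\<And>w. w \<in> U \<Longrightarrow> linear (L w)"
    and L: "\<And>b. (\<lambda>w. L w b) differentiable (at z)" and inj: "inj (L z)"
    and y: "y differentiable (at z)" and eq: "\<And>w. w \<in> U \<Longrightarrow> L w (x w) = y w"
  shows "x differentiable (at z)"
proof -
  obtain Q where Q: "linear Q" "Q \<circ> L z = id"
    using linear_injective_left_inverse[OF lin[OF U(2)] inj] by blast
  have bQ: "bounded_linear Q" using Q(1) by (simp add: linear_conv_bounded_linear)
  have QL: "Q (L z b) = b" for b using Q(2) by (metis comp_apply id_apply)
  define N where "N w b = Q (L w b) - b" for w b
  have Nd: "(\<lambda>w. N w b) differentiable (at z)" for b
    unfolding N_def
    by (intro differentiable_diff differentiable_const differentiable_compose_linear[OF bQ] L)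
  have N0: "N z b = 0" for b by (simp add: N_def QL)
  have x: "x w = Q (y w) - (\<Sum>b\<in>Basis. (x w \<bullet> b) *\<^sub>R N w b)" if "w \<in> U" for w
  proof -
    have "Q (y w) = (\<Sum>b\<in>Basis. (x w \<bullet> b) *\<^sub>R Q (L w b))"
      using linear_Basis_sum[OF linear_compose[OF lin[OF that] Q(1)], of "x w"] eq[OF that] by simp
    moreover have "x w = (\<Sum>b\<in>Basis. (x w \<bullet> b) *\<^sub>R b)" by (simp add: euclidean_representation)
    ultimately show ?thesis
      by (simp add: N_def scaleR_diff_right sum_subtractf)
  qed
  have Qy: "(\<lambda>w. Q (y w)) differentiable (at z)"
    by (rule differentiable_compose_linear[OF bQ y])
  have Qyc: "((\<lambda>w. Q (y w)) \<longlongrightarrow> Q (y z)) (at z)"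
    using differentiable_imp_continuous_within[OF Qy] by (simp add: isCont_def)
  have Nc: "((\<lambda>w. N w b) \<longlongrightarrow> 0) (at z)" for b
    using differentiable_imp_continuous_within[OF Nd[of b]] N0[of b] by (simp add: isCont_def)
  define S where "S w = (\<Sum>b\<in>Basis. norm (N w b))" for w
  have Sc: "(S \<longlongrightarrow> 0) (at z)"
    unfolding S_def using tendsto_sum[of Basis "\<lambda>b w. norm (N w b)" "\<lambda>_. 0" "at z"] tendsto_norm_zero[OF Nc] by simp
  have bnd: "norm (x w - Q (y w)) \<le> norm (x w) * S w" if "w \<in> U" for w
  proof -
    have "norm (x w - Q (y w)) = norm (\<Sum>b\<in>Basis. (x w \<bullet> b) *\<^sub>R N w b)"
      by (subst x[OF that]) simp
    also have "\<dots> \<le> (\<Sum>b\<in>Basis. norm (x w) * norm (N w b))"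
      by (rule sum_norm_le) (simp add: Basis_le_norm mult_right_mono)
    finally show ?thesis by (simp add: S_def sum_distrib_left)
  qed
  have evU: "\<forall>\<^sub>F w in at z. w \<in> U" using U eventually_at_topological by blast
  \<comment> \<open>Nothing is known about x yet, not even boundedness. Once S w is below 1/2, the
    term containing x w on the right of the fixed point equation can be absorbed on the left, so x w
    is at most twice as long as Q (y w).\<close>
  have evS: "\<forall>\<^sub>F w in at z. S w < 1/2" using Sc by (rule order_tendstoD) simp
  have "((\<lambda>w. x w - Q (y w)) \<longlongrightarrow> 0) (at z)"
  proof (rule Lim_null_comparison)
    show "\<forall>\<^sub>F w in at z. norm (x w - Q (y w)) \<le> 2 * norm (Q (y w)) * S w"
      using evU evS
    proof eventually_elim
      case (elim w)
      have S0: "S w \<ge> 0" by (simp add: S_def sum_nonneg)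
      have "norm (x w) \<le> norm (Q (y w)) + norm (x w - Q (y w))"
        using norm_triangle_sub by blast
      also have "\<dots> \<le> norm (Q (y w)) + norm (x w) * (1/2)"
        using bnd[OF elim(1)] mult_left_mono[of "S w" "1/2" "norm (x w)"] elim(2) by simp
      finally have "norm (x w) \<le> 2 * norm (Q (y w))" by simp
      then show ?case using bnd[OF elim(1)] mult_right_mono[OF _ S0] by (meson order.trans)
    qed
    show "((\<lambda>w. 2 * norm (Q (y w)) * S w) \<longlongrightarrow> 0) (at z)"
      using tendsto_mult[OF tendsto_mult[OF tendsto_const[of 2] tendsto_norm[OF Qyc]] Sc] by simp
  qed
  from tendsto_add[OF this Qyc] have "(x \<longlongrightarrow> Q (y z)) (at z)" by simp
  moreover have "Q (y z) = x z" using x[OF U(2)] N0 by simp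
  ultimately have xc: "isCont x z" by (simp add: isCont_def)
  \<comment> \<open>Continuity of x is enough at this point, because N vanishes at z.\<close>
  have "(\<lambda>w. (x w \<bullet> b) *\<^sub>R N w b) differentiable (at z)" for b
  proof -
    have "isCont (\<lambda>w. x w \<bullet> b) z" using xc by (intro continuous_intros)
    from has_derivative_scaleR_vanishing[OF this, where g="\<lambda>w. N w b"] N0 Nd show ?thesis
      unfolding differentiable_def by blast
  qed
  then have "(\<lambda>w. Q (y w) - (\<Sum>b\<in>Basis. (x w \<bullet> b) *\<^sub>R N w b)) differentiable (at z)"
    by (intro differentiable_diff Qy differentiable_sum) auto
  then show ?thesis
    unfolding differentiable_def
    using has_derivative_transform_within_open[OF _ U, of _ _ UNIV x] x by (metis (no_types, lifting))
qed

section \<open>Curvature and its naturality\<close>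

text \<open>Differentiability of the family is assumed for each fixed argument only; in finite
  dimension a basis expansion reduces the moving argument to the ordinary product rule.\<close>

lemma has_derivative_linear_family:
  fixes f :: "'a::real_normed_vector \<Rightarrow> 'b::euclidean_space" and L :: "'a \<Rightarrow> 'b \<Rightarrow> 'c::real_normed_vector"
  assumes V: "open V" "z \<in> V" and lin: "\<And>y. y \<in> V \<Longrightarrow> linear (L y)"
    and L: "\<And>a. ((\<lambda>y. L y a) has_derivative (\<lambda>h. L' h a)) (at z)"
    and f: "(f has_derivative f') (at z)"
  shows "((\<lambda>y. L y (f y)) has_derivative (\<lambda>h. L' h (f z) + L z (f' h))) (at z)"
proof -
  \<comment> \<open>Linearity in the argument passes to the derivative of the family, by uniqueness
    of derivatives.\<close>
  have L': "L' h a = (\<Sum>i\<in>Basis. (a \<bullet> i) *\<^sub>R L' h i)" for h a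
  proof -
    have "((\<lambda>y. \<Sum>i\<in>Basis. (a \<bullet> i) *\<^sub>R L y i) has_derivative (\<lambda>h. \<Sum>i\<in>Basis. (a \<bullet> i) *\<^sub>R L' h i)) (at z)"
      by (intro has_derivative_sum has_derivative_scaleR_right L)
    then have "((\<lambda>y. L y a) has_derivative (\<lambda>h. \<Sum>i\<in>Basis. (a \<bullet> i) *\<^sub>R L' h i)) (at z)"
      by (rule has_derivative_transform_within_open[OF _ V]) (rule linear_Basis_sum[OF lin, symmetric])
    from has_derivative_unique[OF L[of a] this] show ?thesis by metis
  qed
  have "((\<lambda>y. \<Sum>i\<in>Basis. (f y \<bullet> i) *\<^sub>R L y i) has_derivative
      (\<lambda>h. \<Sum>i\<in>Basis. (f z \<bullet> i) *\<^sub>R L' h i + (f' h \<bullet> i) *\<^sub>R L z i)) (at z)"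
    by (intro has_derivative_sum has_derivative_scaleR L has_derivative_inner_left f)
  then have "((\<lambda>y. L y (f y)) has_derivative
      (\<lambda>h. \<Sum>i\<in>Basis. (f z \<bullet> i) *\<^sub>R L' h i + (f' h \<bullet> i) *\<^sub>R L z i)) (at z)"
    by (rule has_derivative_transform_within_open[OF _ V]) (rule linear_Basis_sum[OF lin, symmetric])
  moreover have "(\<Sum>i\<in>Basis. (f z \<bullet> i) *\<^sub>R L' h i + (f' h \<bullet> i) *\<^sub>R L z i) = L' h (f z) + L z (f' h)" for h
    using L'[of h "f z"] linear_Basis_sum[OF lin[OF V(2)], of "f' h"] by (simp add: sum.distrib)
  ultimately show ?thesis by simp
qed

lemma has_derivative_bilinear_family:
  fixes f :: "'a::real_normed_vector \<Rightarrow> 'b::euclidean_space" and g :: "'a \<Rightarrow> 'c::euclidean_space"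
    and B :: "'a \<Rightarrow> 'b \<Rightarrow> 'c \<Rightarrow> 'd::real_normed_vector"
  assumes V: "open V" "z \<in> V" and lin: "\<And>y. y \<in> V \<Longrightarrow> bilinear (B y)"
    and B: "\<And>a b. ((\<lambda>y. B y a b) has_derivative (\<lambda>h. B' h a b)) (at z)"
    and f: "(f has_derivative f') (at z)" and g: "(g has_derivative g') (at z)"
  shows "((\<lambda>y. B y (f y) (g y)) has_derivative
    (\<lambda>h. B' h (f z) (g z) + B z (f z) (g' h) + B z (f' h) (g z))) (at z)"
proof (rule has_derivative_linear_family[OF V _ _ f])
  show "linear (\<lambda>a. B y a (g y))" if "y \<in> V" for y
    using lin[OF that] by (simp add: bilinear_def)
  show "((\<lambda>y. B y a (g y)) has_derivative (\<lambda>h. B' h a (g z) + B z a (g' h))) (at z)" for a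
    by (rule has_derivative_linear_family[OF V _ B g]) (use lin in \<open>simp add: bilinear_def\<close>)
qed

section \<open>Levi-Civita connections, their curvature and their pullbacks\<close>

definition connection_curvature :: "('a::euclidean_space \<Rightarrow> 'a \<Rightarrow> 'a \<Rightarrow> 'a) \<Rightarrow> 'a \<Rightarrow> 'a \<Rightarrow> 'a \<Rightarrow> 'a \<Rightarrow> 'a" where
  "connection_curvature \<Gamma> z x y v =
    frechet_derivative (\<lambda>w. \<Gamma> w y v) (at z) x - frechet_derivative (\<lambda>w. \<Gamma> w x v) (at z) y
    + \<Gamma> z x (\<Gamma> z y v) - \<Gamma> z y (\<Gamma> z x v)"

text \<open>Symmetry and compatibility characterize the connection, so a guessed
  \<open>\<Gamma>\<close> can be checked without solving the Koszul formula. Differentiability is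
  listed because the curvature differentiates \<open>\<Gamma>\<close>, and compatibility alone only
  describes first derivatives of the metric.\<close>

locale levi_civita =
  fixes U :: "'a::euclidean_space set" and G :: "'a metric" and \<Gamma> :: "'a \<Rightarrow> 'a \<Rightarrow> 'a \<Rightarrow> 'a"
  assumes open_U: "open U"
    and bilinear_G: "z \<in> U \<Longrightarrow> bilinear (G z)"
    and sym_G: "z \<in> U \<Longrightarrow> G z u v = G z v u"
    and pos_G: "z \<in> U \<Longrightarrow> u \<noteq> 0 \<Longrightarrow> G z u u > 0"
    and bilinear_\<Gamma>: "z \<in> U \<Longrightarrow> bilinear (\<Gamma> z)"
    and sym_\<Gamma>: "z \<in> U \<Longrightarrow> \<Gamma> z u v = \<Gamma> z v u"
    and compatible: "z \<in> U \<Longrightarrow>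
      ((\<lambda>y. G y v x) has_derivative (\<lambda>u. G z (\<Gamma> z u v) x + G z v (\<Gamma> z u x))) (at z)"
    and differentiable_\<Gamma>: "z \<in> U \<Longrightarrow> (\<lambda>y. \<Gamma> y u v) differentiable (at z)"
begin

text \<open>Compatibility and symmetry turn the Koszul expression into 2 G(\<open>\<Gamma>\<close> u
  v, x). Positivity of the metric makes the vector representing this form unique.\<close>

lemma christoffel_eq:
  assumes z: "z \<in> U"
  shows "christoffel G z u v = \<Gamma> z u v"
proof -
  have fd: "frechet_derivative (\<lambda>y. G y v x) (at z) u = G z (\<Gamma> z u v) x + G z v (\<Gamma> z u x)" for u v x
    using frechet_derivative_at[OF compatible[OF z]] by metis
  have k: "frechet_derivative (\<lambda>y. G y v x) (at z) u + frechet_derivative (\<lambda>y. G y u x) (at z) v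
      - frechet_derivative (\<lambda>y. G y u v) (at z) x = 2 * G z (\<Gamma> z u v) x" for x
    unfolding fd using sym_G[OF z] sym_\<Gamma>[OF z] by (smt (verit))
  show ?thesis
    unfolding christoffel_def k
  proof (rule the_equality)
    fix w assume w: "\<forall>x. 2 * G z w x = 2 * G z (\<Gamma> z u v) x"
    have "G z (w - \<Gamma> z u v) (w - \<Gamma> z u v) = 0"
      using w bilinear_lsub[OF bilinear_G[OF z]] by simp
    then show "w = \<Gamma> z u v" using pos_G[OF z, of "w - \<Gamma> z u v"] by fastforce
  qed simp
qed

lemma riemann_eq:
  assumes z: "z \<in> U"
  shows "riemann G z x y v u = G z (connection_curvature \<Gamma> z x y v) u"
proof -
  have n: "nabla G (\<lambda>_. y) (\<lambda>_. v) w = \<Gamma> w y v" if "w \<in> U" for w y v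
    using christoffel_eq[OF that] frechet_derivative_const[of v] by (simp add: nabla_def)
  have "nabla G (\<lambda>_. x) (nabla G (\<lambda>_. y) (\<lambda>_. v)) z =
      frechet_derivative (\<lambda>w. \<Gamma> w y v) (at z) x + \<Gamma> z x (\<Gamma> z y v)" for x y
  proof -
    have "frechet_derivative (nabla G (\<lambda>_. y) (\<lambda>_. v)) (at z) = frechet_derivative (\<lambda>w. \<Gamma> w y v) (at z)"
      by (rule frechet_derivative_cong_open[OF open_U z n])
    then show ?thesis by (simp add: nabla_def[of G "\<lambda>_. x"] n[OF z] christoffel_eq[OF z])
  qed
  moreover have "nabla G (lie_bracket (\<lambda>_. x) (\<lambda>_. y)) (\<lambda>_. v) z = 0"
    using bilinear_lzero[OF bilinear_\<Gamma>[OF z]]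
    by (simp add: nabla_def lie_bracket_def frechet_derivative_const christoffel_eq[OF z])
  ultimately show ?thesis
    by (simp add: riemann_def curvature_op_def connection_curvature_def algebra_simps)
qed

end

locale levi_civita_pullback = levi_civita U G \<Gamma>
  for U :: "'a::euclidean_space set" and G :: "'a metric" and \<Gamma> :: "'a \<Rightarrow> 'a \<Rightarrow> 'a \<Rightarrow> 'a" +
  fixes V :: "'a set" and \<psi> :: "'a \<Rightarrow> 'a"
  assumes open_V: "open V" and smooth: "smooth_on V \<psi>" and into: "\<psi> ` V \<subseteq> U"
    and inj: "z \<in> V \<Longrightarrow> inj (frechet_derivative \<psi> (at z))"
begin

abbreviation P :: "'a \<Rightarrow> 'a \<Rightarrow> 'a" where
  "P z \<equiv> frechet_derivative \<psi> (at z)"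

abbreviation P2 :: "'a \<Rightarrow> 'a \<Rightarrow> 'a \<Rightarrow> 'a" where
  "P2 z u v \<equiv> frechet_derivative (\<lambda>y. P y v) (at z) u"

text \<open>The transformation law of Christoffel symbols. The function \<open>inv\<close> is a
  two-sided inverse here, as an injective linear map of the space to itself is bijective.\<close>

definition pullback_\<Gamma> :: "'a \<Rightarrow> 'a \<Rightarrow> 'a \<Rightarrow> 'a" where
  "pullback_\<Gamma> z u v = inv (P z) (P2 z u v + \<Gamma> (\<psi> z) (P z u) (P z v))"

lemma in_U: "z \<in> V \<Longrightarrow> \<psi> z \<in> U"
  using into by blast

lemma deriv_\<psi>: "z \<in> V \<Longrightarrow> (\<psi> has_derivative P z) (at z)"
  by (rule smooth_on_has_derivative[OF smooth])

lemma linear_P: "z \<in> V \<Longrightarrow> linear (P z)"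
  using deriv_\<psi> has_derivative_linear by blast

lemma deriv_P: "z \<in> V \<Longrightarrow> ((\<lambda>y. P y v) has_derivative (\<lambda>u. P2 z u v)) (at z)"
  using smooth_on_has_derivative[OF smooth_on_frechet[OF smooth]] .

lemma sym_P2: "z \<in> V \<Longrightarrow> P2 z u v = P2 z v u"
  by (rule second_derivative_symmetric[OF open_V smooth])

lemma bilinear_P2:
  assumes z: "z \<in> V"
  shows "bilinear (P2 z)"
proof -
  have l: "linear (\<lambda>u. P2 z u v)" for v using has_derivative_linear[OF deriv_P[OF z]] .
  moreover have "linear (\<lambda>u. P2 z v u)" for v
    using l[of v] by (subst (asm) sym_P2[OF z])
  ultimately show ?thesis by (simp add: bilinear_def)
qed

lemma P_pullback_\<Gamma>:
  assumes "z \<in> V"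
  shows "P z (pullback_\<Gamma> z u v) = P2 z u v + \<Gamma> (\<psi> z) (P z u) (P z v)"
proof -
  have "surj (P z)" using linear_injective_imp_surjective[OF linear_P inj] assms by blast
  then show ?thesis unfolding pullback_\<Gamma>_def by (rule surj_f_inv_f)
qed

lemma deriv_bilinear:
  assumes z: "z \<in> V" and lin: "\<And>w. w \<in> U \<Longrightarrow> bilinear (B w)"
    and B: "\<And>a b. ((\<lambda>w. B w a b) has_derivative (\<lambda>h. B' h a b)) (at (\<psi> z))"
  shows "((\<lambda>y. B (\<psi> y) (P y u) (P y v)) has_derivative
    (\<lambda>h. B' (P z h) (P z u) (P z v) + B (\<psi> z) (P z u) (P2 z h v) + B (\<psi> z) (P2 z h u) (P z v))) (at z)"
  by (rule has_derivative_bilinear_family[OF open_V z _ has_derivative_compose[OF deriv_\<psi>[OF z] B] deriv_P[OF z] deriv_P[OF z]])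
    (use lin in_U in blast)

lemma deriv_\<Gamma>:
  "w \<in> U \<Longrightarrow> ((\<lambda>y. \<Gamma> y a b) has_derivative (\<lambda>h. frechet_derivative (\<lambda>y. \<Gamma> y a b) (at w) h)) (at w)"
  using differentiable_\<Gamma> frechet_derivative_works by blast

lemma deriv_P_pullback_\<Gamma>:
  assumes z: "z \<in> V"
  shows "((\<lambda>y. P2 y u v + \<Gamma> (\<psi> y) (P y u) (P y v)) has_derivative
    (\<lambda>h. frechet_derivative (\<lambda>y. P2 y u v) (at z) h
      + (frechet_derivative (\<lambda>y. \<Gamma> y (P z u) (P z v)) (at (\<psi> z)) (P z h)
         + \<Gamma> (\<psi> z) (P z u) (P2 z h v) + \<Gamma> (\<psi> z) (P2 z h u) (P z v)))) (at z)"
  by (intro has_derivative_add smooth_on_has_derivative[OF smooth_on_frechet[OF smooth_on_frechet[OF smooth]] z]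
      deriv_bilinear[OF z bilinear_\<Gamma> deriv_\<Gamma>[OF in_U[OF z]]])

lemma pullback_levi_civita: "levi_civita V (pullback_metric \<psi> G) pullback_\<Gamma>"
proof
  show "open V" by (rule open_V)
  fix z assume z: "z \<in> V"
  note l = linear_P[OF z] and w = in_U[OF z] and G = bilinear_G[OF in_U[OF z]] and P = P_pullback_\<Gamma>[OF z]
  show "bilinear (pullback_metric \<psi> G z)"
    unfolding bilinear_def pullback_metric_def
    using G linear_compose[OF l, of "\<lambda>v. G (\<psi> z) a v" for a] linear_compose[OF l, of "\<lambda>v. G (\<psi> z) v a" for a]
    by (simp add: bilinear_def o_def)
  have inj0: "P z u = P z v \<Longrightarrow> u = v" for u v using inj[OF z] by (simp add: inj_eq)
  show "bilinear (pullback_\<Gamma> z)"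
  proof -
    note bi = bilinear_\<Gamma>[OF w] bilinear_P2[OF z]
    note s = bi[THEN bilinear_ladd] bi[THEN bilinear_radd] bi[THEN bilinear_lmul] bi[THEN bilinear_rmul]
      linear_add[OF l] linear_cmul[OF l]
    show ?thesis
      unfolding bilinear_def
      by (intro conjI allI linearI; rule inj0) (simp_all add: P s scaleR_add_right)
  qed
  fix u v x
  show "pullback_metric \<psi> G z u v = pullback_metric \<psi> G z v u"
    unfolding pullback_metric_def by (rule sym_G[OF w])
  show "pullback_metric \<psi> G z u u > 0" if "u \<noteq> 0"
    using that pos_G[OF w, of "P z u"] linear_injective_0[OF l] inj[OF z] unfolding pullback_metric_def by blast
  show "pullback_\<Gamma> z u v = pullback_\<Gamma> z v u"
    unfolding pullback_\<Gamma>_def using sym_P2[OF z] sym_\<Gamma>[OF w] by metis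
  have "((\<lambda>y. G (\<psi> y) (P y v) (P y x)) has_derivative
    (\<lambda>h. (G (\<psi> z) (\<Gamma> (\<psi> z) (P z h) (P z v)) (P z x) + G (\<psi> z) (P z v) (\<Gamma> (\<psi> z) (P z h) (P z x)))
      + G (\<psi> z) (P z v) (P2 z h x) + G (\<psi> z) (P2 z h v) (P z x))) (at z)"
    by (rule deriv_bilinear[OF z bilinear_G compatible[OF w]])
  then show "((\<lambda>y. pullback_metric \<psi> G y v x) has_derivative
      (\<lambda>u. pullback_metric \<psi> G z (pullback_\<Gamma> z u v) x + pullback_metric \<psi> G z v (pullback_\<Gamma> z u x))) (at z)"
    unfolding pullback_metric_def P
    by (simp add: bilinear_ladd[OF G] bilinear_radd[OF G] algebra_simps)
  \<comment> \<open>Instead of differentiating the inverse of P z, the new connection is regarded as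
    the solution of a linear equation with differentiable coefficients.\<close>
  show "(\<lambda>y. pullback_\<Gamma> y u v) differentiable (at z)"
    by (rule differentiable_linear_solution[where L=P, OF open_V z linear_P _ inj[OF z] differentiableI[OF deriv_P_pullback_\<Gamma>[OF z]] P_pullback_\<Gamma>])
      (use differentiableI[OF deriv_P[OF z]] in auto)
qed

lemma P_connection_curvature:
  assumes z: "z \<in> V"
  shows "P z (connection_curvature pullback_\<Gamma> z x y v) =
    connection_curvature \<Gamma> (\<psi> z) (P z x) (P z y) (P z v)"
proof -
  interpret pb: levi_civita V "pullback_metric \<psi> G" pullback_\<Gamma> by (rule pullback_levi_civita)
  note l = linear_P[OF z] and w = in_U[OF z] and P = P_pullback_\<Gamma>[OF z]
  have D: "P z (frechet_derivative (\<lambda>w. pullback_\<Gamma> w y v) (at z) x) =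
      frechet_derivative (\<lambda>y'. P2 y' y v) (at z) x
      + frechet_derivative (\<lambda>y'. \<Gamma> y' (P z y) (P z v)) (at (\<psi> z)) (P z x)
      + \<Gamma> (\<psi> z) (P z y) (P2 z x v) + \<Gamma> (\<psi> z) (P2 z x y) (P z v) - P2 z x (pullback_\<Gamma> z y v)" for x y
  proof -
    have "((\<lambda>w. pullback_\<Gamma> w y v) has_derivative frechet_derivative (\<lambda>w. pullback_\<Gamma> w y v) (at z)) (at z)"
      using pb.differentiable_\<Gamma>[OF z] frechet_derivative_works by blast
    from has_derivative_linear_family[where L=P, OF open_V z linear_P deriv_P[OF z] this]
    have "((\<lambda>w. P w (pullback_\<Gamma> w y v)) has_derivative (\<lambda>h. P2 z h (pullback_\<Gamma> z y v)
        + P z (frechet_derivative (\<lambda>w. pullback_\<Gamma> w y v) (at z) h))) (at z)" .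
    then have "((\<lambda>w. P2 w y v + \<Gamma> (\<psi> w) (P w y) (P w v)) has_derivative (\<lambda>h. P2 z h (pullback_\<Gamma> z y v)
        + P z (frechet_derivative (\<lambda>w. pullback_\<Gamma> w y v) (at z) h))) (at z)"
      by (rule has_derivative_transform_within_open[OF _ open_V z]) (rule P_pullback_\<Gamma>)
    from fun_cong[OF has_derivative_unique[OF this deriv_P_pullback_\<Gamma>[OF z]], of x] show ?thesis
      by (simp add: algebra_simps)
  qed
  \<comment> \<open>Symmetry of second derivatives, applied to the map y to P y v, removes the third
    derivatives of \<open>\<psi>\<close> from the antisymmetrized expression; the terms with second
    derivatives then cancel in pairs.\<close>
  have D3: "frechet_derivative (\<lambda>y'. P2 y' y v) (at z) x = frechet_derivative (\<lambda>y'. P2 y' x v) (at z) y"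
    by (rule second_derivative_symmetric[OF open_V smooth_on_frechet[OF smooth] z])
  show ?thesis
    unfolding connection_curvature_def
    by (simp add: linear_add[OF l] linear_diff[OF l] P D D3 sym_P2[OF z, of x y]
        bilinear_radd[OF bilinear_\<Gamma>[OF w]] algebra_simps)
qed

lemma riemann_pullback:
  assumes z: "z \<in> V"
  shows "riemann (pullback_metric \<psi> G) z x y v u = riemann G (\<psi> z) (P z x) (P z y) (P z v) (P z u)"
  using levi_civita.riemann_eq[OF pullback_levi_civita z] riemann_eq[OF in_U[OF z]] P_connection_curvature[OF z]
  by (simp add: pullback_metric_def)

end

section \<open>The Bochner tensor of a curvature of Bochner type\<close>

lemma frame_independent:
  fixes g :: "'a::euclidean_space \<Rightarrow> 'a \<Rightarrow> real"
  assumes g: "bilinear g" and F: "finite F" "\<And>x y. x \<in> F \<Longrightarrow> y \<in> F \<Longrightarrow> g x y = (if x = y then 1 else 0)"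
  shows "independent F"
proof -
  have "c u = 0" if s: "(\<Sum>v\<in>F. c v *\<^sub>R v) = 0" and u: "u \<in> F" for c u
  proof -
    have l: "linear (\<lambda>v. g v u)" using g by (simp add: bilinear_def)
    have "0 = g (\<Sum>v\<in>F. c v *\<^sub>R v) u" using s bilinear_lzero[OF g] by simp
    also have "\<dots> = (\<Sum>v\<in>F. c v * g v u)"
      using linear_sum[OF l, of "\<lambda>v. c v *\<^sub>R v" F] linear_cmul[OF l] by simp
    also have "\<dots> = (\<Sum>v\<in>F. if v = u then c v else 0)"
      by (rule sum.cong) (use F(2) u in auto)
    also have "\<dots> = c u" using F(1) u by simp
    finally show "c u = 0" by simp
  qed
  then show ?thesis using independent_if_scalars_zero[OF F(1)] by blast
qed

lemma orthonormal_frame_expansion: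
  fixes G :: "'a::euclidean_space metric"
  assumes g: "bilinear (G z)" and F: "orthonormal_frame G z F"
  shows "v = (\<Sum>e\<in>F. G z v e *\<^sub>R e)"
proof -
  have f: "finite F" and c: "card F = DIM('a)"
    and o: "\<And>x y. x \<in> F \<Longrightarrow> y \<in> F \<Longrightarrow> G z x y = (if x = y then 1 else 0)"
    using F unfolding orthonormal_frame_def by auto
  have "independent F" by (rule frame_independent[OF g f o])
  then have "span F = UNIV" using c f by (metis card_ge_dim_independent dim_UNIV subset_UNIV top.extremum_uniqueI order_refl)
  then obtain r where r: "v = (\<Sum>e\<in>F. r e *\<^sub>R e)" using span_finite[OF f] by auto
  have "G z v u = r u" if u: "u \<in> F" for u
  proof -
    have l: "linear (\<lambda>v. G z v u)" using g by (simp add: bilinear_def)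
    have "G z v u = (\<Sum>e\<in>F. r e * G z e u)"
      unfolding r using linear_sum[OF l, of "\<lambda>v. r v *\<^sub>R v" F] linear_cmul[OF l] by simp
    also have "\<dots> = (\<Sum>e\<in>F. if e = u then r e else 0)"
      by (rule sum.cong) (use o u in auto)
    also have "\<dots> = r u" using f u by simp
    finally show ?thesis .
  qed
  then show ?thesis using r by simp
qed

text \<open>One Gram-Schmidt step for each step of the induction. Existence is what makes the choice
  of a frame in \<open>ricci\<close> and \<open>scalar_curvature\<close> meaningful.\<close>

lemma orthonormal_frame_exists:
  fixes G :: "'a::euclidean_space metric"
  assumes g: "bilinear (G z)" and sym: "\<And>u v. G z u v = G z v u" and pos: "\<And>u. u \<noteq> 0 \<Longrightarrow> G z u u > 0"
  shows "\<exists>F. orthonormal_frame G z F"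
proof -
  have "\<exists>F. finite F \<and> card F = m \<and> (\<forall>x\<in>F. \<forall>y\<in>F. G z x y = (if x = y then 1 else 0))"
    if "m \<le> DIM('a)" for m
    using that
  proof (induction m)
    case (Suc m)
    then obtain F where F: "finite F" "card F = m"
      "\<And>x y. x \<in> F \<Longrightarrow> y \<in> F \<Longrightarrow> G z x y = (if x = y then 1 else 0)" by auto
    have "span F \<noteq> UNIV"
    proof
      assume "span F = UNIV"
      then have "DIM('a) \<le> card F" using F(1) by (metis dim_UNIV dim_le_card top.extremum)
      then show False using F(2) Suc.prems by simp
    qed
    then obtain v where v: "v \<notin> span F" by auto
    define w where "w = v - (\<Sum>e\<in>F. G z v e *\<^sub>R e)"
    have w0: "w \<noteq> 0"
    proof
      assume "w = 0"
      then have "v = (\<Sum>e\<in>F. G z v e *\<^sub>R e)" by (simp add: w_def)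
      then show False using v by (metis (no_types, lifting) span_base span_scale span_sum)
    qed
    have wu: "G z w u = 0" if u: "u \<in> F" for u
    proof -
      have l: "linear (\<lambda>v. G z v u)" using g by (simp add: bilinear_def)
      have "G z (\<Sum>e\<in>F. G z v e *\<^sub>R e) u = (\<Sum>e\<in>F. G z v e * G z e u)"
        using linear_sum[OF l, of "\<lambda>e. G z v e *\<^sub>R e" F] linear_cmul[OF l] by simp
      also have "\<dots> = (\<Sum>e\<in>F. if e = u then G z v e else 0)"
        by (rule sum.cong) (use F(3) u in auto)
      also have "\<dots> = G z v u" using F(1) u by simp
      finally show ?thesis unfolding w_def by (simp add: bilinear_lsub[OF g])
    qed
    define n where "n = (1 / sqrt (G z w w)) *\<^sub>R w"
    have nn: "G z n n = 1"
      using pos[OF w0] by (simp add: n_def bilinear_lmul[OF g] bilinear_rmul[OF g] divide_simps)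
    have nu: "G z n u = 0" if "u \<in> F" for u
      using wu[OF that] by (simp add: n_def bilinear_lmul[OF g])
    have un: "G z u n = 0" if "u \<in> F" for u
      using nu[OF that] sym[of u n] by simp
    have nF: "n \<notin> F" using nu nn by force
    show ?case
      by (intro exI[of _ "insert n F"]) (use F nF nn nu un in auto)
  qed (auto intro: exI[of _ "{}"])
  then show ?thesis unfolding orthonormal_frame_def by blast
qed

section \<open>Hermitian forms and complexified tensors\<close>

definition sesquilinear :: "(complex^'n \<Rightarrow> complex^'n \<Rightarrow> complex) \<Rightarrow> bool" where
  "sesquilinear h \<longleftrightarrow>
     (\<forall>u v w. h (u + v) w = h u w + h v w) \<and> (\<forall>u v w. h w (u + v) = h w u + h w v) \<and>
     (\<forall>c u v. h (c *s u) v = c * h u v) \<and> (\<forall>c u v. h u (c *s v) = cnj c * h u v)"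

lemma scaleR_eq_scalar: "r *\<^sub>R (u :: complex^'n) = complex_of_real r *s u"
  by (simp add: vec_eq_iff complex_eq_iff)

text \<open>A real-linear function splits into a complex linear and a complex antilinear part; the vectors
  \<open>\<partial>/\<partial>z\<^sup>\<alpha>\<close> see only the former.\<close>

lemma cext_dz:
  assumes "\<And>u. T u = p u + m u" "\<And>c u. p (c *s u) = c * p u" "\<And>c u. m (c *s u) = cnj c * m u"
  shows "cext T (dz \<alpha>) = p (axis \<alpha> 1)" "cext T (dzbar \<alpha>) = m (axis \<alpha> 1)"
proof -
  have i: "(1/2) *\<^sub>R axis \<alpha> 1 = (1/2) *s (axis \<alpha> 1 :: complex^'n)"
    "(1/2) *\<^sub>R axis \<alpha> \<i> = (\<i>/2) *s (axis \<alpha> 1 :: complex^'n)"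
    "(-1/2) *\<^sub>R axis \<alpha> \<i> = (-\<i>/2) *s (axis \<alpha> 1 :: complex^'n)" for \<alpha> :: "'n::finite"
    by (simp_all add: vec_eq_iff axis_def complex_eq_iff)
  show "cext T (dz \<alpha>) = p (axis \<alpha> 1)" "cext T (dzbar \<alpha>) = m (axis \<alpha> 1)"
    unfolding cext_def dz_def dzbar_def fst_conv snd_conv i assms
    by (simp_all add: algebra_simps)
qed

text \<open>The combination of metric and Ricci tensor in the Bochner tensor, with S in place of the
  Ricci tensor. For curvatures of this shape S is a multiple of the Ricci form corrected by a
  multiple of the metric, see \<open>ricci_eq\<close>.\<close>

definition bochner_type ::
    "(complex^'n \<Rightarrow> complex^'n \<Rightarrow> complex) \<Rightarrow> (complex^'n \<Rightarrow> complex^'n \<Rightarrow> complex) \<Rightarrow>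
     complex^'n \<Rightarrow> complex^'n \<Rightarrow> complex^'n \<Rightarrow> complex^'n \<Rightarrow> complex" where
  "bochner_type g S x y u v = g x y * S u v + g u y * S x v + g u v * S x y + g x v * S u y"

text \<open>If \<open>l\<close> annihilates a vector orthogonal to one on which it does not vanish, then \<open>E\<close> is the only
  obstruction to the vanishing of the Bochner tensor at \<open>z\<close>.\<close>

locale almost_bochner =
  fixes G :: "(complex^'n::finite) metric" and z :: "complex^'n"
    and h S :: "complex^'n \<Rightarrow> complex^'n \<Rightarrow> complex" and E :: complex and l :: "complex^'n \<Rightarrow> complex"
  assumes sesq: "sesquilinear h" "sesquilinear S"
    and hermitian: "h v u = cnj (h u v)" "S v u = cnj (S u v)"
    and l_scale: "l (c *s u) = c * l u"
    and metric: "G z u v = Re (h u v)"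
    and positive: "u \<noteq> 0 \<Longrightarrow> G z u u > 0"
    and curvature: "riemann G z x y v u =
      Re ((bochner_type h S y x v u - E * l y * cnj (l x) * l v * cnj (l u))
        - (bochner_type h S x y v u - E * l x * cnj (l y) * l v * cnj (l u)))"
begin

lemma h_linear: "h (u + v) w = h u w + h v w" "h w (u + v) = h w u + h w v"
    "h (c *s u) v = c * h u v" "h u (c *s v) = cnj c * h u v"
  and S_linear: "S (u + v) w = S u w + S v w" "S w (u + v) = S w u + S w v"
    "S (c *s u) v = c * S u v" "S u (c *s v) = cnj c * S u v"
  using sesq unfolding sesquilinear_def by simp_all

definition R4 :: "complex^'n \<Rightarrow> complex^'n \<Rightarrow> complex^'n \<Rightarrow> complex^'n \<Rightarrow> complex" where
  "R4 x y u v = bochner_type h S x y u v - E * l x * cnj (l y) * l u * cnj (l v)"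

lemma R4_scale:
  "R4 (c *s x) y u v = c * R4 x y u v" "R4 x (c *s y) u v = cnj c * R4 x y u v"
  "R4 x y (c *s u) v = c * R4 x y u v" "R4 x y u (c *s v) = cnj c * R4 x y u v"
  by (simp_all add: R4_def bochner_type_def h_linear S_linear l_scale algebra_simps)

lemma Re_half: "complex_of_real (Re c) = c / 2 + cnj c / 2"
  by (simp add: complex_eq_iff)

text \<open>The real curvature is the real part of a difference of two terms in which x and y are
  exchanged. Since \<open>R4\<close> is linear in its first and third slot and antilinear in the
  others, the types of the four inserted vectors kill one term together with the conjugates; the
  factor 1/2 comes from the real part.\<close>

lemma cext4_riemann:
  "cext4 (riemann G z) (dz \<alpha>) (dzbar \<beta>) (dz \<gamma>) (dzbar \<delta>) =
    - R4 (axis \<alpha> 1) (axis \<beta> 1) (axis \<gamma> 1) (axis \<delta> 1) / 2"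
proof -
  let ?e = "\<lambda>\<alpha>. axis \<alpha> 1 :: complex^'n"
  have R: "riemann G z x y v u = Re (R4 y x v u - R4 x y v u)" for x y v u
    by (simp add: curvature R4_def)
  have 1: "cext (\<lambda>u. complex_of_real (riemann G z x y v u)) (dzbar \<delta>) =
      (R4 y x v (?e \<delta>) - R4 x y v (?e \<delta>)) / 2" for x y v
    by (rule cext_dz(2)[where p="\<lambda>u. cnj (R4 y x v u - R4 x y v u) / 2"])
      (simp_all add: R Re_half R4_scale algebra_simps diff_divide_distrib add_divide_distrib)
  have 2: "cext (\<lambda>v. (R4 y x v (?e \<delta>) - R4 x y v (?e \<delta>)) / 2) (dz \<gamma>) =
      (R4 y x (?e \<gamma>) (?e \<delta>) - R4 x y (?e \<gamma>) (?e \<delta>)) / 2" for x y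
    by (rule cext_dz(1)[where m="\<lambda>u. 0"]) (simp_all add: R4_scale algebra_simps)
  have 3: "cext (\<lambda>y. (R4 y x (?e \<gamma>) (?e \<delta>) - R4 x y (?e \<gamma>) (?e \<delta>)) / 2) (dzbar \<beta>) =
      - R4 x (?e \<beta>) (?e \<gamma>) (?e \<delta>) / 2" for x
    by (rule cext_dz(2)[where p="\<lambda>y. R4 y x (?e \<gamma>) (?e \<delta>) / 2"])
      (simp_all add: R4_scale algebra_simps diff_divide_distrib)
  have 4: "cext (\<lambda>x. - R4 x (?e \<beta>) (?e \<gamma>) (?e \<delta>) / 2) (dz \<alpha>) =
      - R4 (?e \<alpha>) (?e \<beta>) (?e \<gamma>) (?e \<delta>) / 2"
    by (rule cext_dz(1)[where m="\<lambda>u. 0"]) (simp_all add: R4_scale)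
  show ?thesis unfolding cext4_def 1 2 3 4 ..
qed

lemma cext2_hermitian:
  assumes "\<And>u v. B u v = Re (b u v)" "sesquilinear b"
  shows "cext2 B (dz \<alpha>) (dzbar \<beta>) = b (axis \<alpha> 1) (axis \<beta> 1) / 2"
proof -
  have s: "b (c *s u) v = c * b u v" "b u (c *s v) = cnj c * b u v" for c u v
    using assms(2) unfolding sesquilinear_def by simp_all
  have 1: "cext (\<lambda>v. complex_of_real (B u v)) (dzbar \<beta>) = b u (axis \<beta> 1) / 2" for u
    by (rule cext_dz(2)[where p="\<lambda>v. cnj (b u v) / 2"]) (simp_all add: assms(1) Re_half s)
  have 2: "cext (\<lambda>u. b u (axis \<beta> 1) / 2) (dz \<alpha>) = b (axis \<alpha> 1) (axis \<beta> 1) / 2"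
    by (rule cext_dz(1)[where m="\<lambda>v. 0"]) (simp_all add: s)
  show ?thesis unfolding cext2_def 1 2 ..
qed

lemma bilinear_metric: "bilinear (G z)"
  unfolding bilinear_def
  by (intro conjI allI linearI)
    (simp_all add: metric h_linear scaleR_eq_scalar)

definition F :: "(complex^'n) set" where "F = (SOME F. orthonormal_frame G z F)"

lemma frame: "orthonormal_frame G z F"
  unfolding F_def
proof (rule someI_ex, rule orthonormal_frame_exists[where G=G and z=z])
  show "bilinear (G z)" by (rule bilinear_metric)
  show "G z u v = G z v u" for u v by (simp add: metric hermitian(1)[of u v])
qed (rule positive)

lemma finite_F: "finite F" and card_F: "card F = 2 * CARD('n)"
    and G_F: "x \<in> F \<Longrightarrow> y \<in> F \<Longrightarrow> G z x y = (if x = y then 1 else 0)"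
  using iffD1[OF orthonormal_frame_def frame] by (blast, simp, blast)

lemma h_F: "e \<in> F \<Longrightarrow> h e e = 1"
  using G_F[of e e] hermitian(1)[of e e] by (simp add: metric complex_eq_iff)

lemma sum_G_F:
  assumes "\<And>u v. p (u + v) = p u + p v" "\<And>r u. p (complex_of_real r *s u) = complex_of_real r * p u"
  shows "(\<Sum>e\<in>F. complex_of_real (G z v e) * p e) = p v"
proof -
  have 0: "p 0 = 0" using assms(2)[of 0 0] by simp
  have "p (\<Sum>e\<in>A. G z v e *\<^sub>R e) = (\<Sum>e\<in>A. complex_of_real (G z v e) * p e)" if "finite A" for A
    using that by (induction A) (simp_all add: 0 assms scaleR_eq_scalar)
  from this[OF finite_F] show ?thesis
    using orthonormal_frame_expansion[where G=G and z=z, OF bilinear_metric frame, of v] by simp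
qed

lemma h_eq_G: "h u v = complex_of_real (G z u v) - \<i> * complex_of_real (G z (\<i> *s u) v)"
  by (simp add: metric h_linear complex_eq_iff)

text \<open>Taking p only real-linear covers two cases at once: a sum against h v e gives 2 p v for
  complex linear p and 0 for antilinear p, and against h e v it is the other way round. The proof
  splits h into G and G composed with multiplication by i.\<close>

lemma sum_h_F:
  assumes "\<And>u v. p (u + v) = p u + p v" "\<And>r u. p (complex_of_real r *s u) = complex_of_real r * p u"
  shows "(\<Sum>e\<in>F. h v e * p e) = p v - \<i> * p (\<i> *s v)" "(\<Sum>e\<in>F. h e v * p e) = p v + \<i> * p (\<i> *s v)"
proof -
  have "(\<Sum>e\<in>F. h v e * p e) =
      (\<Sum>e\<in>F. complex_of_real (G z v e) * p e - \<i> * (complex_of_real (G z (\<i> *s v) e) * p e))"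
    by (rule sum.cong) (simp_all add: h_eq_G[of v] algebra_simps)
  then show "(\<Sum>e\<in>F. h v e * p e) = p v - \<i> * p (\<i> *s v)"
    by (simp add: sum_subtractf sum_distrib_left[symmetric] sum_G_F[OF assms])
  have "(\<Sum>e\<in>F. h e v * p e) =
      (\<Sum>e\<in>F. complex_of_real (G z v e) * p e + \<i> * (complex_of_real (G z (\<i> *s v) e) * p e))"
    by (rule sum.cong) (simp_all add: hermitian(1)[of _ v] h_eq_G[of v] algebra_simps)
  then show "(\<Sum>e\<in>F. h e v * p e) = p v + \<i> * p (\<i> *s v)"
    by (simp add: sum.distrib sum_distrib_left[symmetric] sum_G_F[OF assms])
qed

definition trS :: real where "trS = (\<Sum>e\<in>F. Re (S e e))"

lemma ricci_eq:
  assumes "E = 0"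
  shows "ricci G z y v = Re (- (of_real (2 * real CARD('n) + 4) * S y v + of_real trS * h y v))"
proof -
  have lin: "\<And>u v. S w (u + v) = S w u + S w v"
    "\<And>r u. S w (complex_of_real r *s u) = complex_of_real r * S w u"
    "\<And>u v. S (u + v) w = S u w + S v w"
    "\<And>r u. S (complex_of_real r *s u) w = complex_of_real r * S u w" for w
    by (simp_all add: S_linear)
  have "Im (S e e) = 0" for e using arg_cong[OF hermitian(2)[of e e], of Im] by simp
  then have "S e e = complex_of_real (Re (S e e))" for e by (simp add: complex_eq_iff)
  then have tr: "(\<Sum>e\<in>F. S e e) = of_real trS" unfolding trS_def of_real_sum by (rule sum.cong[OF refl])
  \<comment> \<open>Both slots filled with e are antilinear, and such a contraction over a real
    frame vanishes.\<close>
  have 1: "(\<Sum>e\<in>F. bochner_type h S y e v e) = 0"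
    unfolding bochner_type_def sum.distrib
    by (simp add: sum_h_F(1)[OF lin(1,2)] S_linear)
  \<comment> \<open>Of the factor 2 n + 4, the two mixed contractions contribute 2 each, and the
    last sum contributes the real dimension 2 n.\<close>
  have "(\<Sum>e\<in>F. bochner_type h S e y v e) =
      (\<Sum>e\<in>F. h e y * S v e) + h v y * (\<Sum>e\<in>F. S e e) + (\<Sum>e\<in>F. h v e * S e y) + (\<Sum>e\<in>F. S v y)"
    unfolding bochner_type_def sum.distrib sum_distrib_left by (simp add: h_F)
  also have "\<dots> = of_real (2 * real CARD('n) + 4) * S v y + of_real trS * h v y"
    unfolding tr sum_h_F(2)[OF lin(1,2)] sum_h_F(1)[OF lin(3,4)]
    by (simp add: S_linear card_F algebra_simps)
  finally have 2: "(\<Sum>e\<in>F. bochner_type h S e y v e) = of_real (2 * real CARD('n) + 4) * S v y + of_real trS * h v y" .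
  have "ricci G z y v = Re ((\<Sum>e\<in>F. bochner_type h S y e v e) - (\<Sum>e\<in>F. bochner_type h S e y v e))"
    by (simp add: ricci_def F_def[symmetric] curvature assms sum_subtractf)
  also have "\<dots> = Re (- (of_real (2 * real CARD('n) + 4) * S y v + of_real trS * h y v))"
    unfolding 1 2 by (simp add: hermitian[of v y])
  finally show ?thesis .
qed

lemma scalar_curvature_eq:
  assumes "E = 0"
  shows "scalar_curvature G z = - 4 * (real CARD('n) + 1) * trS"
proof -
  have "scalar_curvature G z = (\<Sum>e\<in>F. - ((2 * real CARD('n) + 4) * Re (S e e) + trS))"
    unfolding scalar_curvature_def F_def[symmetric] by (rule sum.cong) (simp_all add: ricci_eq[OF assms] h_F)
  also have "\<dots> = - ((2 * real CARD('n) + 4) * trS + 2 * real CARD('n) * trS)"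
    unfolding trS_def[symmetric] sum_negf sum.distrib sum_distrib_left[symmetric] by (simp add: card_F)
  finally show ?thesis by (simp add: algebra_simps)
qed

lemma bochner_eq_0:
  assumes "E = 0"
  shows "bochner G z \<alpha> \<beta> \<gamma> \<delta> = 0"
proof -
  let ?e = "\<lambda>\<alpha>. axis \<alpha> 1 :: complex^'n"
  have s: "sesquilinear (\<lambda>y v. - (of_real (2 * real CARD('n) + 4) * S y v + of_real trS * h y v))"
    unfolding sesquilinear_def by (simp add: S_linear h_linear algebra_simps)
  have rho: "cext2 (ricci G z) (dz \<mu>) (dzbar \<nu>) =
      - (of_real (2 * real CARD('n) + 4) * S (?e \<mu>) (?e \<nu>) + of_real trS * h (?e \<mu>) (?e \<nu>)) / 2" for \<mu> \<nu>
    by (rule cext2_hermitian[OF ricci_eq[OF assms] s])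
  have g: "cext2 (G z) (dz \<mu>) (dzbar \<nu>) = h (?e \<mu>) (?e \<nu>) / 2" for \<mu> \<nu>
    by (rule cext2_hermitian[OF metric sesq(1)])
  have R: "cext4 (riemann G z) (dz \<alpha>) (dzbar \<beta>) (dz \<gamma>) (dzbar \<delta>) =
      - bochner_type h S (?e \<alpha>) (?e \<beta>) (?e \<gamma>) (?e \<delta>) / 2"
    unfolding cext4_riemann R4_def by (simp add: assms)
  define N where "N = complex_of_real (1 / (real CARD('n) + 2))"
  define c where "c = complex_of_real (2 * real CARD('n) + 4)"
  define t where "t = complex_of_real trS"
  have "1 / (real CARD('n) + 2) * (2 * real CARD('n) + 4) = 2" by (simp add: divide_simps)
  then have Nc: "N * c = 2" unfolding N_def c_def of_real_mult[symmetric] by simp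
  have "scalar_curvature G z / (2 * (real CARD('n) + 1) * (real CARD('n) + 2)) =
      - 2 * (trS * (1 / (real CARD('n) + 2)))"
    unfolding scalar_curvature_eq[OF assms] by (simp add: divide_simps) (simp add: algebra_simps)
  then have T: "complex_of_real (scalar_curvature G z / (2 * (real CARD('n) + 1) * (real CARD('n) + 2))) = - 2 * (t * N)"
    unfolding N_def t_def by (simp only: of_real_mult of_real_minus of_real_numeral)
  \<comment> \<open>The fourth comes from the halves in the complexified metric and Ricci tensor,
    the half from the complexified curvature. The part of the Ricci tensor proportional to h has
    cancelled against the scalar curvature term.\<close>
  have "bochner G z \<alpha> \<beta> \<gamma> \<delta> = (N * c / 4 - 1 / 2) * bochner_type h S (?e \<alpha>) (?e \<beta>) (?e \<gamma>) (?e \<delta>)"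
    unfolding bochner_def Let_def rho g R T N_def[symmetric] c_def[symmetric] t_def[symmetric] bochner_type_def
    by (simp add: field_simps)
  then show ?thesis by (simp add: Nc)
qed

text \<open>The components with indices j j j j and k k j j do not contain E, because l annihilates
  the j-th basis vector; they force the quantities \<open>s j\<close> and \<open>s k\<close> to
  vanish. What is left of the component k k k k is E times the fourth power of the modulus of l at
  the k-th vector.\<close>

lemma bochner_eq_0_imp:
  assumes b: "\<And>\<alpha> \<beta> \<gamma> \<delta>. bochner G z \<alpha> \<beta> \<gamma> \<delta> = 0"
    and jk: "h (axis j 1) (axis k 1) = 0" "l (axis j 1) = 0" "l (axis k 1) \<noteq> 0"
  shows "E = 0"
proof -
  let ?e = "\<lambda>\<alpha>. axis \<alpha> 1 :: complex^'n"
  have g: "cext2 (G z) (dz \<mu>) (dzbar \<nu>) = h (?e \<mu>) (?e \<nu>) / 2" for \<mu> \<nu>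
    by (rule cext2_hermitian[OF metric sesq(1)])
  have kj: "h (?e k) (?e j) = 0" using hermitian(1)[of "?e k" "?e j"] jk(1) by simp
  have nz: "h (?e i) (?e i) \<noteq> 0" for i
    using positive[of "?e i"] by (auto simp: metric axis_eq_0_iff)
  define N where "N = complex_of_real (1 / (real CARD('n) + 2))"
  define T where "T = complex_of_real (scalar_curvature G z / (2 * (real CARD('n) + 1) * (real CARD('n) + 2)))"
  define r where "r i = cext2 (ricci G z) (dz i) (dzbar i)" for i
  define H where "H i = h (?e i) (?e i)" for i
  \<comment> \<open>The combination in which S, the unknown Ricci entry and the unknown scalar
    curvature enter these three components.\<close>
  define s where "s i = S (?e i) (?e i) + N * r i - T * H i / 4" for i
  note B = b[unfolded bochner_def Let_def g cext4_riemann R4_def bochner_type_def N_def[symmetric] T_def[symmetric]]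
  have "H j * s j = 0"
    using B[of j j j j] jk(2) by (simp add: r_def[symmetric] H_def[symmetric] s_def field_simps)
  then have sj: "s j = 0" using nz by (simp add: H_def)
  have "H k * s j + H j * s k = 0"
    using B[of k k j j] jk kj by (simp add: r_def[symmetric] H_def[symmetric] s_def field_simps)
  then have sk: "s k = 0" using sj nz by (simp add: H_def)
  have "E * l (?e k) * cnj (l (?e k)) * l (?e k) * cnj (l (?e k)) =
      4 * H k * S (?e k) (?e k) + 4 * N * H k * r k - T * H k * H k"
    using B[of k k k k] by (simp add: r_def[symmetric] H_def[symmetric] field_simps)
  also have "\<dots> = 4 * H k * s k" by (simp add: s_def algebra_simps)
  finally have "E * l (?e k) * cnj (l (?e k)) * l (?e k) * cnj (l (?e k)) = 4 * H k * s k" .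
  then show ?thesis using sk jk(3) by simp
qed

end

section \<open>Rotationally symmetric Kaehler metrics on the negative cone\<close>

definition herm :: "'n::finite \<Rightarrow> complex^'n \<Rightarrow> complex^'n \<Rightarrow> complex" where
  "herm k u v = (\<Sum>j\<in>UNIV - {k}. u $ j * cnj (v $ j)) - u $ k * cnj (v $ k)"

lemma lorentz_eq_Re_herm: "lorentz k u v = Re (herm k u v)"
  by (simp add: lorentz_def herm_def)

lemma sesquilinear_herm: "sesquilinear (herm k)"
  unfolding sesquilinear_def herm_def
  by (simp add: algebra_simps sum.distrib sum_distrib_left)

lemma herm_linear:
  "herm k (u + v) w = herm k u w + herm k v w" "herm k w (u + v) = herm k w u + herm k w v"
  "herm k (c *s u) v = c * herm k u v" "herm k u (c *s v) = cnj c * herm k u v"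
  using sesquilinear_herm[of k] unfolding sesquilinear_def by simp_all

lemma herm_commute: "herm k v u = cnj (herm k u v)"
  by (simp add: herm_def mult.commute)

lemma herm_diff: "herm k (u - v) w = herm k u w - herm k v w"
  using herm_linear(1)[of k "u - v" v w] by simp

lemma bounded_bilinear_herm: "bounded_bilinear (herm k)"
  unfolding bilinear_conv_bounded_bilinear[symmetric] bilinear_def
  by (intro conjI allI linearI) (simp_all add: herm_linear scaleR_eq_scalar scaleR_conv_of_real)

lemma bounded_bilinear_scalar: "bounded_bilinear ((*s) :: complex \<Rightarrow> complex^'n \<Rightarrow> complex^'n)"
  unfolding bilinear_conv_bounded_bilinear[symmetric] bilinear_def
  by (intro conjI allI linearI) (simp_all add: vec_eq_iff algebra_simps)

text \<open>Orthogonality equates the modulus of the k-th term with that of the sum over the other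
  coordinates. Cauchy-Schwarz bounds the latter, and w being time-like makes the resulting
  comparison of d with its k-th coordinate strict.\<close>

lemma herm_timelike_orthogonal:
  assumes w: "lorentz k w w < 0" and d: "herm k d w = 0" "d \<noteq> 0"
  shows "lorentz k d d > 0"
proof -
  have L: "lorentz k u u = (\<Sum>j\<in>UNIV - {k}. (cmod (u $ j))\<^sup>2) - (cmod (u $ k))\<^sup>2" for u
  proof -
    have "Re (c * cnj c) = (cmod c)\<^sup>2" for c
      by (simp only: complex_mult_cnj Re_complex_of_real cmod_power2)
    then show ?thesis unfolding lorentz_def by simp
  qed
  define D where "D = (\<Sum>j\<in>UNIV - {k}. (cmod (d $ j))\<^sup>2)"
  define W where "W = (\<Sum>j\<in>UNIV - {k}. (cmod (w $ j))\<^sup>2)"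
  have W0: "0 \<le> W" and D0: "0 \<le> D" by (simp_all add: W_def D_def sum_nonneg)
  have W: "W < (cmod (w $ k))\<^sup>2" using w by (simp add: L W_def)
  have "cmod (d $ k) * cmod (w $ k) = cmod (\<Sum>j\<in>UNIV - {k}. d $ j * cnj (w $ j))"
    using d(1) by (simp add: herm_def norm_mult[symmetric]) (simp add: norm_mult)
  also have "\<dots> \<le> (\<Sum>j\<in>UNIV - {k}. cmod (d $ j) * cmod (w $ j))"
    by (rule sum_norm_le) (simp add: norm_mult)
  finally have "(cmod (d $ k) * cmod (w $ k))\<^sup>2 \<le> (\<Sum>j\<in>UNIV - {k}. cmod (d $ j) * cmod (w $ j))\<^sup>2"
    by (simp add: power_mono)
  also have "\<dots> \<le> D * W" unfolding D_def W_def by (rule Cauchy_Schwarz_ineq_sum)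
  finally have CS: "(cmod (d $ k))\<^sup>2 * (cmod (w $ k))\<^sup>2 \<le> D * W" by (simp add: power_mult_distrib)
  show ?thesis
  proof (cases "d $ k = 0")
    case True
    have "D > 0"
    proof (rule ccontr)
      assume "\<not> D > 0"
      then have "D = 0" using D0 by simp
      then have "\<forall>j\<in>UNIV - {k}. (cmod (d $ j))\<^sup>2 = 0" unfolding D_def by (subst (asm) sum_nonneg_eq_0_iff) auto
      then have "d = 0" using True by (auto simp: vec_eq_iff)
      then show False using d(2) by simp
    qed
    then show ?thesis using True by (simp add: L D_def)
  next
    case False
    then have k: "(cmod (d $ k))\<^sup>2 > 0" by simp
    have "D > (cmod (d $ k))\<^sup>2"
    proof (rule ccontr)
      assume "\<not> D > (cmod (d $ k))\<^sup>2"
      then have "D * W \<le> (cmod (d $ k))\<^sup>2 * W" using W0 by (simp add: mult_right_mono)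
      also have "\<dots> < (cmod (d $ k))\<^sup>2 * (cmod (w $ k))\<^sup>2" using W k by simp
      finally show False using CS by simp
    qed
    then show ?thesis by (simp add: L D_def)
  qed
qed

text \<open>The coordinate-free content of \<open>hform_Q\<close>: xy stands for H x y, X and U for
  H x w and H u w, Y and V for H w y and H w v, and p for a/2, which keeps the coefficients
  integral. The hypothesis is what balances the terms xy U V and uy X V; the last line collects what
  remains, a multiple of X Y U V.\<close>

lemma bochner_type_identity:
  fixes A p b b1 r xy uy uv xv X U Y V :: complex
  assumes "a1 = 2 * p * b * r - 4 * p * p - b"
  shows "(2 * p * xy - a1 * X * Y) * (A * (uv + 2 * p * U * V)) + (2 * p * uy - a1 * U * Y) * (A * (xv + 2 * p * X * V))
    + (b * (xy * U + X * uy) - b1 * Y * X * U) * (A * (V + 2 * p * (- r) * V)) =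
   A * (xy + 2 * p * X * Y) * (p * uv - (a1 + 2 * p * p) * U * V) + A * (uy + 2 * p * U * Y) * (p * xv - (a1 + 2 * p * p) * X * V)
   + A * (uv + 2 * p * U * V) * (p * xy - (a1 + 2 * p * p) * X * Y) + A * (xv + 2 * p * X * V) * (p * uy - (a1 + 2 * p * p) * U * Y)
   - A * ((1 - r * (2 * p)) * b1 - 4 * p * a1 - 16 * p * p * p) * X * Y * U * V"
  unfolding assms by algebra

text \<open>The equation for the derivative of a serves to introduce b: solved for b it reads (a' +
  a^2) / (r a - 1), the third coefficient of the connection. The condition r a > 1 is positivity of
  the metric in the direction w.\<close>

locale cone_metric =
  fixes k :: "'n::finite" and R :: "real set" and A a b b1 :: "real \<Rightarrow> real"
  assumes open_R: "open R" and R_pos: "r \<in> R \<Longrightarrow> r > 0"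
    and A_pos: "r \<in> R \<Longrightarrow> A r > 0" and a_gt: "r \<in> R \<Longrightarrow> r * a r > 1"
    and smooth_A: "smooth_on R A" and smooth_a: "smooth_on R a"
    and deriv_A: "r \<in> R \<Longrightarrow> (A has_real_derivative - a r * A r) (at r)"
    and deriv_a: "r \<in> R \<Longrightarrow> (a has_real_derivative a r * b r * r - (a r)\<^sup>2 - b r) (at r)"
    and deriv_b: "r \<in> R \<Longrightarrow> (b has_real_derivative b1 r) (at r)"
begin

abbreviation H :: "complex^'n \<Rightarrow> complex^'n \<Rightarrow> complex" where "H \<equiv> herm k"

definition rsq :: "complex^'n \<Rightarrow> real" where "rsq w = - lorentz k w w"

definition cone :: "(complex^'n) set" where "cone = {w. rsq w \<in> R}"

definition hform :: "complex^'n \<Rightarrow> complex^'n \<Rightarrow> complex^'n \<Rightarrow> complex" where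
  "hform w u v = of_real (A (rsq w)) * (H u v + of_real (a (rsq w)) * H u w * H w v)"

definition gmetric :: "(complex^'n) metric" where
  "gmetric w u v = Re (hform w u v)"

text \<open>The Chern connection of the Hermitian form. The first two coefficients arise from dA/dr
  = - a A, because r changes by - H u w in the holomorphic direction u; the last one is fixed by the
  derivative of a. Being complex bilinear and symmetric, it is also the Levi-Civita
  connection.\<close>

definition \<Gamma> :: "complex^'n \<Rightarrow> complex^'n \<Rightarrow> complex^'n \<Rightarrow> complex^'n" where
  "\<Gamma> w u v = (of_real (a (rsq w)) * H u w) *s v + (of_real (a (rsq w)) * H v w) *s u
    + (of_real (b (rsq w)) * H u w * H v w) *s w"

lemma H_self: "H w w = - of_real (rsq w)"
proof -
  have "Im (H w w) = 0" using arg_cong[OF herm_commute[of k w w], of Im] by simp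
  then show ?thesis by (simp add: rsq_def lorentz_eq_Re_herm complex_eq_iff)
qed

lemma deriv_H:
  "((\<lambda>y. H u y) has_derivative (\<lambda>h. H u h)) (at w)" "((\<lambda>y. H y u) has_derivative (\<lambda>h. H h u)) (at w)"
  using bounded_bilinear.bounded_linear_right[OF bounded_bilinear_herm[of k], of u]
    bounded_bilinear.bounded_linear_left[OF bounded_bilinear_herm[of k], of u]
  by (auto intro: bounded_linear_imp_has_derivative)

lemma deriv_rsq: "(rsq has_derivative (\<lambda>h. - Re (H h w + H w h))) (at w)"
proof -
  have "((\<lambda>y. H y y) has_derivative (\<lambda>h. H w h + H h w)) (at w)"
    by (rule bounded_bilinear.FDERIV[OF bounded_bilinear_herm]) (auto intro: has_derivative_ident)
  from has_derivative_minus[OF bounded_linear.has_derivative[OF bounded_linear_Re this]]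
  show ?thesis
    unfolding rsq_def[abs_def] lorentz_eq_Re_herm by (simp add: add.commute)
qed

lemma smooth_rsq: "smooth_on V rsq"
proof -
  have id: "smooth_on UNIV (\<lambda>w::complex^'n. w)" by (rule smooth_on_bounded_linear) simp
  have "smooth_on UNIV (\<lambda>w. - Re (H w w))"
    by (intro smooth_on_minus smooth_on_compose_linear[OF bounded_linear_Re]
        smooth_on_bilinear[OF bounded_bilinear_herm] open_UNIV id)
  then have "smooth_on UNIV rsq" by (simp add: rsq_def[abs_def] lorentz_eq_Re_herm)
  then show ?thesis by (rule smooth_on_subset) simp
qed

lemma open_cone: "open cone"
proof -
  have "continuous_on UNIV rsq" by (rule smooth_on_continuous_on[OF smooth_rsq])
  then have "open (rsq -` R)" by (rule open_vimage[OF open_R])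
  then show ?thesis by (simp add: cone_def vimage_def)
qed

lemma deriv_radial:
  assumes "(f has_real_derivative f') (at (rsq w))"
  shows "((\<lambda>y. complex_of_real (f (rsq y))) has_derivative (\<lambda>h. - of_real f' * (H h w + H w h))) (at w)"
proof -
  have s: "complex_of_real (Re (H h w + H w h)) = H h w + H w h" for h
    using herm_commute[of k h w] by (simp add: complex_eq_iff)
  have "((\<lambda>y. f (rsq y)) has_derivative (\<lambda>h. f' * (- Re (H h w + H w h)))) (at w)"
    using has_derivative_compose[OF deriv_rsq assms[unfolded has_field_derivative_def]] .
  from bounded_linear.has_derivative[OF bounded_linear_of_real this]
  have "((\<lambda>y. complex_of_real (f (rsq y))) has_derivative
      (\<lambda>h. of_real f' * (- complex_of_real (Re (H h w + H w h))))) (at w)" by simp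
  then show ?thesis unfolding s by (simp only: mult_minus_left mult_minus_right)
qed

lemma bilinear_\<Gamma>: "bilinear (\<Gamma> w)"
  unfolding bilinear_def \<Gamma>_def
  by (intro conjI allI linearI)
    (simp_all add: herm_linear scaleR_eq_scalar vec_eq_iff algebra_simps)

lemma \<Gamma>_scale: "\<Gamma> w u (c *s v) = c *s \<Gamma> w u v"
  by (simp add: \<Gamma>_def herm_linear vec_eq_iff algebra_simps)

lemma sym_\<Gamma>: "\<Gamma> w u v = \<Gamma> w v u"
  by (simp add: \<Gamma>_def algebra_simps)

lemma hform_linear:
  "hform w (u + v) x = hform w u x + hform w v x" "hform w x (u + v) = hform w x u + hform w x v"
  "hform w (c *s u) v = c * hform w u v" "hform w u (c *s v) = cnj c * hform w u v"
  by (simp_all add: hform_def herm_linear algebra_simps)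

lemma hform_commute: "hform w v u = cnj (hform w u v)"
  by (simp add: hform_def herm_commute[symmetric])

lemma bilinear_gmetric: "bilinear (gmetric w)"
  unfolding bilinear_def gmetric_def
  by (intro conjI allI linearI) (simp_all add: hform_linear scaleR_eq_scalar)

lemma hform_diff: "hform w (u - v) x = hform w u x - hform w v x"
  using hform_linear(1)[of w "u - v" v x] by simp

lemma gmetric_pos:
  assumes w: "w \<in> cone" and u: "u \<noteq> 0"
  shows "gmetric w u u > 0"
proof -
  let ?r = "rsq w"
  have r: "?r > 0" "A ?r > 0" "?r * a ?r > 1"
    using w R_pos A_pos a_gt by (auto simp: cone_def)
  \<comment> \<open>As H w w = - r, this is the coefficient of u along w, and the rest d is
    orthogonal to w, where H is positive. The direction w contributes with the positive factor r (r
    a - 1).\<close>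
  define c where "c = - H u w / of_real ?r"
  define d where "d = u - c *s w"
  have ud: "u = d + c *s w" by (simp add: d_def)
  have dw: "H d w = 0" using r by (simp add: d_def herm_diff herm_linear H_self c_def)
  then have wd: "H w d = 0" using herm_commute[of k w d] by simp
  have "hform w u u = of_real (A ?r) * (H d d + c * cnj c * of_real (?r * (?r * a ?r - 1)))"
    unfolding hform_def ud by (simp add: herm_linear dw wd H_self algebra_simps)
  also have "c * cnj c = of_real ((cmod c)\<^sup>2)" by (simp add: complex_norm_square[symmetric])
  finally have g: "gmetric w u u = A ?r * (lorentz k d d + (cmod c)\<^sup>2 * (?r * (?r * a ?r - 1)))"
    by (simp add: gmetric_def lorentz_eq_Re_herm)
  have t: "?r * (?r * a ?r - 1) > 0" using r by simp
  have "lorentz k d d + (cmod c)\<^sup>2 * (?r * (?r * a ?r - 1)) > 0"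
  proof (cases "d = 0")
    case True
    then have "c \<noteq> 0" using u ud by auto
    moreover have "lorentz k d d = 0" using True by (simp add: lorentz_def)
    ultimately show ?thesis using t by simp
  next
    case False
    then have "lorentz k d d > 0"
      using herm_timelike_orthogonal[OF _ dw] r by (simp add: rsq_def)
    then show ?thesis using t by (simp add: add_pos_nonneg)
  qed
  then show ?thesis using g r by simp
qed

text \<open>The derivative separates by type: its complex linear part in h is the term with
  \<open>\<Gamma> w h v\<close>, its antilinear part the term with
  \<open>\<Gamma> w h x\<close>.\<close>

lemma hform_compatible:
  assumes w: "w \<in> cone"
  shows "((\<lambda>y. hform y v x) has_derivative (\<lambda>h. hform w (\<Gamma> w h v) x + hform w v (\<Gamma> w h x))) (at w)"
proof -
  let ?r = "rsq w"
  have r: "?r \<in> R" using w by (simp add: cone_def)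
  have "((\<lambda>y. hform y v x) has_derivative (\<lambda>h. of_real (A ?r) * (0 +
      (of_real (a ?r) * H v w * H h x + (of_real (a ?r) * H v h
        + - of_real (a ?r * b ?r * ?r - (a ?r)\<^sup>2 - b ?r) * (H h w + H w h) * H v w) * H w x))
      + - of_real (- a ?r * A ?r) * (H h w + H w h) * (H v x + of_real (a ?r) * H v w * H w x))) (at w)"
    unfolding hform_def
    by (intro has_derivative_mult has_derivative_add has_derivative_const deriv_H
        deriv_radial[OF deriv_A[OF r]] deriv_radial[OF deriv_a[OF r]])
  then show ?thesis
  proof (rule has_derivative_eq_rhs, intro ext)
    fix h
    have c: "cnj (H u w) = H w u" for u using herm_commute[of k w u] by simp
    show "of_real (A ?r) * (0 +
      (of_real (a ?r) * H v w * H h x + (of_real (a ?r) * H v h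
        + - of_real (a ?r * b ?r * ?r - (a ?r)\<^sup>2 - b ?r) * (H h w + H w h) * H v w) * H w x))
      + - of_real (- a ?r * A ?r) * (H h w + H w h) * (H v x + of_real (a ?r) * H v w * H w x)
      = hform w (\<Gamma> w h v) x + hform w v (\<Gamma> w h x)"
      unfolding hform_def \<Gamma>_def
      by (simp add: herm_linear c H_self) (simp add: algebra_simps power2_eq_square)
  qed
qed

lemma deriv_\<Gamma>:
  assumes w: "w \<in> cone"
  defines "r \<equiv> rsq w"
  defines "da h \<equiv> - of_real (a r * b r * r - (a r)\<^sup>2 - b r) * (H h w + H w h)"
  defines "db h \<equiv> - of_real (b1 r) * (H h w + H w h)"
  shows "((\<lambda>y. \<Gamma> y u v) has_derivative (\<lambda>h.
      (of_real (a r) * H u h + da h * H u w) *s v + (of_real (a r) * H v h + da h * H v w) *s u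
      + ((of_real (b r) * H u w * H v w) *s h
         + (of_real (b r) * H u w * H v h + (of_real (b r) * H u h + db h * H u w) * H v w) *s w))) (at w)"
proof -
  have r: "rsq w \<in> R" using w by (simp add: cone_def)
  note s = bounded_linear.has_derivative[OF bounded_bilinear.bounded_linear_left[OF bounded_bilinear_scalar]]
  show ?thesis
    unfolding \<Gamma>_def r_def da_def db_def
    by (intro has_derivative_add s bounded_bilinear.FDERIV[OF bounded_bilinear_scalar] has_derivative_mult
        deriv_H has_derivative_ident deriv_radial[OF deriv_a[OF r]] deriv_radial[OF deriv_b[OF r]])
qed

sublocale levi_civita cone gmetric \<Gamma>
proof
  show "open cone" by (rule open_cone)
  fix w u v x assume w: "w \<in> cone"
  show "bilinear (gmetric w)" "bilinear (\<Gamma> w)" "\<Gamma> w u v = \<Gamma> w v u"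
    by (rule bilinear_gmetric bilinear_\<Gamma> sym_\<Gamma>)+
  show "gmetric w u v = gmetric w v u" by (simp add: gmetric_def hform_commute[of w v u])
  show "gmetric w u u > 0" if "u \<noteq> 0" by (rule gmetric_pos[OF w that])
  show "((\<lambda>y. gmetric y v x) has_derivative (\<lambda>u. gmetric w (\<Gamma> w u v) x + gmetric w v (\<Gamma> w u x))) (at w)"
    using bounded_linear.has_derivative[OF bounded_linear_Re hform_compatible[OF w]]
    by (simp add: gmetric_def)
  show "(\<lambda>y. \<Gamma> y u v) differentiable (at w)"
    using deriv_\<Gamma>[OF w] differentiableI by blast
qed

text \<open>The curvature of a Kaehler metric is \<open>R(x, y)v = Q(y, v; x) - Q(x, v; y)\<close> with \<open>Q(x, u; y)\<close>
  the antiholomorphic derivative of \<open>\<Gamma>(x, u)\<close> in the direction \<open>y\<close>.\<close>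

definition a1 :: "complex^'n \<Rightarrow> real" where
  "a1 w = a (rsq w) * b (rsq w) * rsq w - (a (rsq w))\<^sup>2 - b (rsq w)"

definition Q :: "complex^'n \<Rightarrow> complex^'n \<Rightarrow> complex^'n \<Rightarrow> complex^'n \<Rightarrow> complex^'n" where
  "Q w x u y =
    (of_real (a (rsq w)) * H x y - of_real (a1 w) * H x w * H w y) *s u
    + (of_real (a (rsq w)) * H u y - of_real (a1 w) * H u w * H w y) *s x
    + (of_real (b (rsq w)) * (H x y * H u w + H x w * H u y)
        - of_real (b1 (rsq w)) * H w y * H x w * H u w) *s w"

lemma curvature_\<Gamma>:
  assumes w: "w \<in> cone"
  shows "connection_curvature \<Gamma> w x y v = Q w y v x - Q w x v y"
  unfolding connection_curvature_def
    fun_cong[OF frechet_derivative_at[OF deriv_\<Gamma>[OF w], symmetric]]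
  unfolding \<Gamma>_def Q_def a1_def
  by (simp add: herm_linear H_self vec_eq_iff) (simp add: algebra_simps power2_eq_square)

text \<open>The two coefficients are obtained by comparing those of H x y H u v and of H u v H x w H
  w y in \<open>hform_Q\<close>. The quartic term in w is then the only one left to match, and
  \<open>defect\<close> measures its failure.\<close>

definition S :: "complex^'n \<Rightarrow> complex^'n \<Rightarrow> complex^'n \<Rightarrow> complex" where
  "S w u v = of_real (a (rsq w) / 2) * H u v - of_real (a1 w + (a (rsq w))\<^sup>2 / 2) * H u w * H w v"

definition defect :: "real \<Rightarrow> real" where
  "defect r = A r * ((1 - r * a r) * b1 r - 2 * a r * (a r * b r * r - (a r)\<^sup>2 - b r) - 2 * (a r) ^ 3)"

lemma hform_Q:
  "hform w (Q w x u y) v = bochner_type (hform w) (S w) x y u v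
    - of_real (defect (rsq w)) * H x w * cnj (H y w) * H u w * cnj (H v w)"
proof -
  have c: "cnj (H u w) = H w u" for u using herm_commute[of k w u] by simp
  define p where "p = complex_of_real (a (rsq w) / 2)"
  have a: "complex_of_real (a (rsq w)) = 2 * p" by (simp add: p_def)
  have a1: "complex_of_real (a1 w) = 2 * p * of_real (b (rsq w)) * of_real (rsq w) - 4 * p * p - of_real (b (rsq w))"
    by (simp add: a1_def a power2_eq_square)
  have S: "S w u v = p * H u v - (of_real (a1 w) + 2 * p * p) * H u w * H w v" for u v
    by (simp add: S_def a power2_eq_square)
  have d: "complex_of_real (defect (rsq w)) = of_real (A (rsq w)) * ((1 - of_real (rsq w) * (2 * p)) * of_real (b1 (rsq w))
      - 4 * p * of_real (a1 w) - 16 * p * p * p)"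
    by (simp add: defect_def a1_def[symmetric] a power3_eq_cube)
  show ?thesis
    unfolding Q_def hform_linear bochner_type_def S c d unfolding hform_def H_self a
    by (rule bochner_type_identity[OF a1])
qed

lemma riemann_gmetric:
  assumes w: "w \<in> cone"
  shows "riemann gmetric w x y v u = Re (hform w (Q w y v x) u - hform w (Q w x v y) u)"
  by (simp add: riemann_eq[OF w] curvature_\<Gamma>[OF w] gmetric_def hform_diff)

end

section \<open>The cone metric in arbitrary holomorphic coordinates\<close>

lemma scalar_linear_of_\<i>:
  fixes P :: "complex^'n \<Rightarrow> complex^'n"
  assumes "linear P" "\<And>v. P (\<i> *s v) = \<i> *s P v"
  shows "P (c *s v) = c *s P v"
proof -
  have c: "c *s v = Re c *\<^sub>R v + Im c *\<^sub>R (\<i> *s v)" for v :: "complex^'n"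
    by (simp add: vec_eq_iff complex_eq_iff)
  show ?thesis
    unfolding c linear_add[OF assms(1)] linear_cmul[OF assms(1)] assms(2) ..
qed

lemma levi_civita_cong:
  assumes "levi_civita U G \<Gamma>" and eq: "\<And>z. z \<in> U \<Longrightarrow> G' z = G z"
  shows "levi_civita U G' \<Gamma>"
proof -
  interpret levi_civita U G \<Gamma> by fact
  show ?thesis
  proof
    fix z u v x assume z: "z \<in> U"
    show "((\<lambda>y. G' y v x) has_derivative (\<lambda>u. G' z (\<Gamma> z u v) x + G' z v (\<Gamma> z u x))) (at z)"
      unfolding eq[OF z]
      by (rule has_derivative_transform_within_open[OF compatible[OF z] open_U z]) (simp add: eq)
  qed (use open_U bilinear_G sym_G pos_G bilinear_\<Gamma> sym_\<Gamma> differentiable_\<Gamma> eq in auto)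
qed

text \<open>An arbitrary holomorphic parametrization seen through the special chart:
  \<open>\<psi>\<close> is the change of coordinates. Only on V is G' required to agree with the
  pullback.\<close>

locale cone_chart = cone_metric k R A a b b1
  for k :: "'n::finite" and R :: "real set" and A a b b1 :: "real \<Rightarrow> real" +
  fixes V :: "(complex^'n) set" and \<psi> :: "complex^'n \<Rightarrow> complex^'n" and G' :: "(complex^'n) metric"
  assumes open_V: "open V" and smooth_\<psi>: "smooth_on V \<psi>" and into: "\<psi> ` V \<subseteq> cone"
    and inj: "z \<in> V \<Longrightarrow> inj (frechet_derivative \<psi> (at z))"
    and holomorphic: "z \<in> V \<Longrightarrow> frechet_derivative \<psi> (at z) (\<i> *s v) = \<i> *s frechet_derivative \<psi> (at z) v"
    and G': "z \<in> V \<Longrightarrow> G' z = pullback_metric \<psi> gmetric z"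
begin

sublocale pb: levi_civita_pullback cone gmetric \<Gamma> V \<psi>
  by unfold_locales (use open_V smooth_\<psi> into inj in auto)

sublocale lc: levi_civita V G' pb.pullback_\<Gamma>
  by (rule levi_civita_cong[OF pb.pullback_levi_civita G'])

lemma P_scale: "z \<in> V \<Longrightarrow> frechet_derivative \<psi> (at z) (c *s v) = c *s frechet_derivative \<psi> (at z) v"
  by (rule scalar_linear_of_\<i>[OF pb.linear_P holomorphic])

lemma riemann_G':
  assumes z: "z \<in> V"
  shows "riemann G' z x y v u = riemann gmetric (\<psi> z) (pb.P z x) (pb.P z y) (pb.P z v) (pb.P z u)"
  using lc.riemann_eq[OF z] levi_civita.riemann_eq[OF pb.pullback_levi_civita z] pb.riemann_pullback[OF z]
  by (simp add: G'[OF z])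

lemma almost_bochner_G':
  assumes z: "z \<in> V"
  shows "almost_bochner G' z (\<lambda>u v. hform (\<psi> z) (pb.P z u) (pb.P z v)) (\<lambda>u v. S (\<psi> z) (pb.P z u) (pb.P z v))
    (of_real (defect (rsq (\<psi> z)))) (\<lambda>u. H (pb.P z u) (\<psi> z))"
proof
  note l = linear_add[OF pb.linear_P[OF z]] P_scale[OF z]
  show "sesquilinear (\<lambda>u v. hform (\<psi> z) (pb.P z u) (pb.P z v))"
    unfolding sesquilinear_def by (simp add: l hform_linear)
  show "sesquilinear (\<lambda>u v. S (\<psi> z) (pb.P z u) (pb.P z v))"
    unfolding sesquilinear_def by (simp add: S_def l herm_linear algebra_simps)
  fix u v x y c
  show "hform (\<psi> z) (pb.P z v) (pb.P z u) = cnj (hform (\<psi> z) (pb.P z u) (pb.P z v))"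
    by (rule hform_commute)
  show "S (\<psi> z) (pb.P z v) (pb.P z u) = cnj (S (\<psi> z) (pb.P z u) (pb.P z v))"
    by (simp add: S_def herm_commute[symmetric])
  show "H (pb.P z (c *s u)) (\<psi> z) = c * H (pb.P z u) (\<psi> z)" by (simp add: l herm_linear)
  show "G' z u v = Re (hform (\<psi> z) (pb.P z u) (pb.P z v))"
    by (simp add: G'[OF z] pullback_metric_def gmetric_def)
  show "G' z u u > 0" if "u \<noteq> 0" by (rule lc.pos_G[OF z that])
  show "riemann G' z x y v u = Re ((bochner_type (\<lambda>u v. hform (\<psi> z) (pb.P z u) (pb.P z v)) (\<lambda>u v. S (\<psi> z) (pb.P z u) (pb.P z v)) y x v u
      - of_real (defect (rsq (\<psi> z))) * H (pb.P z y) (\<psi> z) * cnj (H (pb.P z x) (\<psi> z)) * H (pb.P z v) (\<psi> z) * cnj (H (pb.P z u) (\<psi> z)))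
    - (bochner_type (\<lambda>u v. hform (\<psi> z) (pb.P z u) (pb.P z v)) (\<lambda>u v. S (\<psi> z) (pb.P z u) (pb.P z v)) x y v u
      - of_real (defect (rsq (\<psi> z))) * H (pb.P z x) (\<psi> z) * cnj (H (pb.P z y) (\<psi> z)) * H (pb.P z v) (\<psi> z) * cnj (H (pb.P z u) (\<psi> z))))"
    unfolding riemann_G'[OF z] riemann_gmetric[OF pb.in_U[OF z]] hform_Q bochner_type_def ..
qed

text \<open>The complex structure is parallel. This survives the change of coordinates because the
  differential of \<open>\<psi>\<close>, and hence its second derivative, commutes with
  multiplication by i.\<close>

lemma pullback_\<Gamma>_\<i>:
  assumes z: "z \<in> V"
  shows "pb.pullback_\<Gamma> z u (\<i> *s v) = \<i> *s pb.pullback_\<Gamma> z u v"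
proof (rule injD[OF inj[OF z]])
  have "bounded_linear (\<lambda>x::complex^'n. \<i> *s x)"
    by (rule bounded_bilinear.bounded_linear_right[OF bounded_bilinear_scalar])
  from frechet_derivative_compose_linear[OF this smooth_on_differentiable[OF smooth_on_frechet[OF smooth_\<psi>] z], of v u]
  have "pb.P2 z u (\<i> *s v) = \<i> *s pb.P2 z u v"
    using frechet_derivative_cong_open[OF open_V z holomorphic[of _ v]] by simp
  then show "pb.P z (pb.pullback_\<Gamma> z u (\<i> *s v)) = pb.P z (\<i> *s pb.pullback_\<Gamma> z u v)"
    unfolding P_scale[OF z] pb.P_pullback_\<Gamma>[OF z] by (simp add: \<Gamma>_scale vector_add_ldistrib)
qed

text \<open>For closedness, the three derivatives are expanded by metric compatibility and the
  factor i is moved out of the connection. The resulting six terms cancel in pairs by skewness of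
  the fundamental form and symmetry of the connection.\<close>

lemma kaehler_on_G': "kaehler_on V G'"
  unfolding kaehler_on_def
proof (intro conjI ballI allI impI)
  fix u v
  have "smooth_on V (\<lambda>z. A (rsq (\<psi> z)) * Re (H (pb.P z u) (pb.P z v) + of_real (a (rsq (\<psi> z))) * H (pb.P z u) (\<psi> z) * H (\<psi> z) (pb.P z v)))"
  proof -
    have r: "smooth_on V (\<lambda>z. rsq (\<psi> z))"
      by (rule smooth_on_compose[OF smooth_rsq smooth_\<psi> open_V open_UNIV]) simp
    have f: "smooth_on V (\<lambda>z. f (rsq (\<psi> z)))" if "smooth_on R f" for f :: "real \<Rightarrow> real"
      by (rule smooth_on_compose[OF that r open_V open_R]) (use into in \<open>auto simp: cone_def\<close>)
    show ?thesis
      by (intro smooth_on_mult smooth_on_add smooth_on_bilinear[OF bounded_bilinear_mult] smooth_on_bilinear[OF bounded_bilinear_herm]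
          smooth_on_compose_linear[OF bounded_linear_Re] smooth_on_compose_linear[OF bounded_linear_of_real]
          f smooth_A smooth_a smooth_on_frechet smooth_\<psi> open_V)
  qed
  then show "smooth_on V (\<lambda>z. G' z u v)"
    by (subst smooth_on_cong[OF open_V]) (auto simp: G' pullback_metric_def gmetric_def hform_def)
next
  fix z u v w assume z: "z \<in> V"
  show "bilinear (G' z)" by (rule lc.bilinear_G[OF z])
  show sym: "G' z u v = G' z v u" for u v by (rule lc.sym_G[OF z])
  show "G' z u u > 0" if "u \<noteq> 0" by (rule lc.pos_G[OF z that])
  show inv: "G' z (\<i> *s u) (\<i> *s v) = G' z u v" for u v
    by (simp add: G'[OF z] pullback_metric_def gmetric_def holomorphic[OF z] hform_linear)
  have fd: "frechet_derivative (\<lambda>y. G' y v x) (at z) u = G' z (pb.pullback_\<Gamma> z u v) x + G' z v (pb.pullback_\<Gamma> z u x)" for u v x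
    using fun_cong[OF frechet_derivative_at[OF lc.compatible[OF z, of v x]], of u] by simp
  have skew: "G' z (\<i> *s p) q = - G' z (\<i> *s q) p" for p q
  proof -
    have "G' z (\<i> *s p) q = G' z (\<i> *s (\<i> *s p)) (\<i> *s q)" by (simp only: inv)
    also have "\<i> *s (\<i> *s p) = - p" by (simp add: vec_eq_iff)
    finally show ?thesis using bilinear_lneg[OF lc.bilinear_G[OF z]] sym by simp
  qed
  show "frechet_derivative (\<lambda>y. G' y (\<i> *s v) w) (at z) u + frechet_derivative (\<lambda>y. G' y (\<i> *s w) u) (at z) v
      + frechet_derivative (\<lambda>y. G' y (\<i> *s u) v) (at z) w = 0"
    unfolding fd pullback_\<Gamma>_\<i>[OF z]
    using skew[of "pb.pullback_\<Gamma> z u v" w] skew[of "pb.pullback_\<Gamma> z v w" u] skew[of "pb.pullback_\<Gamma> z w u" v]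
      lc.sym_\<Gamma>[OF z, of u v] lc.sym_\<Gamma>[OF z, of v w] lc.sym_\<Gamma>[OF z, of w u] by simp
qed

end

section \<open>The meridian\<close>

text \<open>The interval may be unbounded, so its endpoints are taken in the extended reals.
  Openness of I makes them strict bounds.\<close>

lemma open_interval_antiderivative:
  fixes g :: "real \<Rightarrow> real"
  assumes "open I" "is_interval I" "continuous_on I g"
  shows "\<exists>L. \<forall>s\<in>I. (L has_real_derivative g s) (at s)"
proof (cases "I = {}")
  case False
  define a b where "a = Inf (ereal ` I)" and "b = Sup (ereal ` I)"
  have ab: "a < ereal s" "ereal s < b" if s: "s \<in> I" for s
  proof -
    obtain e where e: "e > 0" "cball s e \<subseteq> I" using open_contains_cball[of I] assms(1) s by blast
    have "s - e \<in> cball s e" "s + e \<in> cball s e" using e(1) by (simp_all add: dist_real_def)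
    then have m: "s - e \<in> I" "s + e \<in> I" using e(2) by blast+
    have "a \<le> ereal (s - e)" unfolding a_def by (rule Inf_lower[OF imageI[OF m(1)]])
    also have "ereal (s - e) < ereal s" using e(1) by simp
    finally show "a < ereal s" .
    have "ereal s < ereal (s + e)" using e(1) by simp
    also have "ereal (s + e) \<le> b" unfolding b_def by (rule Sup_upper[OF imageI[OF m(2)]])
    finally show "ereal s < b" .
  qed
  have mem: "s \<in> I" if s: "a < ereal s" "ereal s < b" for s
  proof -
    obtain x where x: "x \<in> I" "x < s" using s(1) unfolding a_def Inf_less_iff by auto
    obtain y where y: "y \<in> I" "s < y" using s(2) unfolding b_def less_Sup_iff by auto
    show ?thesis using assms(2) x y unfolding is_interval_1 by (meson less_imp_le)
  qed
  obtain s0 where "s0 \<in> I" using False by blast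
  then have "a < b" using ab less_trans by blast
  moreover have "isCont g s" if "a < ereal s" "ereal s < b" for s
    using mem[OF that] assms by (simp add: continuous_on_eq_continuous_at)
  ultimately obtain F where "\<forall>s::real. a < s \<longrightarrow> s < b \<longrightarrow> (F has_vector_derivative g s) (at s)"
    using einterval_antiderivative by blast
  then show ?thesis using ab by (auto simp: has_real_derivative_iff_has_vector_derivative)
qed simp

locale meridian =
  fixes I :: "real set" and t q L :: "real \<Rightarrow> real"
  assumes open_I: "open I" and interval_I: "is_interval I"
    and smooth_t: "smooth_on I t" and smooth_q: "smooth_on I q"
    and t_pos: "s \<in> I \<Longrightarrow> t s > 0" and t'_le: "s \<in> I \<Longrightarrow> deriv t s \<le> -1"
    and natural: "s \<in> I \<Longrightarrow> - (deriv t s)\<^sup>2 + (deriv q s)\<^sup>2 = -1"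
    and deriv_L: "s \<in> I \<Longrightarrow> (L has_real_derivative 1 / t s) (at s)"
begin

abbreviation t1 :: "real \<Rightarrow> real" where "t1 \<equiv> deriv t"
abbreviation t2 :: "real \<Rightarrow> real" where "t2 \<equiv> deriv t1"
abbreviation t3 :: "real \<Rightarrow> real" where "t3 \<equiv> deriv t2"

lemma smooth_t123: "smooth_on I t1" "smooth_on I t2" "smooth_on I t3"
  using smooth_on_deriv[OF open_I] smooth_t by blast+

lemma deriv_t123:
  assumes "s \<in> I"
  shows "(t has_real_derivative t1 s) (at s)" "(t1 has_real_derivative t2 s) (at s)"
    "(t2 has_real_derivative t3 s) (at s)"
  using assms smooth_t smooth_t123 smooth_on_DERIV by blast+

lemma deriv_q: "s \<in> I \<Longrightarrow> (q has_real_derivative deriv q s) (at s)"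
  using smooth_q smooth_on_DERIV by blast

lemma segment_I: "x \<in> I \<Longrightarrow> y \<in> I \<Longrightarrow> x \<le> z \<Longrightarrow> z \<le> y \<Longrightarrow> z \<in> I"
  using interval_I unfolding is_interval_1 by blast

lemma inj_on_of_deriv:
  fixes h h' :: "real \<Rightarrow> real"
  assumes "\<And>s. s \<in> I \<Longrightarrow> (h has_real_derivative h' s) (at s)" "\<And>s. s \<in> I \<Longrightarrow> h' s \<noteq> 0"
  shows "inj_on h I"
proof -
  have ne: "h x \<noteq> h y" if xy: "x \<in> I" "y \<in> I" "x < y" for x y
  proof -
    have d: "(h has_real_derivative h' z) (at z)" if "x \<le> z" "z \<le> y" for z
      by (rule assms(1)[OF segment_I[OF xy(1,2) that]])
    obtain z where z: "x < z" "z < y" "h y - h x = (y - x) * h' z"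
      using MVT2[OF xy(3) d] by blast
    have "z \<in> I" using segment_I[OF xy(1,2)] z(1,2) by simp
    then show ?thesis using assms(2)[of z] z(3) xy(3) by auto
  qed
  show ?thesis
  proof (rule inj_onI, rule ccontr)
    fix x y assume "x \<in> I" "y \<in> I" "h x = h y" "x \<noteq> y"
    then show False using ne[of x y] ne[of y x] by (metis linorder_neqE_linordered_idom)
  qed
qed

lemma t1_nz: "s \<in> I \<Longrightarrow> t1 s \<noteq> 0"
  using t'_le[of s] by auto

lemma inj_t: "inj_on t I"
  by (rule inj_on_of_deriv[OF deriv_t123(1) t1_nz])

lemma smooth_L: "smooth_on I L"
  by (rule smooth_on_realI[OF open_I deriv_L])
    (auto intro!: smooth_on_divide open_I smooth_on_const smooth_t dest: t_pos)

definition f :: "real \<Rightarrow> real" where "f s = exp (L s)"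

text \<open>The value of r = - H(w, w) at w = f(s) n. Its derivative 2 r / t has no zero, so s
  becomes a smooth function \<open>par\<close> of r with d/dr = (t / (2 r)) d/ds.\<close>

definition ell :: "real \<Rightarrow> real" where "ell s = (f s)\<^sup>2"

definition radii :: "real set" where "radii = ell ` I"

definition par :: "real \<Rightarrow> real" where "par = the_inv_into I ell"

lemma f_pos: "f s > 0" and ell_pos: "ell s > 0"
  by (simp_all add: f_def ell_def)

lemma deriv_f: "s \<in> I \<Longrightarrow> (f has_real_derivative f s / t s) (at s)"
  unfolding f_def[abs_def] by (auto intro!: derivative_eq_intros deriv_L)

lemma deriv_ell: "s \<in> I \<Longrightarrow> (ell has_real_derivative 2 * ell s / t s) (at s)"
  unfolding ell_def[abs_def] by (auto intro!: derivative_eq_intros deriv_f simp: power2_eq_square)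

lemma smooth_f: "smooth_on I f"
  unfolding f_def[abs_def] by (rule smooth_on_compose[OF smooth_on_exp smooth_L open_I open_UNIV]) simp

lemma smooth_ell: "smooth_on I ell"
  unfolding ell_def[abs_def] power2_eq_square by (intro smooth_on_mult open_I smooth_f)

lemma ell'_nz: "s \<in> I \<Longrightarrow> 2 * ell s / t s \<noteq> 0"
  using ell_pos[of s] t_pos[of s] by simp

lemma inj_ell: "inj_on ell I"
  by (rule inj_on_of_deriv[OF deriv_ell ell'_nz])

lemma deriv_ell_nz: "s \<in> I \<Longrightarrow> deriv ell s \<noteq> 0"
  using DERIV_imp_deriv[OF deriv_ell] ell'_nz by simp

lemma open_radii: "open radii" and smooth_par: "smooth_on radii par"
  unfolding radii_def par_def
  using smooth_on_the_inv_into[OF open_I inj_ell smooth_ell deriv_ell_nz] by blast+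

lemma par_ell: "s \<in> I \<Longrightarrow> par (ell s) = s"
  unfolding par_def by (rule the_inv_into_f_f[OF inj_ell])

lemma par_in: "r \<in> radii \<Longrightarrow> par r \<in> I" and ell_par: "r \<in> radii \<Longrightarrow> ell (par r) = r"
  by (auto simp: radii_def par_ell)

lemma deriv_par:
  assumes "r \<in> radii"
  shows "(par has_real_derivative t (par r) / (2 * r)) (at r)"
  using the_inv_into_DERIV[OF open_I inj_ell deriv_ell par_in[OF assms] ell'_nz[OF par_in[OF assms]]] ell_par[OF assms]
  by (simp add: par_def)

lemma deriv_par_compose:
  assumes "r \<in> radii" "(g has_real_derivative g') (at (par r))"
  shows "((\<lambda>r. g (par r)) has_real_derivative g' * (t (par r) / (2 * r))) (at r)"
  using DERIV_chain2[OF assms(2) deriv_par[OF assms(1)]] .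

lemma smooth_par_compose:
  fixes g :: "real \<Rightarrow> 'b::real_normed_vector"
  shows "smooth_on I g \<Longrightarrow> smooth_on radii (\<lambda>r. g (par r))"
  by (rule smooth_on_compose[OF _ smooth_par open_radii open_I]) (auto simp: par_in)

lemma radii_pos: "r \<in> radii \<Longrightarrow> r > 0"
  by (auto simp: radii_def ell_pos)

text \<open>This is r^2 b, found by solving the equation for da/dr in \<open>cone_metric\<close> for
  b; the denominator \<open>t1 s\<close> is 1 - r a.\<close>

definition nb :: "real \<Rightarrow> real" where "nb s = 1 - t1 s + t s * t2 s / (2 * t1 s)"

definition nb' :: "real \<Rightarrow> real" where
  "nb' s = - t2 s / 2 + t s * t3 s / (2 * t1 s) - t s * (t2 s)\<^sup>2 / (2 * (t1 s)\<^sup>2)"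

definition coeff_A :: "real \<Rightarrow> real" where "coeff_A r = (t (par r))\<^sup>2 / r"
definition coeff_a :: "real \<Rightarrow> real" where "coeff_a r = (1 - t1 (par r)) / r"
definition coeff_b :: "real \<Rightarrow> real" where "coeff_b r = nb (par r) / r\<^sup>2"
definition coeff_b1 :: "real \<Rightarrow> real" where
  "coeff_b1 r = (nb' (par r) * t (par r) / 2 - 2 * nb (par r)) / r ^ 3"

lemma deriv_nb: "s \<in> I \<Longrightarrow> (nb has_real_derivative nb' s) (at s)"
  unfolding nb_def[abs_def] nb'_def
  by (auto intro!: derivative_eq_intros deriv_t123 simp: t1_nz field_simps power2_eq_square)

lemma smooth_id: "smooth_on V (\<lambda>x::real. x)"
  by (rule smooth_on_bounded_linear) simp

lemma cone_metric_meridian: "cone_metric radii coeff_A coeff_a coeff_b coeff_b1"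
proof
  show "open radii" by (rule open_radii)
  show "smooth_on radii coeff_A"
    unfolding coeff_A_def[abs_def] power2_eq_square
    by (intro smooth_on_divide smooth_on_mult open_radii smooth_par_compose smooth_t smooth_id)
      (use radii_pos in force)
  show "smooth_on radii coeff_a"
    unfolding coeff_a_def[abs_def]
    by (intro smooth_on_divide smooth_on_diff open_radii smooth_on_const smooth_par_compose smooth_t123 smooth_id)
      (use radii_pos in force)
  fix r assume r: "r \<in> radii"
  then have r0: "r > 0" by (rule radii_pos)
  define s where "s = par r"
  have s: "s \<in> I" using par_in[OF r] by (simp add: s_def)
  have p: "t s > 0" "t1 s \<le> -1" "t1 s \<noteq> 0" using t_pos t'_le t1_nz s by auto
  note d = deriv_par_compose[OF r deriv_t123(1)[OF s[unfolded s_def]]] deriv_par_compose[OF r deriv_t123(2)[OF s[unfolded s_def]]]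
    deriv_par_compose[OF r deriv_nb[OF s[unfolded s_def]]]
  show "r > 0" by (rule r0)
  show "coeff_A r > 0" using p r0 by (simp add: coeff_A_def s_def)
  show "r * coeff_a r > 1" using p r0 by (simp add: coeff_a_def s_def)
  show "(coeff_A has_real_derivative - coeff_a r * coeff_A r) (at r)"
    unfolding coeff_A_def[abs_def] coeff_a_def
    by (rule derivative_eq_intros d refl)+
      (use r0 in \<open>simp_all add: field_simps power2_eq_square\<close>)
  show "(coeff_a has_real_derivative coeff_a r * coeff_b r * r - (coeff_a r)\<^sup>2 - coeff_b r) (at r)"
    unfolding coeff_a_def[abs_def] coeff_b_def nb_def
    by (rule derivative_eq_intros d refl)+
      (use r0 p in \<open>simp_all add: s_def[symmetric] field_simps power2_eq_square\<close>)
  show "(coeff_b has_real_derivative coeff_b1 r) (at r)"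
    unfolding coeff_b_def[abs_def] coeff_b1_def
    by (rule derivative_eq_intros d refl)+
      (use r0 in \<open>simp_all add: field_simps power2_eq_square power3_eq_cube\<close>)
qed

text \<open>With p = t' regarded as a function of t one has t'' = p dp/dt and t' t''' - t''^2 = p^3
  d^2p/dt^2, so this is p^3 times the Euler operator, written without inverting t.\<close>

definition ode :: "real \<Rightarrow> real" where
  "ode s = (t s)\<^sup>2 * (t1 s * t3 s - (t2 s)\<^sup>2) - 5 * t s * (t1 s)\<^sup>2 * t2 s + 8 * (t1 s) ^ 3 * (t1 s - 1)"

lemma defect_eq:
  assumes s: "s \<in> I"
  shows "cone_metric.defect coeff_A coeff_a coeff_b coeff_b1 (ell s) = (t s)\<^sup>2 / (4 * t1 s * ell s ^ 4) * ode s"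
proof -
  define x p p2 p3 u v r where "x = t s" and "p = t1 s" and "p2 = t2 s" and "p3 = t3 s"
    and "u = nb s" and "v = nb' s" and "r = ell s"
  note d = x_def[symmetric] p_def[symmetric] p2_def[symmetric] p3_def[symmetric] u_def[symmetric] v_def[symmetric] r_def[symmetric]
  have r: "r \<noteq> 0" using ell_pos[of s] by (simp add: r_def)
  have p: "p \<noteq> 0" using t1_nz[OF s] by (simp add: p_def)
  have u: "2 * p * u = 2 * p * (1 - p) + x * p2"
    using p by (simp add: u_def nb_def d(1-4) field_simps)
  have v: "2 * p\<^sup>2 * v = - p\<^sup>2 * p2 + x * p3 * p - x * p2\<^sup>2"
    using p by (simp add: v_def nb'_def d(1-4) field_simps power2_eq_square)
  \<comment> \<open>This is r^3 times the bracket in \<open>defect\<close>; the cubes of 1 - p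
    cancel.\<close>
  define Z where "Z = p * (v * x / 2 - 2 * u) + 2 * (1 - p) * p * u"
  have "4 * p * Z = x * (2 * p\<^sup>2 * v) - 4 * p\<^sup>2 * (2 * p * u)"
    unfolding Z_def by (simp add: algebra_simps power2_eq_square)
  also have "\<dots> = ode s"
    unfolding u v ode_def d by (simp add: algebra_simps power2_eq_square power3_eq_cube)
  finally have Z: "ode s = 4 * p * Z" ..
  have pr: "par r = s" unfolding r_def by (rule par_ell[OF s])
  have "cone_metric.defect coeff_A coeff_a coeff_b coeff_b1 r = x\<^sup>2 / r * ((1 - r * ((1 - p) / r)) * ((v * x / 2 - 2 * u) / r ^ 3)
      - 2 * ((1 - p) / r) * ((1 - p) / r * (u / r\<^sup>2) * r - ((1 - p) / r)\<^sup>2 - u / r\<^sup>2) - 2 * ((1 - p) / r) ^ 3)"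
    unfolding cone_metric.defect_def[OF cone_metric_meridian] coeff_A_def coeff_a_def coeff_b_def coeff_b1_def pr d ..
  also have "\<dots> = x\<^sup>2 / r * (Z / r ^ 3)"
  proof -
    have "(1 - r * ((1 - p) / r)) = p" "(1 - p) / r * (u / r\<^sup>2) * r = (1 - p) * u / r\<^sup>2"
      using r by simp_all
    then show ?thesis
      using r by (simp add: Z_def field_simps power2_eq_square power3_eq_cube)
  qed
  also have "\<dots> = x\<^sup>2 / (4 * p * r ^ 4) * ode s"
    using p r by (simp add: Z power4_eq_xxxx power3_eq_cube)
  finally show ?thesis by (simp add: d)
qed

text \<open>As a function of \<open>t\<close>, the derivative \<open>p = t'\<close> satisfies the Euler equation
  \<open>t\<^sup>2 p'' - 5 t p' + 8 (p - 1) = 0\<close>; the constants \<open>c1\<close>, \<open>c2\<close> are its first integrals.\<close>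

lemma ode_iff: "(\<forall>s\<in>I. ode s = 0) \<longleftrightarrow> (\<exists>c1 c2. \<forall>s\<in>I. t1 s = c1 * t s ^ 4 + c2 * t s ^ 2 + 1)"
proof
  assume o: "\<forall>s\<in>I. ode s = 0"
  \<comment> \<open>The quotient \<open>t2 s / t1 s\<close> is dp/dt. The characteristic exponents
    are 2 and 4, and the operator t d/dt - 2 applied to p - 1 removes the square and leaves 2 c1
    t^4; likewise 4 - t d/dt leaves 2 c2 t^2.\<close>
  define C1 where "C1 s = (t s * (t2 s / t1 s) - 2 * (t1 s - 1)) / (2 * t s ^ 4)" for s
  define C2 where "C2 s = (4 * (t1 s - 1) - t s * (t2 s / t1 s)) / (2 * (t s)\<^sup>2)" for s
  have "(C1 has_real_derivative 0) (at s)" "(C2 has_real_derivative 0) (at s)" if s: "s \<in> I" for s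
  proof -
    have p: "t s \<noteq> 0" "t1 s \<noteq> 0" using t_pos[OF s] t1_nz[OF s] by auto
    let ?N = "t1 s * (t2 s / t1 s) + t s * ((t3 s * t1 s - t2 s * t2 s) / (t1 s * t1 s))"
    have N: "((\<lambda>s. t s * (t2 s / t1 s)) has_real_derivative ?N) (at s)"
      by (rule DERIV_cong[OF DERIV_mult[OF deriv_t123(1)[OF s] DERIV_divide[OF deriv_t123(3,2)[OF s] p(2)]]])
        (simp add: algebra_simps)
    have n1: "((\<lambda>s. t s * (t2 s / t1 s) - 2 * (t1 s - 1)) has_real_derivative ?N - 2 * t2 s) (at s)"
      by (rule DERIV_diff[OF N]) (auto intro!: derivative_eq_intros deriv_t123[OF s])
    have n2: "((\<lambda>s. 4 * (t1 s - 1) - t s * (t2 s / t1 s)) has_real_derivative 4 * t2 s - ?N) (at s)"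
      by (rule DERIV_diff[OF _ N]) (auto intro!: derivative_eq_intros deriv_t123[OF s])
    have d1: "((\<lambda>s. 2 * t s ^ 4) has_real_derivative 8 * t s ^ 3 * t1 s) (at s)"
      and d2: "((\<lambda>s. 2 * (t s)\<^sup>2) has_real_derivative 4 * t s * t1 s) (at s)"
      by (auto intro!: derivative_eq_intros deriv_t123[OF s])
    have 1: "(C1 has_real_derivative ((?N - 2 * t2 s) * (2 * t s ^ 4)
        - (t s * (t2 s / t1 s) - 2 * (t1 s - 1)) * (8 * t s ^ 3 * t1 s)) / ((2 * t s ^ 4) * (2 * t s ^ 4))) (at s)"
      unfolding C1_def[abs_def] by (rule DERIV_divide[OF n1 d1]) (simp add: p)
    have 2: "(C2 has_real_derivative ((4 * t2 s - ?N) * (2 * (t s)\<^sup>2)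
        - (4 * (t1 s - 1) - t s * (t2 s / t1 s)) * (4 * t s * t1 s)) / ((2 * (t s)\<^sup>2) * (2 * (t s)\<^sup>2))) (at s)"
      unfolding C2_def[abs_def] by (rule DERIV_divide[OF n2 d2]) (simp add: p)
    have e1: "((?N - 2 * t2 s) * (2 * t s ^ 4) - (t s * (t2 s / t1 s) - 2 * (t1 s - 1)) * (8 * t s ^ 3 * t1 s))
        = 2 * t s ^ 3 / (t1 s)\<^sup>2 * ode s"
      unfolding ode_def using p by (simp add: field_simps power2_eq_square power3_eq_cube power4_eq_xxxx)
    show "(C1 has_real_derivative 0) (at s)" using 1[unfolded e1] o s by simp
    have e2: "((4 * t2 s - ?N) * (2 * (t s)\<^sup>2) - (4 * (t1 s - 1) - t s * (t2 s / t1 s)) * (4 * t s * t1 s))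
        = - 2 * t s / (t1 s)\<^sup>2 * ode s"
      unfolding ode_def using p by (simp add: field_simps power2_eq_square power3_eq_cube power4_eq_xxxx)
    show "(C2 has_real_derivative 0) (at s)" using 2[unfolded e2] o s by simp
  qed
  then obtain c1 c2 where c: "\<forall>s\<in>I. C1 s = c1" "\<forall>s\<in>I. C2 s = c2"
    using has_field_derivative_zero_constant[OF is_interval_convex[OF interval_I], of C1]
      has_field_derivative_zero_constant[OF is_interval_convex[OF interval_I], of C2]
    by (meson has_field_derivative_at_within)
  have "t1 s = c1 * t s ^ 4 + c2 * t s ^ 2 + 1" if s: "s \<in> I" for s
  proof -
    have p: "t s \<noteq> 0" using t_pos[OF s] by auto
    have "C1 s * t s ^ 4 = (t s * (t2 s / t1 s) - 2 * (t1 s - 1)) / 2"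
      "C2 s * (t s)\<^sup>2 = (4 * (t1 s - 1) - t s * (t2 s / t1 s)) / 2"
      using p by (simp_all add: C1_def C2_def)
    then have "C1 s * t s ^ 4 + C2 s * (t s)\<^sup>2 = t1 s - 1" by (simp add: field_simps)
    then show ?thesis using c s by simp
  qed
  then show "\<exists>c1 c2. \<forall>s\<in>I. t1 s = c1 * t s ^ 4 + c2 * t s ^ 2 + 1" by blast
next
  assume "\<exists>c1 c2. \<forall>s\<in>I. t1 s = c1 * t s ^ 4 + c2 * t s ^ 2 + 1"
  then obtain c1 c2 where c: "\<And>s. s \<in> I \<Longrightarrow> t1 s = c1 * t s ^ 4 + c2 * t s ^ 2 + 1" by blast
  have d2: "t2 s = (4 * c1 * t s ^ 3 + 2 * c2 * t s) * t1 s" if s: "s \<in> I" for s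
  proof -
    have "((\<lambda>s. c1 * t s ^ 4 + c2 * t s ^ 2 + 1) has_real_derivative (4 * c1 * t s ^ 3 + 2 * c2 * t s) * t1 s) (at s)"
      by (auto intro!: derivative_eq_intros deriv_t123[OF s] simp: algebra_simps)
    then have "(t1 has_real_derivative (4 * c1 * t s ^ 3 + 2 * c2 * t s) * t1 s) (at s)"
      by (rule has_field_derivative_transform_within_open[OF _ open_I s]) (simp add: c)
    then show ?thesis by (rule DERIV_unique[OF deriv_t123(2)[OF s]])
  qed
  have d3: "t3 s = (12 * c1 * (t s)\<^sup>2 + 2 * c2) * (t1 s)\<^sup>2 + (4 * c1 * t s ^ 3 + 2 * c2 * t s) * t2 s" if s: "s \<in> I" for s
  proof -
    have "((\<lambda>s. (4 * c1 * t s ^ 3 + 2 * c2 * t s) * t1 s) has_real_derivative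
        (12 * c1 * (t s)\<^sup>2 + 2 * c2) * (t1 s)\<^sup>2 + (4 * c1 * t s ^ 3 + 2 * c2 * t s) * t2 s) (at s)"
      by (auto intro!: derivative_eq_intros deriv_t123[OF s] simp: algebra_simps power2_eq_square)
    then have "(t2 has_real_derivative
        (12 * c1 * (t s)\<^sup>2 + 2 * c2) * (t1 s)\<^sup>2 + (4 * c1 * t s ^ 3 + 2 * c2 * t s) * t2 s) (at s)"
      by (rule has_field_derivative_transform_within_open[OF _ open_I s]) (simp add: d2)
    then show ?thesis by (rule DERIV_unique[OF deriv_t123(3)[OF s]])
  qed
  show "\<forall>s\<in>I. ode s = 0"
  proof
    fix s assume s: "s \<in> I"
    define x where "x = t s"
    define p where "p = t1 s"
    have p: "p = c1 * x ^ 4 + c2 * x ^ 2 + 1" using c[OF s] by (simp add: p_def x_def)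
    have "ode s = p ^ 3 * (x\<^sup>2 * (12 * c1 * x\<^sup>2 + 2 * c2) - 5 * x * (4 * c1 * x ^ 3 + 2 * c2 * x) + 8 * (p - 1))"
      unfolding ode_def d3[OF s] d2[OF s] x_def[symmetric] p_def[symmetric] by algebra
    also have "\<dots> = 0" unfolding p by algebra
    finally show "ode s = 0" .
  qed
qed

end

section \<open>The holomorphic chart of the hypersurface\<close>

locale rotational = meridian I t q L for I t q L +
  fixes k :: "'n::finite"
begin

sublocale c: cone_metric k radii coeff_A coeff_a coeff_b coeff_b1
  by (rule cone_metric_meridian)

abbreviation H :: "complex^'n \<Rightarrow> complex^'n \<Rightarrow> complex" where "H \<equiv> herm k"
abbreviation rsq :: "complex^'n \<Rightarrow> real" where "rsq \<equiv> c.rsq"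
abbreviation cone :: "(complex^'n) set" where "cone \<equiv> c.cone"
abbreviation M :: "((complex^'n) \<times> real) set" where "M \<equiv> rot_hypersurface k I t q"
abbreviation J :: "(complex^'n) \<times> real \<Rightarrow> (complex^'n) \<times> real \<Rightarrow> (complex^'n) \<times> real" where "J \<equiv> rot_J k I t q"
abbreviation g :: "((complex^'n) \<times> real) metric" where "g \<equiv> rot_metric k I t q"

text \<open>At the point with parameters (s, n) the first component has - H equal to t(s)^2.
  Inverting this function recovers s by a formula that also makes sense off the
  hypersurface.\<close>

definition sq :: "real \<Rightarrow> real" where "sq s = (t s)\<^sup>2"

lemma deriv_sq: "s \<in> I \<Longrightarrow> (sq has_real_derivative 2 * t s * t1 s) (at s)"
  unfolding sq_def[abs_def] by (auto intro!: derivative_eq_intros deriv_t123)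

lemma sq'_nz: "s \<in> I \<Longrightarrow> 2 * t s * t1 s \<noteq> 0"
  using t_pos[of s] t1_nz[of s] by simp

lemma inj_sq: "inj_on sq I"
  by (rule inj_on_of_deriv[OF deriv_sq sq'_nz])

lemma smooth_sq: "smooth_on I sq"
  unfolding sq_def[abs_def] power2_eq_square by (intro smooth_on_mult open_I smooth_t)

lemma open_sq: "open (sq ` I)" and smooth_inv_sq: "smooth_on (sq ` I) (the_inv_into I sq)"
proof -
  have "deriv sq s \<noteq> 0" if "s \<in> I" for s
    using DERIV_imp_deriv[OF deriv_sq[OF that]] sq'_nz[OF that] by simp
  then show "open (sq ` I)" "smooth_on (sq ` I) (the_inv_into I sq)"
    using smooth_on_the_inv_into[OF open_I inj_sq smooth_sq] by blast+
qed

section \<open>The chart, its inverse and their smoothness\<close>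

definition chart :: "complex^'n \<Rightarrow> (complex^'n) \<times> real" where
  "chart w = ((t (par (rsq w)) / f (par (rsq w))) *\<^sub>R w, q (par (rsq w)))"

definition unchart :: "(complex^'n) \<times> real \<Rightarrow> complex^'n" where
  "unchart p = (let s = the_inv_into I sq (rsq (fst p)) in (f s / t s) *\<^sub>R fst p)"

lemma rsq_scaleR: "rsq (a *\<^sub>R w) = a\<^sup>2 * rsq w"
  by (simp add: c.rsq_def lorentz_scale power2_eq_square)

lemma ell_in_radii: "s \<in> I \<Longrightarrow> ell s \<in> radii"
  by (simp add: radii_def)

lemma coneD:
  assumes "w \<in> cone"
  shows "rsq w \<in> radii" "par (rsq w) \<in> I" "rsq w = (f (par (rsq w)))\<^sup>2" "rsq w > 0"
  using assms par_in[of "rsq w"] ell_par[of "rsq w"] radii_pos[of "rsq w"]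
  by (auto simp: c.cone_def ell_def)

lemma unit_normal:
  assumes "w \<in> cone"
  shows "(1 / f (par (rsq w))) *\<^sub>R w \<in> hyperquadric k"
    "chart w = rot_point t q (par (rsq w), (1 / f (par (rsq w))) *\<^sub>R w)"
proof -
  let ?f = "f (par (rsq w))"
  have "rsq ((1 / ?f) *\<^sub>R w) = (1 / ?f)\<^sup>2 * ?f\<^sup>2" unfolding rsq_scaleR using coneD(3)[OF assms] by simp
  also have "\<dots> = 1" using f_pos[of "par (rsq w)"] by (simp add: power_divide)
  finally show "(1 / ?f) *\<^sub>R w \<in> hyperquadric k"
    by (simp add: hyperquadric_def c.rsq_def)
  show "chart w = rot_point t q (par (rsq w), (1 / ?f) *\<^sub>R w)"
    by (simp add: chart_def rot_point_simp)
qed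

lemma chart_in_M: "w \<in> cone \<Longrightarrow> chart w \<in> M"
  using unit_normal coneD(2) unfolding rot_hypersurface_def by blast

lemma M_cases:
  assumes "p \<in> M"
  obtains s n where "s \<in> I" "n \<in> hyperquadric k" "p = (t s *\<^sub>R n, q s)" "rsq (fst p) = sq s" "unchart p = f s *\<^sub>R n"
proof -
  obtain s n where sn: "s \<in> I" "n \<in> hyperquadric k" "p = (t s *\<^sub>R n, q s)"
    using assms unfolding rot_hypersurface_def by (auto simp: rot_point_simp)
  have n: "rsq n = 1" using sn(2) by (simp add: hyperquadric_def c.rsq_def)
  have r: "rsq (fst p) = sq s" by (simp add: sn(3) rsq_scaleR n sq_def)
  have "unchart p = f s *\<^sub>R n"
    unfolding unchart_def r the_inv_into_f_f[OF inj_sq sn(1)] Let_def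
    using t_pos[OF sn(1)] by (simp add: sn(3))
  then show ?thesis using that sn r by blast
qed

lemma unchart_in_cone: "p \<in> M \<Longrightarrow> unchart p \<in> cone"
  and chart_unchart: "p \<in> M \<Longrightarrow> chart (unchart p) = p"
proof -
  assume "p \<in> M"
  then obtain s n where sn: "s \<in> I" "n \<in> hyperquadric k" "p = (t s *\<^sub>R n, q s)" "unchart p = f s *\<^sub>R n"
    by (rule M_cases)
  have n: "rsq n = 1" using sn(2) by (simp add: hyperquadric_def c.rsq_def)
  have r: "rsq (unchart p) = ell s" by (simp add: sn(4) rsq_scaleR n ell_def)
  then show "unchart p \<in> cone" using sn(1) by (simp add: c.cone_def ell_in_radii)
  show "chart (unchart p) = p"
    unfolding chart_def r par_ell[OF sn(1)] unfolding sn(4) using f_pos[of s] by (simp add: sn(3))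
qed

lemma unchart_chart:
  assumes w: "w \<in> cone"
  shows "unchart (chart w) = w"
proof -
  let ?s = "par (rsq w)"
  have "rsq (fst (chart w)) = (t ?s / f ?s)\<^sup>2 * (f ?s)\<^sup>2"
    unfolding chart_def fst_conv rsq_scaleR using coneD(3)[OF w] by simp
  also have "\<dots> = sq ?s" using f_pos[of ?s] by (simp add: sq_def power_divide)
  finally show ?thesis
    using f_pos[of ?s] t_pos[OF coneD(2)[OF w]]
    by (simp add: unchart_def the_inv_into_f_f[OF inj_sq coneD(2)[OF w]] chart_def)
qed

text \<open>Smoothness is a notion for open sets, and M is not open in the ambient space. On this
  neighbourhood \<open>unchart\<close> is smooth, so its composition with any smooth parametrization
  of M is smooth as well.\<close>

definition M_nbhd :: "((complex^'n) \<times> real) set" where "M_nbhd = {p. rsq (fst p) \<in> sq ` I}"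

lemma smooth_rsq_fst: "smooth_on V (\<lambda>p::(complex^'n) \<times> real. rsq (fst p))"
proof -
  have "smooth_on UNIV (\<lambda>p::(complex^'n) \<times> real. rsq (fst p))"
    by (rule smooth_on_compose[OF c.smooth_rsq smooth_on_bounded_linear[OF bounded_linear_fst]
        open_UNIV open_UNIV subset_UNIV])
  then show ?thesis by (rule smooth_on_subset) simp
qed

lemma open_M_nbhd: "open M_nbhd"
proof -
  have "open ((\<lambda>p::(complex^'n) \<times> real. rsq (fst p)) -` (sq ` I))"
    by (rule open_vimage[OF open_sq smooth_on_continuous_on[OF smooth_rsq_fst]])
  then show ?thesis by (simp add: M_nbhd_def vimage_def)
qed

lemma M_subset_nbhd: "M \<subseteq> M_nbhd"
  by (auto simp: M_nbhd_def elim!: M_cases)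

lemma smooth_unchart: "smooth_on M_nbhd unchart"
proof -
  have s: "smooth_on M_nbhd (\<lambda>p. the_inv_into I sq (rsq (fst p)))"
    by (rule smooth_on_compose[OF smooth_inv_sq smooth_rsq_fst open_M_nbhd open_sq]) (auto simp: M_nbhd_def)
  have ft: "smooth_on I (\<lambda>s. f s / t s)"
    by (rule smooth_on_divide[OF open_I smooth_f smooth_t]) (use t_pos in force)
  have into: "(\<lambda>p. the_inv_into I sq (rsq (fst p))) ` M_nbhd \<subseteq> I"
    by (auto simp: M_nbhd_def the_inv_into_f_f[OF inj_sq])
  show ?thesis
    unfolding unchart_def[abs_def] Let_def
    by (intro smooth_on_bilinear[OF bounded_bilinear_scaleR open_M_nbhd]
        smooth_on_compose[OF ft s open_M_nbhd open_I into] smooth_on_bounded_linear bounded_linear_fst)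
qed

lemma smooth_chart: "smooth_on cone chart"
proof -
  have r: "smooth_on cone (\<lambda>w. u (rsq w))" if "smooth_on radii u" for u :: "real \<Rightarrow> real"
    by (rule smooth_on_compose[OF that c.smooth_rsq c.open_cone open_radii]) (auto simp: c.cone_def)
  have tf: "smooth_on I (\<lambda>s. t s / f s)"
    by (rule smooth_on_divide[OF open_I smooth_t smooth_f]) (simp add: f_def)
  show ?thesis
    unfolding chart_def[abs_def]
    by (intro smooth_on_Pair smooth_on_bilinear[OF bounded_bilinear_scaleR] c.open_cone
        r[OF smooth_par_compose[OF tf]] r[OF smooth_par_compose[OF smooth_q]] smooth_on_bounded_linear bounded_linear_ident)
qed

text \<open>The differential of the parameter s as a function of w.\<close>

definition sig :: "complex^'n \<Rightarrow> complex^'n \<Rightarrow> real" where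
  "sig w u = - (t (par (rsq w)) / rsq w) * Re (H u w)"

definition dchart :: "complex^'n \<Rightarrow> complex^'n \<Rightarrow> (complex^'n) \<times> real" where
  "dchart w u = (let s = par (rsq w) in
    ((t s / f s) *\<^sub>R u + ((t1 s - 1) / f s * sig w u) *\<^sub>R w, deriv q s * sig w u))"

lemma deriv_chart:
  assumes w: "w \<in> cone"
  shows "(chart has_derivative dchart w) (at w)"
proof -
  let ?s = "par (rsq w)"
  note r = coneD(1)[OF w] and s = coneD(2)[OF w]
  have p: "((\<lambda>w. par (rsq w)) has_derivative sig w) (at w)"
  proof -
    have "((\<lambda>w. par (rsq w)) has_derivative (\<lambda>h. t ?s / (2 * rsq w) * (- Re (H h w + H w h)))) (at w)"
      using has_derivative_compose[OF c.deriv_rsq deriv_par[OF r, unfolded has_field_derivative_def]] .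
    moreover have "t ?s / (2 * rsq w) * (- Re (H h w + H w h)) = sig w h" for h
      using herm_commute[of k h w] by (simp add: sig_def)
    ultimately show ?thesis by simp
  qed
  have "((\<lambda>s. t s / f s) has_real_derivative (t1 ?s - 1) / f ?s) (at ?s)"
    by (rule DERIV_cong[OF DERIV_divide[OF deriv_t123(1)[OF s] deriv_f[OF s]]])
      (use f_pos[of ?s] t_pos[OF s] in \<open>auto simp: field_simps\<close>)
  from has_derivative_compose[OF p this[unfolded has_field_derivative_def]]
  have 1: "((\<lambda>w. t (par (rsq w)) / f (par (rsq w))) has_derivative (\<lambda>h. (t1 ?s - 1) / f ?s * sig w h)) (at w)" .
  have 2: "((\<lambda>w. q (par (rsq w))) has_derivative (\<lambda>h. deriv q ?s * sig w h)) (at w)"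
    using has_derivative_compose[OF p deriv_q[OF s, unfolded has_field_derivative_def]] .
  show ?thesis
    unfolding chart_def[abs_def] dchart_def[abs_def] Let_def
    by (intro has_derivative_Pair has_derivative_scaleR 1 2 has_derivative_ident)
qed

lemma frechet_chart: "w \<in> cone \<Longrightarrow> frechet_derivative chart (at w) = dchart w"
  using frechet_derivative_at[OF deriv_chart] by simp

lemma rot_at_chart:
  assumes w: "w \<in> cone"
  defines "s \<equiv> par (rsq w)"
  shows "rot_param k I t q (chart w) = (s, (1 / f s) *\<^sub>R w)"
    "rot_xi k I t q (chart w) = ((t1 s / f s) *\<^sub>R w, deriv q s)"
    "rot_xi_tilde k I t q (chart w) = ((1 / f s) *\<^sub>R (\<i> *s w), 0)"
proof -
  have s: "s \<in> I" using coneD(2)[OF w] by (simp add: s_def)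
  have d: "t differentiable (at s)" "q differentiable (at s)"
    using smooth_on_differentiable[OF smooth_t s] smooth_on_differentiable[OF smooth_q s] by auto
  have pos: "\<forall>s\<in>I. t s > 0" using t_pos by blast
  note n = unit_normal[OF w, folded s_def]
  show "rot_param k I t q (chart w) = (s, (1 / f s) *\<^sub>R w)"
    by (rule rot_param_p[OF inj_t pos d natural[OF s] s n])
  show "rot_xi k I t q (chart w) = ((t1 s / f s) *\<^sub>R w, deriv q s)"
    using rot_xi_eq[OF inj_t pos d natural[OF s] s n] by simp
  have "\<i> *s ((1 / f s) *\<^sub>R w) = (1 / f s) *\<^sub>R (\<i> *s w)"
    by (simp add: scaleR_eq_scalar vec_eq_iff)
  then show "rot_xi_tilde k I t q (chart w) = ((1 / f s) *\<^sub>R (\<i> *s w), 0)"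
    using rot_xi_tilde_eq[OF inj_t pos d natural[OF s] s n] by simp
qed

lemma Re_H:
  "lorentz k u v = Re (H u v)" "Re (H (a *\<^sub>R u) v) = a * Re (H u v)" "Re (H u (a *\<^sub>R v)) = a * Re (H u v)"
  "Re (H (u + u') v) = Re (H u v) + Re (H u' v)" "Re (H u (v + v')) = Re (H u v) + Re (H u v')"
  "Re (H (\<i> *s u) v) = - Im (H u v)"
  by (simp_all add: lorentz_eq_Re_herm herm_linear scaleR_eq_scalar)

lemma H_self: "w \<in> cone \<Longrightarrow> H w w = - of_real ((f (par (rsq w)))\<^sup>2)"
  using c.H_self[of w] coneD(3)[of w] by simp

lemma Re_Im_H_commute: "Re (H w u) = Re (H u w)" "Im (H w u) = - Im (H u w)"
  using herm_commute[of k w u] by simp_all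

text \<open>The sign in the first value reflects that \<open>\<xi>\<close> has square -1. By
  \<open>sig_\<i>\<close> the second value is ds at i u, so that the pair of forms behaves under i
  as it must for J to become multiplication by i in the chart.\<close>

lemma eta_dchart:
  assumes w: "w \<in> cone"
  shows "rot_eta k I t q (chart w) (dchart w u) = - sig w u"
    "rot_eta_tilde k I t q (chart w) (dchart w u) = t (par (rsq w)) / rsq w * Im (H u w)"
proof -
  define s where "s = par (rsq w)"
  note s' = s_def[symmetric]
  have r: "rsq w = f s * f s" using coneD(3)[OF w] by (simp add: s_def power2_eq_square)
  have f: "f s \<noteq> 0" using f_pos[of s] by simp
  have t: "t s \<noteq> 0" using t_pos[OF coneD(2)[OF w]] by (simp add: s_def)
  have q2: "deriv q s * deriv q s = t1 s * t1 s - 1"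
    using natural[OF coneD(2)[OF w]] by (simp add: s_def power2_eq_square)
  have Hw: "Re (H w w) = - (f s * f s)" "Im (H w w) = 0"
    using H_self[OF w] by (simp_all add: s_def power2_eq_square)
  have sig: "Re (H u w) = - sig w u * (f s * f s) / t s"
    using f t unfolding sig_def s' by (simp add: r)
  have "rot_eta k I t q (chart w) (dchart w u) =
      t1 s / f s * (t s / f s * Re (H u w) + (t1 s - 1) / f s * sig w u * Re (H w w)) + deriv q s * deriv q s * sig w u"
    unfolding rot_eta_def rot_at_chart[OF w] dchart_def Let_def ambient_metric_def s' fst_conv snd_conv Re_H
      Re_Im_H_commute(1)[of w u] using f by (simp add: field_simps)
  also have "\<dots> = - sig w u" unfolding q2 sig Hw using f t by (simp add: field_simps)
  finally show "rot_eta k I t q (chart w) (dchart w u) = - sig w u" .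
  show "rot_eta_tilde k I t q (chart w) (dchart w u) = t (par (rsq w)) / rsq w * Im (H u w)"
    unfolding rot_eta_tilde_def rot_at_chart[OF w] dchart_def Let_def ambient_metric_def s' fst_conv snd_conv Re_H
    by (simp add: Re_Im_H_commute(2)[of w u] Hw herm_linear scaleR_eq_scalar r)
qed

lemma sig_\<i>: "sig w (\<i> *s u) = t (par (rsq w)) / rsq w * Im (H u w)"
  by (simp add: sig_def herm_linear)

lemma J_dchart:
  assumes w: "w \<in> cone"
  shows "J (chart w) (dchart w u) = dchart w (\<i> *s u)"
  unfolding rot_J_def Let_def eta_dchart[OF w] rot_at_chart[OF w]
  unfolding dchart_def Let_def sig_\<i> J0_def
  by (simp add: vec_eq_iff complex_eq_iff algebra_simps diff_divide_distrib add_divide_distrib)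

lemma g_dchart:
  assumes w: "w \<in> cone"
  shows "g (chart w) (dchart w u) (dchart w v) = c.gmetric w u v"
proof -
  define s where "s = par (rsq w)"
  note s' = s_def[symmetric]
  have r: "rsq w = f s * f s" using coneD(3)[OF w] by (simp add: s_def power2_eq_square)
  have f: "f s \<noteq> 0" using f_pos[of s] by simp
  have t: "t s \<noteq> 0" using t_pos[OF coneD(2)[OF w]] by (simp add: s_def)
  have q2: "deriv q s * deriv q s = t1 s * t1 s - 1"
    using natural[OF coneD(2)[OF w]] by (simp add: s_def power2_eq_square)
  have Hw: "Re (H w w) = - (f s * f s)" "Im (H w w) = 0"
    using H_self[OF w] by (simp_all add: s_def power2_eq_square)
  have sig: "Re (H u w) = - sig w u * (f s * f s) / t s" for u
    using f t unfolding sig_def s' by (simp add: r)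
  define x y where "x = t s / f s" and "y = (t1 s - 1) / f s"
  have "ambient_metric k (dchart w u) (dchart w v) =
      x\<^sup>2 * Re (H u v) + x * y * (sig w v * Re (H u w) + sig w u * Re (H v w))
      + y\<^sup>2 * sig w u * sig w v * Re (H w w) + deriv q s * deriv q s * (sig w u * sig w v)"
    unfolding dchart_def Let_def ambient_metric_def s' x_def[symmetric] y_def[symmetric] fst_conv snd_conv
      Re_H Re_Im_H_commute(1)[of w v]
    by (simp add: algebra_simps power2_eq_square)
  \<comment> \<open>Since q'^2 = t'^2 - 1, all terms with ds cancel: the chart is conformal from the
    flat Lorentz metric to the induced one, and only the added multiple of the two squares deforms
    it.\<close>
  also have "\<dots> = (t s / f s)\<^sup>2 * Re (H u v)"
    unfolding q2 Hw unfolding sig x_def y_def using f t by (simp add: field_simps power2_eq_square)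
  finally have amb: "ambient_metric k (dchart w u) (dchart w v) = (t s / f s)\<^sup>2 * Re (H u v)" .
  have "g (chart w) (dchart w u) (dchart w v) = (t s / f s)\<^sup>2 * Re (H u v)
      + (1 - t1 s) * (t s / rsq w)\<^sup>2 * (Re (H u w) * Re (H v w) + Im (H u w) * Im (H v w))"
    unfolding rot_metric_def amb eta_dchart[OF w] rot_at_chart[OF w] fst_conv s'
    by (simp add: sig_def s' power2_eq_square algebra_simps diff_divide_distrib add_divide_distrib)
  also have "\<dots> = c.gmetric w u v"
    unfolding c.gmetric_def c.hform_def coeff_A_def coeff_a_def s' unfolding r
    using f by (simp add: Re_Im_H_commute[of w v] field_simps power2_eq_square)
  finally show ?thesis .
qed

lemma linear_dchart: "w \<in> cone \<Longrightarrow> linear (dchart w)"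
  using has_derivative_linear[OF deriv_chart] .

text \<open>A vector in the kernel has length zero for the pulled back metric, which is positive
  definite.\<close>

lemma inj_dchart:
  assumes w: "w \<in> cone"
  shows "inj (dchart w)"
proof (subst linear_injective_0[OF linear_dchart[OF w]], intro allI impI)
  fix u assume "dchart w u = 0"
  then have "dchart w u = dchart w 0" using linear_0[OF linear_dchart[OF w]] by simp
  then have "c.gmetric w u u = c.gmetric w 0 0"
    using g_dchart[OF w] by metis
  also have "\<dots> = 0" using bilinear_lzero[OF c.bilinear_gmetric] by simp
  finally show "u = 0" using c.gmetric_pos[OF w, of u] by fastforce
qed

lemma holomorphic_param_chart: "holomorphic_param M J cone chart" and chart_image: "chart ` cone = M"
proof -
  show im: "chart ` cone = M"
    using chart_in_M unchart_in_cone chart_unchart by force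
  have "homeomorphism cone M chart unchart"
    unfolding homeomorphism_def
    using im smooth_on_continuous_on[OF smooth_chart] unchart_chart chart_unchart unchart_in_cone
      continuous_on_subset[OF smooth_on_continuous_on[OF smooth_unchart] M_subset_nbhd]
    by (auto simp: image_iff) (metis chart_in_M unchart_chart)
  then show "holomorphic_param M J cone chart"
    unfolding holomorphic_param_def im
    using c.open_cone smooth_chart inj_dchart J_dchart by (auto simp: frechet_chart)
qed

text \<open>The differential of the parametrization factors through that of the chart. Both carry i
  to J, and the latter is injective, so the change of coordinates is holomorphic and
  immersive.\<close>

lemma cone_chart_of_param:
  assumes hp: "holomorphic_param M J U \<phi>"
  shows "cone_chart k radii coeff_A coeff_a coeff_b coeff_b1 U (\<lambda>z. unchart (\<phi> z)) (pullback_metric \<phi> g)"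
proof -
  let ?\<psi> = "\<lambda>z. unchart (\<phi> z)"
  have U: "open U" and sm: "smooth_on U \<phi>" and im: "\<phi> ` U \<subseteq> M"
    and inj: "\<And>z. z \<in> U \<Longrightarrow> inj (frechet_derivative \<phi> (at z))"
    and Jc: "\<And>z v. z \<in> U \<Longrightarrow> frechet_derivative \<phi> (at z) (\<i> *s v) = J (\<phi> z) (frechet_derivative \<phi> (at z) v)"
    using hp unfolding holomorphic_param_def by auto
  have sm\<psi>: "smooth_on U ?\<psi>"
    by (rule smooth_on_compose[OF smooth_unchart sm U open_M_nbhd]) (use im M_subset_nbhd in blast)
  have cone: "?\<psi> z \<in> cone" and eq: "chart (?\<psi> z) = \<phi> z" if "z \<in> U" for z
    using unchart_in_cone chart_unchart im that by blast+
  have d: "frechet_derivative \<phi> (at z) v = dchart (?\<psi> z) (frechet_derivative ?\<psi> (at z) v)" if z: "z \<in> U" for z v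
  proof -
    have "((\<lambda>z. chart (?\<psi> z)) has_derivative (\<lambda>v. dchart (?\<psi> z) (frechet_derivative ?\<psi> (at z) v))) (at z)"
      by (rule has_derivative_compose[OF smooth_on_has_derivative[OF sm\<psi> z] deriv_chart[OF cone[OF z]]])
    then have "(\<phi> has_derivative (\<lambda>v. dchart (?\<psi> z) (frechet_derivative ?\<psi> (at z) v))) (at z)"
      by (rule has_derivative_transform_within_open[OF _ U z]) (rule eq)
    from frechet_derivative_at[OF this] show ?thesis by metis
  qed
  show ?thesis
  proof
    show "open U" "smooth_on U ?\<psi>" "?\<psi> ` U \<subseteq> cone" using U sm\<psi> cone by auto
    fix z v assume z: "z \<in> U"
    show "inj (frechet_derivative ?\<psi> (at z))"
      using inj[OF z] by (auto simp: inj_def d[OF z])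
    have "dchart (?\<psi> z) (frechet_derivative ?\<psi> (at z) (\<i> *s v)) = dchart (?\<psi> z) (\<i> *s frechet_derivative ?\<psi> (at z) v)"
      using Jc[OF z, of v] unfolding d[OF z] J_dchart[OF cone[OF z], unfolded eq[OF z]] .
    then show "frechet_derivative ?\<psi> (at z) (\<i> *s v) = \<i> *s frechet_derivative ?\<psi> (at z) v"
      by (rule injD[OF inj_dchart[OF cone[OF z]]])
    show "pullback_metric \<phi> g z = pullback_metric ?\<psi> c.gmetric z"
      unfolding pullback_metric_def d[OF z] g_dchart[OF cone[OF z], unfolded eq[OF z]] ..
  qed
qed

theorem bochner_kaehler_iff:
  assumes "CARD('n) \<ge> 2"
  shows "bochner_kaehler M g J \<longleftrightarrow> (\<forall>s\<in>I. ode s = 0)"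
proof
  assume ode: "\<forall>s\<in>I. ode s = 0"
  have "bochner (pullback_metric \<phi> g) z \<alpha> \<beta> \<gamma> \<delta> = 0" if hp: "holomorphic_param M J U \<phi>" and z: "z \<in> U" for U \<phi> z \<alpha> \<beta> \<gamma> \<delta>
  proof -
    interpret ch: cone_chart k radii coeff_A coeff_a coeff_b coeff_b1 U "\<lambda>z. unchart (\<phi> z)" "pullback_metric \<phi> g"
      by (rule cone_chart_of_param[OF hp])
    have "unchart (\<phi> z) \<in> cone" using ch.into z by blast
    then have "c.defect (rsq (unchart (\<phi> z))) = 0"
      using defect_eq[OF coneD(2)] ode coneD(1,2) by (simp add: ell_par)
    then show ?thesis
      using almost_bochner.bochner_eq_0[OF ch.almost_bochner_G'[OF z]] by simp
  qed
  then show "bochner_kaehler M g J"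
    unfolding bochner_kaehler_def
    using holomorphic_param_chart chart_image cone_chart.kaehler_on_G'[OF cone_chart_of_param] by blast
next
  assume bk: "bochner_kaehler M g J"
  interpret ch: cone_chart k radii coeff_A coeff_a coeff_b coeff_b1 cone "\<lambda>z. unchart (chart z)" "pullback_metric chart g"
    by (rule cone_chart_of_param[OF holomorphic_param_chart])
  \<comment> \<open>The dimension hypothesis supplies a basis vector orthogonal to the k-axis, on
    which the linear form of \<open>bochner_eq_0_imp\<close> will vanish.\<close>
  obtain j where jk: "j \<noteq> k"
    using assms by (metis (full_types) One_nat_def UNIV_I card_1_singleton_iff card_le_Suc0_iff_eq finite_class.finite_UNIV not_less_eq_eq numeral_2_eq_2)
  have P: "frechet_derivative (\<lambda>z. unchart (chart z)) (at w) v = v" if w: "w \<in> cone" for w v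
  proof -
    have "frechet_derivative (\<lambda>z. unchart (chart z)) (at w) = frechet_derivative (\<lambda>z. z) (at w)"
      by (rule frechet_derivative_cong_open[OF c.open_cone w unchart_chart])
    then show ?thesis by (simp add: frechet_derivative_ident)
  qed
  show "\<forall>s\<in>I. ode s = 0"
  proof
    fix s assume s: "s \<in> I"
    \<comment> \<open>The defect depends on r alone, so one point for each s suffices. On the k-axis
      the j-th basis vector is orthogonal both to w and, for the metric form, to the k-th
      one.\<close>
    define w where "w = (of_real (f s) :: complex) *s (axis k 1 :: complex^'n)"
    have H: "H (axis j 1) (axis k 1) = 0" "H (axis k 1) (axis k 1) = -1"
      using jk by (auto simp: herm_def axis_def)
    have "rsq w = ell s"
      by (simp add: c.rsq_def w_def lorentz_eq_Re_herm herm_linear H ell_def power2_eq_square)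
    moreover from this have w: "w \<in> cone" using s by (simp add: c.cone_def ell_in_radii)
    moreover have Hw: "H (axis j 1) w = 0" "H (axis k 1) w \<noteq> 0"
      using f_pos[of s] by (auto simp: w_def herm_linear H)
    have "bochner (pullback_metric chart g) w \<alpha> \<beta> \<gamma> \<delta> = 0" for \<alpha> \<beta> \<gamma> \<delta>
      using bk holomorphic_param_chart w unfolding bochner_kaehler_def by blast
    from almost_bochner.bochner_eq_0_imp[OF ch.almost_bochner_G'[OF w] this, of j k]
    have "c.defect (rsq w) = 0"
      by (simp add: P[OF w] unchart_chart[OF w] Hw H c.hform_def)
    ultimately show "ode s = 0"
      using defect_eq[OF s] t_pos[OF s] t1_nz[OF s] ell_pos[of s] by auto
  qed
qed

end

theorem proposition6p13:
  fixes k :: "'n::finite" and I :: "real set" and t q :: "real \<Rightarrow> real"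
  assumes "CARD('n) \<ge> 2"
    and "rot_type_III k I t q"
    and "\<forall>s\<in>I. deriv t s \<le> -1"
  shows "bochner_kaehler (rot_hypersurface k I t q) (rot_metric k I t q) (rot_J k I t q) \<longleftrightarrow>
    (\<exists>c1 c2 :: real. \<forall>x\<in>t ` I. c1 * x^4 + c2 * x^2 + 1 \<noteq> 0 \<and>
       (the_inv_into I t has_real_derivative 1 / (c1 * x^4 + c2 * x^2 + 1)) (at x))"
proof -
  have I: "open I" "is_interval I" "smooth_on I t" "smooth_on I q" and pos: "\<And>s. s \<in> I \<Longrightarrow> t s > 0"
    and nat: "\<And>s. s \<in> I \<Longrightarrow> - (deriv t s)\<^sup>2 + (deriv q s)\<^sup>2 = -1"
    using assms(2) unfolding rot_type_III_def by auto
  have "continuous_on I (\<lambda>s. 1 / t s)"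
    using smooth_on_continuous_on[OF I(3)] pos by (intro continuous_intros) force+
  then obtain L where L: "\<forall>s\<in>I. (L has_real_derivative 1 / t s) (at s)"
    using open_interval_antiderivative[OF I(1,2)] by blast
  interpret rotational I t q L k
    by unfold_locales (use I pos nat L assms(3) in auto)
  have "(\<forall>s\<in>I. t1 s = c1 * t s ^ 4 + c2 * t s ^ 2 + 1) \<longleftrightarrow>
    (\<forall>x\<in>t ` I. c1 * x^4 + c2 * x^2 + 1 \<noteq> 0 \<and>
       (the_inv_into I t has_real_derivative 1 / (c1 * x^4 + c2 * x^2 + 1)) (at x))" for c1 c2
  proof -
    have "t1 s = c1 * t s ^ 4 + c2 * t s ^ 2 + 1 \<longleftrightarrow> c1 * t s ^ 4 + c2 * t s ^ 2 + 1 \<noteq> 0 \<and>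
       (the_inv_into I t has_real_derivative 1 / (c1 * t s ^ 4 + c2 * t s ^ 2 + 1)) (at (t s))" if s: "s \<in> I" for s
    proof -
      have d: "(the_inv_into I t has_real_derivative 1 / t1 s) (at (t s))"
        by (rule the_inv_into_DERIV[OF open_I inj_t deriv_t123(1) s t1_nz[OF s]])
      show ?thesis
      proof
        assume "t1 s = c1 * t s ^ 4 + c2 * t s ^ 2 + 1"
        then show "c1 * t s ^ 4 + c2 * t s ^ 2 + 1 \<noteq> 0 \<and>
          (the_inv_into I t has_real_derivative 1 / (c1 * t s ^ 4 + c2 * t s ^ 2 + 1)) (at (t s))"
          using d t1_nz[OF s] by simp
      next
        assume a: "c1 * t s ^ 4 + c2 * t s ^ 2 + 1 \<noteq> 0 \<and>
          (the_inv_into I t has_real_derivative 1 / (c1 * t s ^ 4 + c2 * t s ^ 2 + 1)) (at (t s))"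
        then have "1 / t1 s = 1 / (c1 * t s ^ 4 + c2 * t s ^ 2 + 1)"
          using DERIV_unique[OF d] by blast
        then show "t1 s = c1 * t s ^ 4 + c2 * t s ^ 2 + 1"
          using t1_nz[OF s] a by simp
      qed
    qed
    then show ?thesis by auto
  qed
  then show ?thesis
    unfolding bochner_kaehler_iff[OF assms(1)] ode_iff by simp
qed

end
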